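(* Let $\textsc{Input}$ be one of the ten matroid input types, and let $N$ be a fixed matroid. Consider the decision problem DETECTING AN $N$-MINOR: given $(M,\, \textsc{Input})$, does $M$ have a minor isomorphic to $N$? If $\textsc{Input} \leq$ CIRCUITS or $\textsc{Input} \leq$ HYPERPLANES, then DETECTING AN $N$-MINOR is in P, for every fixed matroid $N$.
   Context: All matroids are finite. A matroid $M$ on a ground set $E$ with $|E| = n$ is described to a Turing machine by a word $(M,\, \textsc{Input})$ over a finite alphabet, where $\textsc{Input}$ is one of ten input types. RANK: a list of every subset of $E$ together with its rank. INDEPENDENT SETS, SPANNING SETS, BASES, FLATS, CIRCUITS, HYPERPLANES: a list of all independent sets, spanning sets, bases, flats, circuits, respectively hyperplanes of $M$. NON-SPANNING CIRCUITS: the rank $r(M)$ together with a list of all non-spanning circuits (only the rank if there are none). DEPENDENT HYPERPLANES: the rank $r(M)$ together with a list of all dependent hyperplanes (only the rank if there are none). CYCLIC FLATS: a list of all cyclic flats (flats that are a possibly empty union of circuits), each together with its rank. Subsets of $E$ are encoded by characteristic vectors and encodings are reasonable (no padding), so a description listing $i$ subsets has length $\Theta(ni)$. For input types $I_1, I_2$, we write $I_1 \leq I_2$ if there is a Turing machine running in time polynomial in the length of its input which, for every matroid $M$, given $(M, I_1)$ produces $(M, I_2)$. *)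

theory Defs
  imports "HOL-Computational_Algebra.Polynomial"
begin

section \<open>Finite matroids\<close>

record 'a matroid =
  ground :: "'a set"
  indep :: "'a set set"

definition matroid :: "'a matroid \<Rightarrow> bool" where
  "matroid M \<longleftrightarrow>
     finite (ground M) \<and>
     (\<forall>I\<in>indep M. I \<subseteq> ground M) \<and>
     {} \<in> indep M \<and>
     (\<forall>I\<in>indep M. \<forall>J. J \<subseteq> I \<longrightarrow> J \<in> indep M) \<and>
     (\<forall>I\<in>indep M. \<forall>J\<in>indep M. card I < card J \<longrightarrow> (\<exists>e\<in>J - I. insert e I \<in> indep M))"

definition rank :: "'a matroid \<Rightarrow> 'a set \<Rightarrow> nat" where
  "rank M X = Max (card ` {I \<in> indep M. I \<subseteq> X})"

definition basis_of :: "'a matroid \<Rightarrow> 'a set \<Rightarrow> 'a set \<Rightarrow> bool" where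
  "basis_of M X B \<longleftrightarrow>
     B \<in> indep M \<and> B \<subseteq> X \<and> (\<forall>I\<in>indep M. B \<subseteq> I \<and> I \<subseteq> X \<longrightarrow> I = B)"

definition bases :: "'a matroid \<Rightarrow> 'a set set" where
  "bases M = {B. basis_of M (ground M) B}"

definition spanning_sets :: "'a matroid \<Rightarrow> 'a set set" where
  "spanning_sets M = {X. X \<subseteq> ground M \<and> rank M X = rank M (ground M)}"

definition flats :: "'a matroid \<Rightarrow> 'a set set" where
  "flats M = {F. F \<subseteq> ground M \<and> (\<forall>e\<in>ground M - F. rank M F < rank M (insert e F))}"

definition circuits :: "'a matroid \<Rightarrow> 'a set set" where
  "circuits M = {C. C \<subseteq> ground M \<and> C \<notin> indep M \<and> (\<forall>D. D \<subset> C \<longrightarrow> D \<in> indep M)}"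

text \<open>Written without subtraction, so that a matroid of rank 0 has no hyperplanes.\<close>

definition hyperplanes :: "'a matroid \<Rightarrow> 'a set set" where
  "hyperplanes M = {H \<in> flats M. rank M H + 1 = rank M (ground M)}"

definition nonspanning_circuits :: "'a matroid \<Rightarrow> 'a set set" where
  "nonspanning_circuits M = circuits M - spanning_sets M"

definition dependent_hyperplanes :: "'a matroid \<Rightarrow> 'a set set" where
  "dependent_hyperplanes M = hyperplanes M - indep M"

definition cyclic_flats :: "'a matroid \<Rightarrow> 'a set set" where
  "cyclic_flats M = {F \<in> flats M. \<exists>\<C> \<subseteq> circuits M. F = \<Union>\<C>}"


section \<open>Minors\<close>

definition delete :: "'a matroid \<Rightarrow> 'a set \<Rightarrow> 'a matroid" where
  "delete M Y = \<lparr>ground = ground M - Y, indep = {I \<in> indep M. I \<subseteq> ground M - Y}\<rparr>"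

definition contract :: "'a matroid \<Rightarrow> 'a set \<Rightarrow> 'a matroid" where
  "contract M X =
     \<lparr>ground = ground M - X,
      indep = {I. I \<subseteq> ground M - X \<and> (\<exists>B. basis_of M X B \<and> I \<union> B \<in> indep M)}\<rparr>"

definition isomorphic :: "'a matroid \<Rightarrow> 'b matroid \<Rightarrow> bool" where
  "isomorphic M N \<longleftrightarrow>
     (\<exists>f. bij_betw f (ground M) (ground N) \<and>
          (\<forall>I. I \<subseteq> ground M \<longrightarrow> (I \<in> indep M \<longleftrightarrow> f ` I \<in> indep N)))"

definition has_minor :: "'a matroid \<Rightarrow> 'b matroid \<Rightarrow> bool" where
  "has_minor M N \<longleftrightarrow>
     (\<exists>X Y. X \<subseteq> ground M \<and> Y \<subseteq> ground M \<and> X \<inter> Y = {} \<and>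
            isomorphic (delete (contract M X) Y) N)"


section \<open>Turing machines\<close>

text \<open>
  Deterministic machines with a fixed positive number of two-way infinite tapes. Inputs and outputs
  are words over the alphabet \<open>letter\<close>; the symbols \<open>Aux i\<close> are available for internal use.
\<close>

datatype letter = Zero | One | Sep

type_synonym word = "letter list"

datatype cell = Blank | Letter letter | Aux nat

datatype move = MoveLeft | Stay | MoveRight

record machine =
  tapes :: nat
  alphabet :: "cell set"
  states :: "nat set"
  start :: nat
  acc :: nat
  rej :: nat
  delta :: "nat \<Rightarrow> cell list \<Rightarrow> nat \<times> (cell \<times> move) list"

definition turing_machine :: "machine \<Rightarrow> bool" where
  "turing_machine T \<longleftrightarrow>
     tapes T \<ge> 1 \<and>
     finite (alphabet T) \<and> insert Blank (range Letter) \<subseteq> alphabet T \<and>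
     finite (states T) \<and> {start T, acc T, rej T} \<subseteq> states T \<and> acc T \<noteq> rej T \<and>
     (\<forall>q \<in> states T - {acc T, rej T}. \<forall>cs.
        length cs = tapes T \<and> set cs \<subseteq> alphabet T \<longrightarrow>
          (case delta T q cs of (q', as) \<Rightarrow>
             q' \<in> states T \<and> length as = tapes T \<and> fst ` set as \<subseteq> alphabet T))"

text \<open>A tape is its contents together with the position of the head.\<close>

type_synonym tape = "(int \<Rightarrow> cell) \<times> int"

type_synonym config = "nat \<times> tape list"

definition read_tape :: "tape \<Rightarrow> cell" where
  "read_tape t = fst t (snd t)"

fun move_head :: "move \<Rightarrow> int \<Rightarrow> int" where
  "move_head MoveLeft h = h - 1"
| "move_head Stay h = h"
| "move_head MoveRight h = h + 1"

definition act :: "cell \<times> move \<Rightarrow> tape \<Rightarrow> tape" where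
  "act a t = ((fst t)(snd t := fst a), move_head (snd a) (snd t))"

definition halted :: "machine \<Rightarrow> config \<Rightarrow> bool" where
  "halted T c \<longleftrightarrow> fst c \<in> {acc T, rej T}"

definition step :: "machine \<Rightarrow> config \<Rightarrow> config" where
  "step T c =
     (if halted T c then c
      else (case delta T (fst c) (map read_tape (snd c)) of (q', as) \<Rightarrow> (q', map2 act as (snd c))))"

text \<open>The input word occupies the cells from position 0 on the first tape.\<close>

definition blank_tape :: tape where
  "blank_tape = (\<lambda>_. Blank, 0)"

definition input_tape :: "word \<Rightarrow> tape" where
  "input_tape w =
     (\<lambda>i. if 0 \<le> i \<and> i < int (length w) then Letter (w ! nat i) else Blank, 0)"

definition init_config :: "machine \<Rightarrow> word \<Rightarrow> config" where
  "init_config T w = (start T, input_tape w # replicate (tapes T - 1) blank_tape)"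

definition run :: "machine \<Rightarrow> word \<Rightarrow> nat \<Rightarrow> config" where
  "run T w t = (step T ^^ t) (init_config T w)"

definition accepts :: "machine \<Rightarrow> word \<Rightarrow> bool" where
  "accepts T w \<longleftrightarrow> (\<exists>t. fst (run T w t) = acc T)"

definition rejects :: "machine \<Rightarrow> word \<Rightarrow> bool" where
  "rejects T w \<longleftrightarrow> (\<exists>t. fst (run T w t) = rej T)"

text \<open>
  The output of a halted machine is the word on the first tape that extends from the scanned cell
  rightwards up to the first blank. Either halting state may be used.
\<close>

definition word_at_head :: "tape \<Rightarrow> word \<Rightarrow> bool" where
  "word_at_head t v \<longleftrightarrow>
     (\<forall>i<length v. fst t (snd t + int i) = Letter (v ! i)) \<and>
     fst t (snd t + int (length v)) = Blank"

definition outputs :: "machine \<Rightarrow> word \<Rightarrow> word \<Rightarrow> bool" where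
  "outputs T w v \<longleftrightarrow>
     (\<exists>t. halted T (run T w t) \<and> word_at_head (hd (snd (run T w t))) v)"

definition polynomial_time :: "machine \<Rightarrow> bool" where
  "polynomial_time T \<longleftrightarrow>
     (\<exists>p :: nat poly. \<forall>w. \<exists>t \<le> poly p (length w). halted T (run T w t))"

text \<open>
  A decision problem is given by its yes-instances and its no-instances; words that are not
  instances may be answered arbitrarily.
\<close>

record problem =
  yes_instances :: "word set"
  no_instances :: "word set"

definition in_P :: "problem \<Rightarrow> bool" where
  "in_P L \<longleftrightarrow>
     (\<exists>T. turing_machine T \<and> polynomial_time T \<and>
          (\<forall>w\<in>yes_instances L. accepts T w) \<and> (\<forall>w\<in>no_instances L. rejects T w))"


section \<open>Descriptions of matroids\<close>

datatype input_type =
    RANK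
  | INDEPENDENT_SETS
  | SPANNING_SETS
  | BASES
  | FLATS
  | CIRCUITS
  | HYPERPLANES
  | NONSPANNING_CIRCUITS
  | DEPENDENT_HYPERPLANES
  | CYCLIC_FLATS

fun listed_sets :: "input_type \<Rightarrow> 'a matroid \<Rightarrow> 'a set set" where
  "listed_sets RANK M = Pow (ground M)"
| "listed_sets INDEPENDENT_SETS M = indep M"
| "listed_sets SPANNING_SETS M = spanning_sets M"
| "listed_sets BASES M = bases M"
| "listed_sets FLATS M = flats M"
| "listed_sets CIRCUITS M = circuits M"
| "listed_sets HYPERPLANES M = hyperplanes M"
| "listed_sets NONSPANNING_CIRCUITS M = nonspanning_circuits M"
| "listed_sets DEPENDENT_HYPERPLANES M = dependent_hyperplanes M"
| "listed_sets CYCLIC_FLATS M = cyclic_flats M"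

text \<open>Binary numerals, most significant digit first.\<close>

fun numeral_word :: "nat \<Rightarrow> word" where
  "numeral_word m =
     (if m < 2 then [if m = 0 then Zero else One]
      else numeral_word (m div 2) @ [if even m then Zero else One])"

declare numeral_word.simps [simp del]

definition char_vector :: "nat \<Rightarrow> nat set \<Rightarrow> word" where
  "char_vector n X = map (\<lambda>e. if e \<in> X then One else Zero) [0..<n]"

definition listing :: "nat \<Rightarrow> nat set list \<Rightarrow> word" where
  "listing n Xs = concat (map (\<lambda>X. Sep # char_vector n X) Xs)"

definition ranked_listing :: "nat \<Rightarrow> nat matroid \<Rightarrow> nat set list \<Rightarrow> word" where
  "ranked_listing n M Xs =
     concat (map (\<lambda>X. Sep # char_vector n X @ Sep # numeral_word (rank M X)) Xs)"

text \<open>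
  Every description starts with the characteristic vector of the ground set itself, so that the
  number of elements can be recovered even if no set is listed (as for the circuits of a free
  matroid). Otherwise all free matroids would have the same description by circuits. A description
  that lists \<open>i > 0\<close> subsets of an \<open>n\<close>-element set still has length \<open>\<Theta>(n i)\<close>.
\<close>

fun description :: "input_type \<Rightarrow> nat matroid \<Rightarrow> nat set list \<Rightarrow> word" where
  "description I M Xs =
     (let n = card (ground M) in
      char_vector n (ground M) @
      (if I \<in> {RANK, CYCLIC_FLATS} then ranked_listing n M Xs
       else if I \<in> {NONSPANNING_CIRCUITS, DEPENDENT_HYPERPLANES}
         then Sep # numeral_word (rank M (ground M)) @ listing n Xs
       else listing n Xs))"

text \<open>
  Characteristic vectors presuppose an ordering of the ground set, so the elements of a described
  matroid are taken to be \<open>0, \<dots>, n - 1\<close>. The sets may be listed in any order, each exactly once;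
  hence a matroid can have several descriptions of the same type.
\<close>

definition describes :: "input_type \<Rightarrow> word \<Rightarrow> nat matroid \<Rightarrow> bool" where
  "describes I w M \<longleftrightarrow>
     matroid M \<and> ground M = {..<card (ground M)} \<and>
     (\<exists>Xs. distinct Xs \<and> set Xs = listed_sets I M \<and> w = description I M Xs)"

definition reducible :: "input_type \<Rightarrow> input_type \<Rightarrow> bool" (infix "\<le>\<^sub>P" 50) where
  "I \<le>\<^sub>P J \<longleftrightarrow>
     (\<exists>T. turing_machine T \<and> polynomial_time T \<and>
          (\<forall>M w. describes I w M \<longrightarrow> (\<exists>v. outputs T w v \<and> describes J v M)))"

definition detecting_minor :: "input_type \<Rightarrow> 'b matroid \<Rightarrow> problem" where
  "detecting_minor I N =
     \<lparr>yes_instances = {w. \<exists>M. describes I w M \<and> has_minor M N},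
      no_instances = {w. \<exists>M. describes I w M \<and> \<not> has_minor M N}\<rparr>"

end

theory Submission
  imports Defs
begin

text \<open>
  Let \<open>D\<^sub>1, \<dots>, D\<^sub>k\<close> be the circuits of \<open>N\<close>. A set \<open>S\<close> of elements of \<open>M\<close> carries a minor isomorphic to
  \<open>N\<close> iff there are circuits \<open>F\<^sub>1, \<dots>, F\<^sub>k\<close> of \<open>M\<close> whose intersections with \<open>S\<close> are copies of
  \<open>D\<^sub>1, \<dots>, D\<^sub>k\<close>, such that every circuit of \<open>M\<close> contained in \<open>S \<union> F\<^sub>1 \<union> \<dots> \<union> F\<^sub>k\<close> meets \<open>S\<close> in the empty
  set or in a copy of a dependent set of \<open>N\<close>: contracting \<open>(F\<^sub>1 \<union> \<dots> \<union> F\<^sub>k) - S\<close> makes all the required sets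
  dependent, and it makes no more sets dependent than any contraction that yields \<open>N\<close> on \<open>S\<close>.
  Complements of hyperplanes are circuits of the dual, so the same criterion applies to
  hyperplanes, with the coindependent sets of \<open>N\<close> in place of its independent sets.

  For fixed \<open>N\<close> the criterion has the form ``there are boundedly many positions of the listing such
  that for all positions \<dots>''. A machine copies the listing to one tape for each of these positions
  and runs through all tuples of head positions. For each tuple, all heads advance in parallel by
  the size of the ground set, which is read off the initial block of ones, while the finite control
  collects the set of columns of symbols that it sees; this set determines the truth of the matrix.
\<close>

section \<open>Independent sets, circuits and hyperplanes\<close>

text \<open>The set to be contracted ranges over exponentially many candidates. Trading it for
  \<open>k\<close> listed sets, with \<open>k\<close> determined by \<open>N\<close>, leaves
  \<open>m + k\<close> existential positions and one universal position, and so a running time of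
  degree \<open>m + k + 2\<close> in the length of the listing.

  The finite control cannot count up to the size of the ground set. An element \<open>e\<close> is
  therefore represented by a head that meets its first symbol other than one after
  \<open>e + 1\<close> moves. A head that starts on a separator reads the entry of \<open>e\<close>
  after the same number of moves, so membership of \<open>e\<close> in all chosen sets is visible in
  one column. As the order of the columns is forgotten, every condition of the criterion has to be
  phrased as the existence of a column of some kind.

  \<open>polynomial_time\<close> demands halting on all words, including those that describe no
  matroid, after which the reduction may leave anything on its tape. Hence the heads run through all
  positions of whatever word is found, and badly placed heads are sorted out by the matrix.\<close>

lemma basis_of_indep: "basis_of M X B \<Longrightarrow> B \<in> indep M"
  and basis_of_subset: "basis_of M X B \<Longrightarrow> B \<subseteq> X"
  and basis_of_max: "basis_of M X B \<Longrightarrow> J \<in> indep M \<Longrightarrow> B \<subseteq> J \<Longrightarrow> J \<subseteq> X \<Longrightarrow> J = B"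
  unfolding basis_of_def by simp_all

lemma basis_ofI:
  assumes "B \<in> indep M" "B \<subseteq> X"
    and "\<And>J. J \<in> indep M \<Longrightarrow> B \<subseteq> J \<Longrightarrow> J \<subseteq> X \<Longrightarrow> J = B"
  shows "basis_of M X B"
  using assms unfolding basis_of_def by simp

lemma ground_delete: "ground (delete M Y) = ground M - Y"
  and indep_delete: "J \<in> indep (delete M Y) \<longleftrightarrow> J \<in> indep M \<and> J \<subseteq> ground M - Y"
  and ground_contract: "ground (contract M X) = ground M - X"
  by (simp_all add: delete_def contract_def)

section \<open>Bases, rank, circuits and hyperplanes of a fixed matroid\<close>

context
  fixes M :: "'a matroid"
  assumes M: "matroid M"
begin

lemma finite_ground: "finite (ground M)"
  and indep_subset_ground: "J \<in> indep M \<Longrightarrow> J \<subseteq> ground M"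
  and empty_indep: "{} \<in> indep M"
  and indep_subset: "J \<in> indep M \<Longrightarrow> K \<subseteq> J \<Longrightarrow> K \<in> indep M"
  and indep_augment: "J \<in> indep M \<Longrightarrow> K \<in> indep M \<Longrightarrow> card J < card K \<Longrightarrow>
    \<exists>e\<in>K - J. insert e J \<in> indep M"
proof -
  show "finite (ground M)" "J \<in> indep M \<Longrightarrow> J \<subseteq> ground M" "{} \<in> indep M"
    using M unfolding matroid_def by auto
  show "J \<in> indep M \<Longrightarrow> K \<subseteq> J \<Longrightarrow> K \<in> indep M"
    using M unfolding matroid_def by meson
  show "J \<in> indep M \<Longrightarrow> K \<in> indep M \<Longrightarrow> card J < card K \<Longrightarrow>
    \<exists>e\<in>K - J. insert e J \<in> indep M"
    using M unfolding matroid_def by meson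
qed

lemma finite_indep: "finite (indep M)"
  using finite_subset[of "indep M" "Pow (ground M)"] indep_subset_ground finite_ground by blast

lemma indep_finite: "J \<in> indep M \<Longrightarrow> finite J"
  using indep_subset_ground finite_ground finite_subset by blast

lemma basis_of_extending:
  assumes "J \<in> indep M" "J \<subseteq> X"
  obtains B where "basis_of M X B" "J \<subseteq> B"
proof -
  have "finite {K \<in> indep M. K \<subseteq> X}" using finite_indep by simp
  then obtain B where "B \<in> {K \<in> indep M. K \<subseteq> X}" "J \<subseteq> B"
      "\<forall>K \<in> {K \<in> indep M. K \<subseteq> X}. B \<subseteq> K \<longrightarrow> B = K"
    using finite_has_maximal2[of "{K \<in> indep M. K \<subseteq> X}" J] assms by auto
  then have "basis_of M X B" by (intro basis_ofI) auto
  then show thesis using \<open>J \<subseteq> B\<close> by (rule that)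
qed

lemma basis_of_exists: obtains B where "basis_of M X B"
  using basis_of_extending[OF empty_indep] by blast

lemma card_indep_le_basis:
  assumes "basis_of M X B" "J \<in> indep M" "J \<subseteq> X"
  shows "card J \<le> card B"
proof (rule ccontr)
  assume "\<not> ?thesis"
  then obtain e where e: "e \<in> J - B" "insert e B \<in> indep M"
    using indep_augment[OF basis_of_indep[OF assms(1)] assms(2)] by auto
  then have "insert e B = B"
    using basis_of_max[OF assms(1)] basis_of_subset[OF assms(1)] assms(3) by blast
  then show False using e by blast
qed

lemma rank_eq_card_basis: "basis_of M X B \<Longrightarrow> rank M X = card B"
  unfolding rank_def
  by (rule Max_eqI) (use finite_indep card_indep_le_basis in \<open>auto simp: basis_of_def\<close>)

lemma rank_indep: "J \<in> indep M \<Longrightarrow> rank M J = card J"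
  by (intro rank_eq_card_basis basis_ofI) auto

lemma indep_basis_if_card:
  assumes "J \<in> indep M" "J \<subseteq> X" "card J = rank M X"
  shows "basis_of M X J"
proof -
  obtain B where B: "basis_of M X B" "J \<subseteq> B" using basis_of_extending assms by blast
  then have "J = B" using rank_eq_card_basis assms indep_finite
    by (metis basis_of_def card_subset_eq)
  then show ?thesis using B by simp
qed

text \<open>An independent subset of \<open>insert e Z\<close> loses at most \<open>e\<close> when
  cut down to \<open>Z\<close>, so maximality of \<open>B\<close> in \<open>Z\<close> controls it.
  One arbitrary basis thus decides whether the rank grows, which is how flats are tested
  below.\<close>

lemma rank_insert:
  assumes B: "basis_of M Z B" and e: "e \<notin> Z"
  shows "rank M (insert e Z) = (if insert e B \<in> indep M then Suc (rank M Z) else rank M Z)"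
proof (cases "insert e B \<in> indep M")
  case True
  have "basis_of M (insert e Z) (insert e B)"
  proof (rule basis_ofI[OF True])
    show "insert e B \<subseteq> insert e Z" using basis_of_subset[OF B] by blast
    fix J assume J: "J \<in> indep M" "insert e B \<subseteq> J" "J \<subseteq> insert e Z"
    have "J - {e} \<in> indep M" using indep_subset[OF J(1)] by blast
    moreover have "B \<subseteq> J - {e}" "J - {e} \<subseteq> Z"
      using J basis_of_subset[OF B] e by blast+
    ultimately have "J - {e} = B" by (rule basis_of_max[OF B])
    then show "J = insert e B" using J by blast
  qed
  moreover have "e \<notin> B" "finite B"
    using basis_of_subset[OF B] e indep_finite[OF basis_of_indep[OF B]] by blast+
  ultimately show ?thesis using True rank_eq_card_basis B by simp
next
  case False
  have "basis_of M (insert e Z) B"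
  proof (rule basis_ofI[OF basis_of_indep[OF B]])
    show "B \<subseteq> insert e Z" using basis_of_subset[OF B] by blast
    fix J assume J: "J \<in> indep M" "B \<subseteq> J" "J \<subseteq> insert e Z"
    then have "e \<notin> J" using False indep_subset[OF J(1), of "insert e B"] by blast
    then have "J \<subseteq> Z" using J by blast
    then show "J = B" by (rule basis_of_max[OF B J(1,2)])
  qed
  then show ?thesis using False rank_eq_card_basis B by simp
qed

lemma rank_mono: "X \<subseteq> Z \<Longrightarrow> rank M X \<le> rank M Z"
proof -
  assume XZ: "X \<subseteq> Z"
  obtain B where B: "basis_of M X B" using basis_of_exists .
  obtain B' where B': "basis_of M Z B'" using basis_of_exists .
  have "card B \<le> card B'"
    by (rule card_indep_le_basis[OF B']) (use B XZ in \<open>auto simp: basis_of_def\<close>)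
  then show ?thesis using rank_eq_card_basis B B' by simp
qed

text \<open>Frees the definition of contraction from its choice of basis. Extend \<open>B\<close> to
  a basis \<open>B2\<close> of \<open>J \<union> X\<close>. Maximality of \<open>B\<close> gives
  \<open>B2 \<inter> X = B\<close>, so \<open>B2 \<subseteq> J \<union> B\<close>, and comparison
  with the independent set \<open>J \<union> B'\<close> of the same size forces equality.\<close>

lemma indep_contract_iff:
  assumes B: "basis_of M X B"
  shows "J \<in> indep (contract M X) \<longleftrightarrow> J \<subseteq> ground M - X \<and> J \<union> B \<in> indep M"
proof
  assume "J \<in> indep (contract M X)"
  then obtain B' where J: "J \<subseteq> ground M - X" and B': "basis_of M X B'" "J \<union> B' \<in> indep M"
    by (auto simp: contract_def)
  have B'i: "B' \<in> indep M" "B' \<subseteq> X" using basis_of_indep[OF B'(1)] basis_of_subset[OF B'(1)] by auto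
  have Bi: "B \<in> indep M" "B \<subseteq> X" using basis_of_indep[OF B] basis_of_subset[OF B] by auto
  then obtain B2 where B2: "basis_of M (J \<union> X) B2" "B \<subseteq> B2"
    using basis_of_extending[of B "J \<union> X"] by blast
  have B2i: "B2 \<in> indep M" "B2 \<subseteq> J \<union> X" using basis_of_indep[OF B2(1)] basis_of_subset[OF B2(1)] by auto
  have "B2 \<inter> X \<in> indep M" using indep_subset[OF B2i(1)] by blast
  moreover have "B \<subseteq> B2 \<inter> X" using B2(2) Bi by blast
  ultimately have "B2 \<inter> X = B" by (intro basis_of_max[OF B]) auto
  then have sub: "B2 \<subseteq> J \<union> B" using B2i by blast
  have fin: "finite J" "finite B" "finite B'"
    using J finite_ground finite_subset[of J "ground M"] indep_finite Bi B'i
    by auto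
  have dis: "J \<inter> B = {}" "J \<inter> B' = {}" using J Bi B'i by blast+
  have "card (J \<union> B) = card (J \<union> B')"
    using rank_eq_card_basis[OF B] rank_eq_card_basis[OF B'(1)] fin dis
    by (simp add: card_Un_disjoint)
  also have "\<dots> \<le> card B2"
    using card_indep_le_basis[OF B2(1) B'(2)] B'i by blast
  finally have "B2 = J \<union> B" using sub fin by (simp add: card_seteq)
  then show "J \<subseteq> ground M - X \<and> J \<union> B \<in> indep M" using J B2i by simp
next
  assume "J \<subseteq> ground M - X \<and> J \<union> B \<in> indep M"
  then show "J \<in> indep (contract M X)" using B unfolding contract_def by auto
qed

lemma dependent_contains_circuit:
  assumes "Z \<subseteq> ground M" "Z \<notin> indep M"
  obtains C where "C \<in> circuits M" "C \<subseteq> Z"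
proof -
  have "finite {D. D \<subseteq> Z \<and> D \<notin> indep M}"
    by (rule finite_subset[of _ "Pow Z"]) (use finite_subset[OF assms(1) finite_ground] in auto)
  then obtain C where C: "C \<in> {D. D \<subseteq> Z \<and> D \<notin> indep M}"
      "\<forall>D \<in> {D. D \<subseteq> Z \<and> D \<notin> indep M}. D \<subseteq> C \<longrightarrow> C = D"
    using finite_has_minimal2[of "{D. D \<subseteq> Z \<and> D \<notin> indep M}" Z] assms by auto
  then have "C \<in> circuits M" using assms unfolding circuits_def by blast
  then show thesis using that C by blast
qed

text \<open>Eliminates bases in favour of circuits. If \<open>C\<close> meets \<open>J\<close>, then
  \<open>C \<inter> X\<close> is a proper subset of a circuit and extends to a basis
  \<open>B\<close> of \<open>X\<close>, so \<open>J \<union> B\<close> contains \<open>C\<close>.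
  Conversely, a circuit in \<open>J \<union> B\<close> must meet \<open>J\<close>, since
  \<open>B\<close> is independent.\<close>

lemma indep_contract_circuits:
  assumes X: "X \<subseteq> ground M" and J: "J \<subseteq> ground M - X"
  shows "J \<in> indep (contract M X) \<longleftrightarrow> \<not> (\<exists>C\<in>circuits M. C \<subseteq> J \<union> X \<and> C \<inter> J \<noteq> {})"
proof
  assume J': "J \<in> indep (contract M X)"
  show "\<not> (\<exists>C\<in>circuits M. C \<subseteq> J \<union> X \<and> C \<inter> J \<noteq> {})"
  proof
    assume "\<exists>C\<in>circuits M. C \<subseteq> J \<union> X \<and> C \<inter> J \<noteq> {}"
    then obtain C where C: "C \<in> circuits M" "C \<subseteq> J \<union> X" "C \<inter> J \<noteq> {}" by blast
    then have "C \<inter> X \<subset> C" using J by blast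
    then have "C \<inter> X \<in> indep M" using C(1) unfolding circuits_def by blast
    then obtain B where B: "basis_of M X B" "C \<inter> X \<subseteq> B"
      using basis_of_extending[of "C \<inter> X" X] by blast
    then have "J \<union> B \<in> indep M" using J' indep_contract_iff by blast
    then have "C \<in> indep M" using indep_subset[of "J \<union> B" C] B(2) C(2) by blast
    then show False using C(1) unfolding circuits_def by blast
  qed
next
  assume no: "\<not> (\<exists>C\<in>circuits M. C \<subseteq> J \<union> X \<and> C \<inter> J \<noteq> {})"
  obtain B where B: "basis_of M X B" using basis_of_exists .
  have Bi: "B \<in> indep M" "B \<subseteq> X" using basis_of_indep[OF B] basis_of_subset[OF B] by auto
  have "J \<union> B \<in> indep M"
  proof (rule ccontr)
    assume "J \<union> B \<notin> indep M"
    then obtain C where C: "C \<in> circuits M" "C \<subseteq> J \<union> B"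
      using dependent_contains_circuit[of "J \<union> B"] J Bi X by blast
    have "C \<inter> J \<noteq> {}"
    proof
      assume "C \<inter> J = {}"
      then have "C \<in> indep M" using indep_subset[OF Bi(1)] C by blast
      then show False using C(1) unfolding circuits_def by blast
    qed
    then show False using no C Bi by blast
  qed
  then show "J \<in> indep (contract M X)" using indep_contract_iff[OF B] J by blast
qed

text \<open>This says that the closure of \<open>W\<close> is the intersection of the hyperplanes
  containing \<open>W\<close>. For the harder direction, extend \<open>insert i B\<close> to a base
  \<open>Bh\<close> and enlarge \<open>Bh - {i}\<close> to a hyperplane; an element of
  \<open>W\<close> outside it could be added to \<open>B\<close>, against maximality.\<close>

lemma insert_basis_indep_iff_hyperplane:
  assumes W: "W \<subseteq> ground M" and B: "basis_of M W B" and i: "i \<in> ground M"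
  shows "insert i B \<in> indep M \<and> i \<notin> B \<longleftrightarrow> (\<exists>H\<in>hyperplanes M. W \<subseteq> H \<and> i \<notin> H)"
proof
  assume iB: "insert i B \<in> indep M \<and> i \<notin> B"
  obtain Bh where Bh: "basis_of M (ground M) Bh" "insert i B \<subseteq> Bh"
    using basis_of_extending[of "insert i B"] iB indep_subset_ground by blast
  have Bhi: "Bh \<in> indep M" "finite Bh" "Bh \<subseteq> ground M"
    using basis_of_indep[OF Bh(1)] indep_finite basis_of_subset[OF Bh(1)] by blast+
  let ?A = "Bh - {i}"
  have Ai: "?A \<in> indep M" using indep_subset[OF Bhi(1)] by blast
  have r: "rank M (ground M) = card Bh" "Suc (card ?A) = card Bh"
    using rank_eq_card_basis[OF Bh(1)] Bh(2) card_Suc_Diff1[of Bh i] Bhi by auto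
  have rA: "rank M ?A = card ?A" by (rule rank_indep[OF Ai])
  \<comment> \<open>A maximal set of this rank around \<open>Bh - {i}\<close> is a flat, because
    every further element raises the rank; the rank is one below full, so it is a
    hyperplane.\<close>
  let ?\<Z> = "{Z. Z \<subseteq> ground M \<and> ?A \<subseteq> Z \<and> rank M Z = card ?A}"
  have "finite ?\<Z>" using finite_ground by simp
  moreover have "?A \<in> ?\<Z>" using rA Bhi by blast
  ultimately obtain H where H: "H \<in> ?\<Z>" and maxi: "\<forall>Z\<in>?\<Z>. H \<subseteq> Z \<longrightarrow> H = Z"
    using finite_has_maximal2[of ?\<Z> ?A] by auto
  have flat: "rank M H < rank M (insert e H)" if "e \<in> ground M - H" for e
  proof -
    have "rank M H \<le> rank M (insert e H)" by (rule rank_mono) blast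
    moreover have "rank M H \<noteq> rank M (insert e H)"
    proof
      assume "rank M H = rank M (insert e H)"
      then have "insert e H \<in> ?\<Z>" using H that by auto
      then have "H = insert e H" using maxi by blast
      then show False using that by blast
    qed
    ultimately show ?thesis by simp
  qed
  have "H \<in> hyperplanes M"
    unfolding hyperplanes_def flats_def using H r flat by auto
  moreover have "i \<notin> H"
  proof
    assume "i \<in> H"
    then have "Bh \<subseteq> H" using H by blast
    then have "card Bh \<le> rank M H"
      using rank_mono[of Bh H] rank_indep[OF Bhi(1)] by simp
    then show False using H r by simp
  qed
  moreover have "W \<subseteq> H"
  proof
    fix x assume x: "x \<in> W"
    show "x \<in> H"
    proof (rule ccontr)
      assume xH: "x \<notin> H"
      have "basis_of M H ?A" by (rule indep_basis_if_card) (use Ai H in auto)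
      then have "insert x ?A \<in> indep M"
        using rank_insert[of H ?A x] flat[of x] x W xH by (auto split: if_splits)
      moreover have BA: "B \<subseteq> ?A" using Bh iB by blast
      ultimately have "insert x B \<in> indep M" using indep_subset[of "insert x ?A" "insert x B"] by blast
      then have "insert x B = B"
        by (rule basis_of_max[OF B]) (use basis_of_subset[OF B] x in auto)
      then show False using BA H xH by blast
    qed
  qed
  ultimately show "\<exists>H\<in>hyperplanes M. W \<subseteq> H \<and> i \<notin> H" by blast
next
  assume "\<exists>H\<in>hyperplanes M. W \<subseteq> H \<and> i \<notin> H"
  then obtain H where H: "H \<in> hyperplanes M" "W \<subseteq> H" "i \<notin> H" by blast
  have Bi: "B \<in> indep M" "B \<subseteq> W" using basis_of_indep[OF B] basis_of_subset[OF B] by auto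
  obtain B' where B': "basis_of M H B'" "B \<subseteq> B'"
    using basis_of_extending[of B H] Bi H by blast
  have "rank M H < rank M (insert i H)"
    using H i unfolding hyperplanes_def flats_def by blast
  then have "insert i B' \<in> indep M" using rank_insert[OF B'(1) H(3)] by (auto split: if_splits)
  then have "insert i B \<in> indep M" by (rule indep_subset) (rule insert_mono[OF B'(2)])
  moreover have "i \<notin> B" using Bi(2) H(2,3) by blast
  ultimately show "insert i B \<in> indep M \<and> i \<notin> B" by simp
qed

end

text \<open>These are the independent sets of the dual matroid, described without constructing the
  dual.\<close>

definition coindep :: "'a matroid \<Rightarrow> 'a set set" where
  "coindep M = {Q. Q \<subseteq> ground M \<and> (\<exists>B\<in>bases M. B \<inter> Q = {})}"

text \<open>The dual of \<open>indep_contract_circuits\<close>: complements of hyperplanes are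
  cocircuits, and the deleted set \<open>Y\<close> takes the place of the contracted one.
  \<open>Q\<close> is coindependent iff each of its elements lies in the closure of the remaining
  elements together with \<open>X\<close>, and closures are expressed by hyperplanes.\<close>

lemma coindep_minor_hyperplanes:
  assumes M: "matroid M" and X: "X \<subseteq> ground M" and Y: "Y \<subseteq> ground M" and XY: "X \<inter> Y = {}"
    and Q: "Q \<subseteq> ground M - X - Y"
  shows "Q \<in> coindep (delete (contract M X) Y) \<longleftrightarrow>
    \<not> (\<exists>C\<in>(\<lambda>H. ground M - H) ` hyperplanes M. C \<subseteq> Q \<union> Y \<and> C \<inter> Q \<noteq> {})"
  (is "_ \<longleftrightarrow> ?rhs")
proof -
  let ?L = "delete (contract M X) Y" and ?S = "ground M - X - Y"
  \<comment> \<open>The complement of \<open>Q \<union> Y\<close>, so that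
    \<open>ground M - H \<subseteq> Q \<union> Y\<close> turns into
    \<open>?W \<subseteq> H\<close>.\<close>
  let ?W = "(?S - Q) \<union> X"
  obtain BX where BX: "basis_of M X BX" using basis_of_exists[OF M] .
  have BXi: "BX \<in> indep M" "BX \<subseteq> X" using basis_of_indep[OF BX] basis_of_subset[OF BX] by auto
  have gL: "ground ?L = ?S" by (simp add: ground_delete ground_contract)
  have iL: "J \<in> indep ?L \<longleftrightarrow> J \<subseteq> ?S \<and> J \<union> BX \<in> indep M" for J
  proof -
    have "J \<in> indep ?L \<longleftrightarrow> J \<in> indep (contract M X) \<and> J \<subseteq> ?S"
      by (simp add: indep_delete ground_contract)
    then show ?thesis using indep_contract_iff[OF M BX, of J] by blast
  qed
  have W: "?W \<subseteq> ground M" using X by blast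
  have *: "C \<subseteq> Q \<union> Y \<and> C \<inter> Q \<noteq> {} \<longleftrightarrow> ?W \<subseteq> H \<and> (\<exists>i\<in>Q. i \<notin> H)"
    if "C = ground M - H" for C H
  proof -
    have "C \<subseteq> Q \<union> Y \<longleftrightarrow> ?W \<subseteq> H"
    proof
      show "?W \<subseteq> H" if "C \<subseteq> Q \<union> Y" using that \<open>C = _\<close> W XY Q by blast
      show "C \<subseteq> Q \<union> Y" if "?W \<subseteq> H" using that \<open>C = _\<close> by blast
    qed
    moreover have "C \<inter> Q \<noteq> {} \<longleftrightarrow> (\<exists>i\<in>Q. i \<notin> H)" using that Q by blast
    ultimately show ?thesis by simp
  qed
  have "Q \<in> coindep ?L \<longleftrightarrow> \<not> (\<exists>i\<in>Q. \<exists>H\<in>hyperplanes M. ?W \<subseteq> H \<and> i \<notin> H)"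
  proof
    assume "Q \<in> coindep ?L"
    then obtain B where B: "basis_of ?L ?S B" "B \<inter> Q = {}"
      unfolding coindep_def bases_def gL by blast
    have Bi: "B \<subseteq> ?S" "B \<union> BX \<in> indep M"
      using basis_of_indep[OF B(1)] iL[of B] by blast+
    have Bmax: "J = B" if "J \<in> indep ?L" "B \<subseteq> J" for J
      using basis_of_max[OF B(1) that] that(1) iL[of J] by blast
    have bas: "basis_of M ?W (B \<union> BX)"
    proof (rule basis_ofI[OF Bi(2)])
      show "B \<union> BX \<subseteq> ?W" using Bi BXi B by blast
      fix J assume J: "J \<in> indep M" "B \<union> BX \<subseteq> J" "J \<subseteq> ?W"
      have "J \<inter> X = BX"
        by (rule basis_of_max[OF BX indep_subset[OF M J(1)]]) (use J BXi in auto)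
      moreover have "J - X \<in> indep ?L"
        using iL[of "J - X"] indep_subset[OF M J(1), of "(J - X) \<union> BX"] J by blast
      then have "J - X = B" using Bmax[of "J - X"] J Bi by blast
      ultimately show "J = B \<union> BX" by blast
    qed
    show "\<not> (\<exists>i\<in>Q. \<exists>H\<in>hyperplanes M. ?W \<subseteq> H \<and> i \<notin> H)"
    proof
      assume "\<exists>i\<in>Q. \<exists>H\<in>hyperplanes M. ?W \<subseteq> H \<and> i \<notin> H"
      then obtain i where i: "i \<in> Q" "insert i (B \<union> BX) \<in> indep M"
        using insert_basis_indep_iff_hyperplane[OF M W bas] Q by blast
      then have "insert i B \<in> indep ?L" using iL Bi Q by auto
      then have "insert i B = B" by (rule Bmax) blast
      then show False using i B by blast
    qed
  next
    assume no: "\<not> (\<exists>i\<in>Q. \<exists>H\<in>hyperplanes M. ?W \<subseteq> H \<and> i \<notin> H)"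
    obtain B2 where B2: "basis_of M ?W B2" "BX \<subseteq> B2"
      using basis_of_extending[OF M, of BX ?W] BXi by blast
    have B2i: "B2 \<in> indep M" "B2 \<subseteq> ?W" using basis_of_indep[OF B2(1)] basis_of_subset[OF B2(1)] by auto
    have "B2 \<inter> X = BX"
      by (rule basis_of_max[OF BX indep_subset[OF M B2i(1)]]) (use B2 BXi in auto)
    then have B2X: "(B2 - X) \<union> BX = B2" by blast
    have "basis_of ?L ?S (B2 - X)"
    proof (rule basis_ofI)
      show sub: "B2 - X \<subseteq> ?S" using B2i by blast
      show "B2 - X \<in> indep ?L" using iL B2X B2i sub by simp
      fix J assume J: "J \<in> indep ?L" "B2 - X \<subseteq> J" "J \<subseteq> ?S"
      show "J = B2 - X"
      proof (rule ccontr)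
        assume "J \<noteq> B2 - X"
        then obtain i where i: "i \<in> J" "i \<notin> B2 - X" using J by blast
        then have iS: "i \<in> ?S" "i \<notin> B2" using J by blast+
        have "insert i B2 \<subseteq> J \<union> BX" using i J B2X by blast
        then have ins: "insert i B2 \<in> indep M" using indep_subset[OF M] J(1) iL by blast
        have "i \<notin> ?W"
        proof
          assume "i \<in> ?W"
          then have "insert i B2 = B2"
            by (intro basis_of_max[OF B2(1) ins]) (use B2i in auto)
          then show False using iS by blast
        qed
        then have "i \<in> Q" using iS by blast
        then show False
          using insert_basis_indep_iff_hyperplane[OF M W B2(1), of i] ins iS no by blast
      qed
    qed
    then show "Q \<in> coindep ?L" unfolding coindep_def bases_def gL using B2i Q by blast
  qed
  also have "\<dots> \<longleftrightarrow> ?rhs" using * by (simp add: image_iff Bex_def) metis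
  finally show ?thesis .
qed

section \<open>Certificates for minors\<close>

definition trace :: "nat \<Rightarrow> (nat \<Rightarrow> 'a) \<Rightarrow> 'a set \<Rightarrow> nat set" where
  "trace m e C = {i. i < m \<and> e i \<in> C}"

text \<open>\<open>\<I>\<close> is meant to be the family of independent (or coindependent) sets of
  \<open>N\<close> on the labels below \<open>m\<close>, and \<open>D\<close> enumerates its minimal
  non-members. Containment in the union is negated into the existence of an escaping element
  \<open>x\<close>, since a single element is what a column of symbols can exhibit.\<close>

definition minor_certificate ::
    "nat \<Rightarrow> nat set set \<Rightarrow> nat \<Rightarrow> (nat \<Rightarrow> nat set) \<Rightarrow> 'a set \<Rightarrow> 'a set set \<Rightarrow> bool" where
  "minor_certificate m \<I> k D E \<C> \<longleftrightarrow>
     (\<exists>e F. inj_on e {..<m} \<and> e ` {..<m} \<subseteq> E \<and>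
        (\<forall>j<k. F j \<in> \<C> \<and> trace m e (F j) = D j) \<and>
        (\<forall>C\<in>\<C>. (\<exists>x\<in>C. x \<notin> e ` {..<m} \<and> (\<forall>j<k. x \<notin> F j)) \<or>
           trace m e C = {} \<or> trace m e C \<notin> \<I>))"

text \<open>Stated for any family \<open>\<C>\<close> of subsets of \<open>E\<close>, so that it
  serves both circuits and complements of hyperplanes. From a certificate, \<open>X\<close> is the
  part of the union of the \<open>F j\<close> outside the labelled elements. From \<open>X\<close>,
  each \<open>F j\<close> is a member of \<open>\<C>\<close> that witnesses
  \<open>D j \<notin> \<I>\<close>.\<close>

lemma minor_certificate_iff:
  assumes down: "\<And>P Q. P \<in> \<I> \<Longrightarrow> Q \<subseteq> P \<Longrightarrow> Q \<in> \<I>" and empty: "{} \<in> \<I>"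
    and D: "D ` {..<k} = {P. P \<subseteq> {..<m} \<and> P \<notin> \<I> \<and> (\<forall>Q. Q \<subset> P \<longrightarrow> Q \<in> \<I>)}"
    and \<C>: "\<And>C. C \<in> \<C> \<Longrightarrow> C \<subseteq> E"
  shows "minor_certificate m \<I> k D E \<C> \<longleftrightarrow>
    (\<exists>e X. inj_on e {..<m} \<and> e ` {..<m} \<subseteq> E \<and> X \<subseteq> E - e ` {..<m} \<and>
      (\<forall>P. P \<subseteq> {..<m} \<longrightarrow> (P \<in> \<I> \<longleftrightarrow> \<not> (\<exists>C\<in>\<C>. C \<subseteq> e ` P \<union> X \<and> C \<inter> e ` P \<noteq> {}))))"
proof
  have Dj: "D j \<subseteq> {..<m}" "D j \<notin> \<I>" "D j \<noteq> {}" "\<And>Q. Q \<subset> D j \<Longrightarrow> Q \<in> \<I>" if "j < k" for j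
  proof -
    have "D j \<in> D ` {..<k}" using that by blast
    then show "D j \<subseteq> {..<m}" "D j \<notin> \<I>" "\<And>Q. Q \<subset> D j \<Longrightarrow> Q \<in> \<I>" unfolding D by auto
    then show "D j \<noteq> {}" using empty by auto
  qed
  {
    assume "minor_certificate m \<I> k D E \<C>"
    then obtain e F where inj: "inj_on e {..<m}" and e: "e ` {..<m} \<subseteq> E"
      and F': "\<forall>j<k. F j \<in> \<C> \<and> trace m e (F j) = D j"
      and all: "\<forall>C\<in>\<C>. (\<exists>x\<in>C. x \<notin> e ` {..<m} \<and> (\<forall>j<k. x \<notin> F j)) \<or>
           trace m e C = {} \<or> trace m e C \<notin> \<I>"
      unfolding minor_certificate_def by (elim exE conjE) (rule that)
    have F: "F j \<in> \<C>" "trace m e (F j) = D j" if "j < k" for j using F' that by simp_all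
    let ?X = "(\<Union>j<k. F j) - e ` {..<m}"
    have "?X \<subseteq> E - e ` {..<m}" using F(1) \<C> by blast
    moreover have "P \<in> \<I> \<longleftrightarrow> \<not> (\<exists>C\<in>\<C>. C \<subseteq> e ` P \<union> ?X \<and> C \<inter> e ` P \<noteq> {})"
      if P: "P \<subseteq> {..<m}" for P
    proof
      assume PI: "P \<in> \<I>"
      show "\<not> (\<exists>C\<in>\<C>. C \<subseteq> e ` P \<union> ?X \<and> C \<inter> e ` P \<noteq> {})"
      proof
        assume "\<exists>C\<in>\<C>. C \<subseteq> e ` P \<union> ?X \<and> C \<inter> e ` P \<noteq> {}"
        then obtain C where C: "C \<in> \<C>" "C \<subseteq> e ` P \<union> ?X" "C \<inter> e ` P \<noteq> {}" by blast
        have "trace m e C \<subseteq> P"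
        proof
          fix i assume i: "i \<in> trace m e C"
          then have "e i \<in> e ` P" using C(2) unfolding trace_def by blast
          then show "i \<in> P" using inj_on_image_mem_iff[OF inj _ P] i unfolding trace_def by blast
        qed
        then have "trace m e C \<in> \<I>" using down[OF PI] by blast
        moreover have "trace m e C \<noteq> {}" using C(3) P unfolding trace_def by blast
        ultimately have "\<exists>x\<in>C. x \<notin> e ` {..<m} \<and> (\<forall>j<k. x \<notin> F j)" using bspec[OF all C(1)] by simp
        then show False using C(2) P by blast
      qed
    next
      assume no: "\<not> (\<exists>C\<in>\<C>. C \<subseteq> e ` P \<union> ?X \<and> C \<inter> e ` P \<noteq> {})"
      show "P \<in> \<I>"
      proof (rule ccontr)
        assume "P \<notin> \<I>"
        moreover have "finite {Q. Q \<subseteq> P \<and> Q \<notin> \<I>}"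
          by (rule finite_subset[of _ "Pow {..<m}"]) (use P in auto)
        ultimately obtain Q where Q: "Q \<subseteq> P" "Q \<notin> \<I>" and
            min: "\<And>R. R \<subseteq> P \<Longrightarrow> R \<notin> \<I> \<Longrightarrow> R \<subseteq> Q \<Longrightarrow> Q = R"
          using finite_has_minimal2[of "{Q. Q \<subseteq> P \<and> Q \<notin> \<I>}" P] by auto
        have "Q \<in> D ` {..<k}" unfolding D using Q P min by blast
        then obtain j where j: "j < k" "Q = D j" by blast
        have "F j \<inter> e ` {..<m} = e ` D j"
          using F(2)[OF j(1)] unfolding trace_def by blast
        moreover have "e ` D j \<subseteq> e ` P" "e ` D j \<noteq> {}" using j Q Dj(3) by blast+
        ultimately have "F j \<subseteq> e ` P \<union> ?X" "F j \<inter> e ` P \<noteq> {}" using j(1) by blast+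
        then show False using no F(1)[OF j(1)] by blast
      qed
    qed
    ultimately show "\<exists>e X. inj_on e {..<m} \<and> e ` {..<m} \<subseteq> E \<and> X \<subseteq> E - e ` {..<m} \<and>
      (\<forall>P. P \<subseteq> {..<m} \<longrightarrow> (P \<in> \<I> \<longleftrightarrow> \<not> (\<exists>C\<in>\<C>. C \<subseteq> e ` P \<union> X \<and> C \<inter> e ` P \<noteq> {})))"
      using inj e by (intro exI[of _ e] exI[of _ ?X]) simp
  next
    assume "\<exists>e X. inj_on e {..<m} \<and> e ` {..<m} \<subseteq> E \<and> X \<subseteq> E - e ` {..<m} \<and>
      (\<forall>P. P \<subseteq> {..<m} \<longrightarrow> (P \<in> \<I> \<longleftrightarrow> \<not> (\<exists>C\<in>\<C>. C \<subseteq> e ` P \<union> X \<and> C \<inter> e ` P \<noteq> {})))"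
    then obtain e X where inj: "inj_on e {..<m}" and e: "e ` {..<m} \<subseteq> E" and X: "X \<subseteq> E - e ` {..<m}"
      and I': "\<forall>P. P \<subseteq> {..<m} \<longrightarrow>
        (P \<in> \<I> \<longleftrightarrow> \<not> (\<exists>C\<in>\<C>. C \<subseteq> e ` P \<union> X \<and> C \<inter> e ` P \<noteq> {}))"
      by (elim exE conjE) (rule that)
    note I = I'[rule_format]
    have tr: "trace m e C \<subseteq> {..<m}" "e ` trace m e C = C \<inter> e ` {..<m}" for C
      unfolding trace_def by auto
    have dep: "trace m e C \<notin> \<I>" if "C \<in> \<C>" "C \<subseteq> e ` {..<m} \<union> X" "trace m e C \<noteq> {}" for C
    proof -
      have "C \<subseteq> e ` trace m e C \<union> X" unfolding tr(2) using that(2) by blast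
      moreover have "C \<inter> e ` trace m e C \<noteq> {}" using that(3) tr(2)[of C] by blast
      ultimately show ?thesis using I[OF tr(1)[of C]] that(1) by blast
    qed
    have "\<exists>C. C \<in> \<C> \<and> C \<subseteq> e ` {..<m} \<union> X \<and> trace m e C = D j" if j: "j < k" for j
    proof -
      obtain C where C: "C \<in> \<C>" "C \<subseteq> e ` D j \<union> X" "C \<inter> e ` D j \<noteq> {}"
        using I[OF Dj(1)[OF j]] Dj(2)[OF j] by blast
      have sub: "trace m e C \<subseteq> D j"
      proof
        fix i assume i: "i \<in> trace m e C"
        then have "e i \<in> e ` D j" using C(2) X unfolding trace_def by blast
        then show "i \<in> D j" using inj_on_image_mem_iff[OF inj _ Dj(1)[OF j]] i
          unfolding trace_def by blast
      qed
      have C2: "C \<subseteq> e ` {..<m} \<union> X" using C(2) Dj(1)[OF j] by blast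
      have "trace m e C \<noteq> {}" using C(3) Dj(1)[OF j] unfolding trace_def by blast
      then have "trace m e C \<notin> \<I>" using dep C(1) C2 by blast
      \<comment> \<open>A proper subset of the minimal non-member \<open>D j\<close> would belong to
        \<open>\<I>\<close>, whereas the trace of \<open>C\<close> does not.\<close>
      then have "trace m e C = D j" using Dj(4)[OF j] sub by blast
      then show ?thesis using C(1) C2 by blast
    qed
    then obtain F where F: "\<And>j. j < k \<Longrightarrow> F j \<in> \<C> \<and> F j \<subseteq> e ` {..<m} \<union> X \<and> trace m e (F j) = D j"
      by metis
    have "(\<exists>x\<in>C. x \<notin> e ` {..<m} \<and> (\<forall>j<k. x \<notin> F j)) \<or> trace m e C = {} \<or> trace m e C \<notin> \<I>"
      if "C \<in> \<C>" for C
    proof (cases "C \<subseteq> e ` {..<m} \<union> X")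
      case True
      then show ?thesis using dep that by blast
    next
      case False
      then obtain x where "x \<in> C" "x \<notin> e ` {..<m}" "x \<notin> X" by blast
      then show ?thesis using F by blast
    qed
    then show "minor_certificate m \<I> k D E \<C>"
      unfolding minor_certificate_def using inj e F by (intro exI[of _ e] exI[of _ F]) simp
  }
qed

text \<open>No augmentation property is needed for duality to be an involution: a down-closed family is
  determined by its maximal members, and dualizing complements these.\<close>

definition maximal_in :: "'a set set \<Rightarrow> 'a set \<Rightarrow> bool" where
  "maximal_in \<I> B \<longleftrightarrow> B \<in> \<I> \<and> (\<forall>J\<in>\<I>. B \<subseteq> J \<longrightarrow> J = B)"

definition dual_family :: "'a set \<Rightarrow> 'a set set \<Rightarrow> 'a set set" where
  "dual_family U \<I> = {Q. Q \<subseteq> U \<and> (\<exists>B. maximal_in \<I> B \<and> B \<inter> Q = {})}"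

lemma maximal_in_mem: "maximal_in \<I> B \<Longrightarrow> B \<in> \<I>"
  and maximal_in_eq: "maximal_in \<I> B \<Longrightarrow> J \<in> \<I> \<Longrightarrow> B \<subseteq> J \<Longrightarrow> J = B"
  unfolding maximal_in_def by simp_all

lemma maximal_inI:
  assumes "B \<in> \<I>" "\<And>J. J \<in> \<I> \<Longrightarrow> B \<subseteq> J \<Longrightarrow> J = B"
  shows "maximal_in \<I> B"
  using assms unfolding maximal_in_def by simp

lemma dual_family_iff:
  "Q \<in> dual_family U \<I> \<longleftrightarrow> Q \<subseteq> U \<and> (\<exists>B. maximal_in \<I> B \<and> B \<inter> Q = {})"
  unfolding dual_family_def by simp

lemma maximal_in_dual_family:
  assumes \<I>: "\<I> \<subseteq> Pow U"
  shows "maximal_in (dual_family U \<I>) B \<longleftrightarrow> B \<subseteq> U \<and> maximal_in \<I> (U - B)"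
proof
  assume B: "maximal_in (dual_family U \<I>) B"
  then obtain A where A: "B \<subseteq> U" "maximal_in \<I> A" "A \<inter> B = {}"
    using maximal_in_mem[OF B] unfolding dual_family_iff by auto
  have AU: "A \<subseteq> U" using maximal_in_mem[OF A(2)] \<I> by auto
  have "U - A \<in> dual_family U \<I>" unfolding dual_family_iff using A(2) by auto
  then have "U - A = B" by (rule maximal_in_eq[OF B]) (use A in auto)
  then have "U - B = A" using AU by auto
  then show "B \<subseteq> U \<and> maximal_in \<I> (U - B)" using A(1,2) by simp
next
  assume B: "B \<subseteq> U \<and> maximal_in \<I> (U - B)"
  show "maximal_in (dual_family U \<I>) B"
  proof (rule maximal_inI)
    show "B \<in> dual_family U \<I>" unfolding dual_family_iff using B by auto
    fix J assume J: "J \<in> dual_family U \<I>" "B \<subseteq> J"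
    then obtain A where A: "J \<subseteq> U" "maximal_in \<I> A" "A \<inter> J = {}"
      unfolding dual_family_iff by auto
    have "A \<subseteq> U - B" using maximal_in_mem[OF A(2)] A(3) J(2) \<I> by auto
    then have "U - B = A" using maximal_in_eq[OF A(2)] maximal_in_mem B by metis
    then show "J = B" using A J(2) by auto
  qed
qed

lemma dual_dual_family:
  assumes fin: "finite U" and U: "\<I> \<subseteq> Pow U"
    and down: "\<And>P Q. P \<in> \<I> \<Longrightarrow> Q \<subseteq> P \<Longrightarrow> Q \<in> \<I>"
  shows "dual_family U (dual_family U \<I>) = \<I>"
proof (intro equalityI subsetI)
  fix Q assume "Q \<in> dual_family U (dual_family U \<I>)"
  then obtain B where B: "Q \<subseteq> U" "maximal_in (dual_family U \<I>) B" "B \<inter> Q = {}"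
    unfolding dual_family_iff[of Q U "dual_family U \<I>"] by auto
  then have "U - B \<in> \<I>" using maximal_in_dual_family[OF U] maximal_in_mem by metis
  then show "Q \<in> \<I>" by (rule down) (use B in auto)
next
  fix Q assume Q: "Q \<in> \<I>"
  have "finite \<I>" using finite_subset[OF U] fin by simp
  then obtain B where B: "B \<in> \<I>" "Q \<subseteq> B" "\<forall>J\<in>\<I>. B \<subseteq> J \<longrightarrow> B = J"
    using finite_has_maximal2[OF _ Q] by metis
  then have "maximal_in \<I> B" by (intro maximal_inI) auto
  moreover have BU: "B \<subseteq> U" using U B(1) by auto
  ultimately have "maximal_in (dual_family U \<I>) (U - B)"
    using maximal_in_dual_family[OF U, of "U - B"] by (simp add: double_diff)
  then show "Q \<in> dual_family U (dual_family U \<I>)"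
    unfolding dual_family_iff[of Q U "dual_family U \<I>"] using B(2) BU by auto
qed

text \<open>A bijection carries maximal members of the pulled-back family to bases. Duality can thus
  be computed on the labels \<open>U\<close>, where \<open>N\<close> and a minor of \<open>M\<close>
  are compared directly.\<close>

lemma coindep_pullback:
  assumes g: "bij_betw g U (ground N)" and N: "\<And>J. J \<in> indep N \<Longrightarrow> J \<subseteq> ground N"
  shows "{Q. Q \<subseteq> U \<and> g ` Q \<in> coindep N} = dual_family U {P. P \<subseteq> U \<and> g ` P \<in> indep N}"
    (is "_ = dual_family U ?I")
proof -
  have inj: "inj_on g U" and im: "g ` U = ground N" using g unfolding bij_betw_def by auto
  have sub: "g ` P \<subseteq> g ` Q \<longleftrightarrow> P \<subseteq> Q" if "P \<subseteq> U" "Q \<subseteq> U" for P Q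
    using inj_on_image_mem_iff[OF inj _ that(2)] that(1) by (auto simp: subset_eq)
  have bas: "g ` B \<in> bases N \<longleftrightarrow> maximal_in ?I B" if B: "B \<subseteq> U" for B
  proof
    assume gB: "g ` B \<in> bases N"
    then have b: "basis_of N (ground N) (g ` B)" unfolding bases_def by simp
    show "maximal_in ?I B"
    proof (rule maximal_inI)
      show "B \<in> ?I" using basis_of_indep[OF b] B by simp
      fix J assume J: "J \<in> ?I" "B \<subseteq> J"
      then have "g ` J = g ` B" by (intro basis_of_max[OF b]) (use N in auto)
      then show "J = B" using inj_on_image_eq_iff[OF inj, of J B] J(1) B by auto
    qed
  next
    assume mx: "maximal_in ?I B"
    have "basis_of N (ground N) (g ` B)"
    proof (rule basis_ofI)
      show "g ` B \<in> indep N" using maximal_in_mem[OF mx] by simp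
      show "g ` B \<subseteq> ground N" using B im by blast
      fix J assume J: "J \<in> indep N" "g ` B \<subseteq> J" "J \<subseteq> ground N"
      then obtain P where P: "P \<subseteq> U" "J = g ` P" using im by (metis subset_imageE)
      then have "P \<in> ?I" "B \<subseteq> P" using J sub[OF B P(1)] by simp_all
      then show "J = g ` B" using maximal_in_eq[OF mx] P(2) by metis
    qed
    then show "g ` B \<in> bases N" unfolding bases_def by simp
  qed
  have "g ` Q \<in> coindep N \<longleftrightarrow> (\<exists>B. maximal_in ?I B \<and> B \<inter> Q = {})" if Q: "Q \<subseteq> U" for Q
  proof
    assume "g ` Q \<in> coindep N"
    then obtain B' where B': "B' \<in> bases N" "B' \<inter> g ` Q = {}" unfolding coindep_def by auto
    then have "B' \<subseteq> g ` U" unfolding bases_def im by (simp add: basis_of_subset)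
    then obtain B where B: "B \<subseteq> U" "B' = g ` B" by (metis subset_imageE)
    then show "\<exists>B. maximal_in ?I B \<and> B \<inter> Q = {}" 
      using B' bas[OF B(1)] by auto
  next
    assume "\<exists>B. maximal_in ?I B \<and> B \<inter> Q = {}"
    then obtain B where B: "maximal_in ?I B" "B \<inter> Q = {}" by auto
    have BU: "B \<subseteq> U" using maximal_in_mem[OF B(1)] by simp
    have "g ` B \<inter> g ` Q = {}" using inj_on_image_Int[OF inj BU Q] B(2) by simp
    moreover have "g ` Q \<subseteq> ground N" using Q im by auto
    ultimately show "g ` Q \<in> coindep N"
      unfolding coindep_def using bas[OF BU] B(1) by auto
  qed
  then show ?thesis unfolding dual_family_def by (intro Collect_cong conj_cong refl)
qed

section \<open>Minors seen through a labelling of the elements of \<open>N\<close>\<close>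

lemma has_minor_iff:
  fixes M :: "'a matroid" and N :: "'b matroid"
  assumes g: "bij_betw g U (ground N)"
  shows "has_minor M N \<longleftrightarrow> (\<exists>X Y e. X \<subseteq> ground M \<and> Y \<subseteq> ground M \<and> X \<inter> Y = {} \<and>
    bij_betw e U (ground M - X - Y) \<and>
    (\<forall>P. P \<subseteq> U \<longrightarrow> (g ` P \<in> indep N \<longleftrightarrow> e ` P \<in> indep (delete (contract M X) Y))))"
proof -
  have "isomorphic L N \<longleftrightarrow> (\<exists>e. bij_betw e U (ground L) \<and>
      (\<forall>P. P \<subseteq> U \<longrightarrow> (g ` P \<in> indep N \<longleftrightarrow> e ` P \<in> indep L)))" for L :: "'a matroid"
  proof
    assume "isomorphic L N"
    then obtain f where f: "bij_betw f (ground L) (ground N)"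
      and I: "\<And>I. I \<subseteq> ground L \<Longrightarrow> I \<in> indep L \<longleftrightarrow> f ` I \<in> indep N"
      unfolding isomorphic_def by blast
    \<comment> \<open>An isomorphism \<open>f\<close> and a labelling \<open>e\<close> of the minor
      determine each other: \<open>e\<close> is \<open>g\<close> followed by the inverse of
      \<open>f\<close>, and \<open>f\<close> is the inverse of \<open>e\<close> followed by
      \<open>g\<close>.\<close>
    let ?e = "inv_into (ground L) f \<circ> g"
    have e: "bij_betw ?e U (ground L)"
      using bij_betw_trans[OF g bij_betw_inv_into[OF f]] .
    moreover have "g ` P \<in> indep N \<longleftrightarrow> ?e ` P \<in> indep L" if P: "P \<subseteq> U" for P
    proof -
      have "f ` ?e ` P = g ` P"
        using P bij_betw_inv_into_right[OF f] bij_betwE[OF g] by (force simp: image_iff)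
      moreover have "?e ` P \<subseteq> ground L" using P e unfolding bij_betw_def by blast
      ultimately show ?thesis using I by metis
    qed
    ultimately show "\<exists>e. bij_betw e U (ground L) \<and>
      (\<forall>P. P \<subseteq> U \<longrightarrow> (g ` P \<in> indep N \<longleftrightarrow> e ` P \<in> indep L))" by blast
  next
    assume "\<exists>e. bij_betw e U (ground L) \<and>
      (\<forall>P. P \<subseteq> U \<longrightarrow> (g ` P \<in> indep N \<longleftrightarrow> e ` P \<in> indep L))"
    then obtain e where e: "bij_betw e U (ground L)"
      and I: "\<And>P. P \<subseteq> U \<Longrightarrow> g ` P \<in> indep N \<longleftrightarrow> e ` P \<in> indep L" by blast
    let ?f = "g \<circ> inv_into U e"
    have "bij_betw ?f (ground L) (ground N)"
      using bij_betw_trans[OF bij_betw_inv_into[OF e] g] .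
    moreover have "I \<in> indep L \<longleftrightarrow> ?f ` I \<in> indep N" if sub: "I \<subseteq> ground L" for I
    proof -
      have "I \<subseteq> e ` U" using sub e unfolding bij_betw_def by blast
      then obtain P where P: "P \<subseteq> U" "I = e ` P" by (metis subset_imageE)
      have "?f ` I = g ` P"
        unfolding P(2) image_comp[symmetric] using inv_into_image_cancel P(1) e
        unfolding bij_betw_def by metis
      then show ?thesis using I[OF P(1)] P(2) by simp
    qed
    ultimately show "isomorphic L N" unfolding isomorphic_def by blast
  qed
  then show ?thesis by (simp add: has_minor_def ground_delete ground_contract)
qed

lemma has_minor_iff_circuits:
  assumes M: "matroid M" and N: "matroid N" and g: "bij_betw g {..<m} (ground N)"
    and D: "D ` {..<k} = {P. P \<subseteq> {..<m} \<and> P \<notin> \<I> \<and> (\<forall>Q. Q \<subset> P \<longrightarrow> Q \<in> \<I>)}"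
    and \<I>: "\<I> = {P. P \<subseteq> {..<m} \<and> g ` P \<in> indep N}"
  shows "has_minor M N \<longleftrightarrow> minor_certificate m \<I> k D (ground M) (circuits M)"
proof -
  have "minor_certificate m \<I> k D (ground M) (circuits M) \<longleftrightarrow>
    (\<exists>e X. inj_on e {..<m} \<and> e ` {..<m} \<subseteq> ground M \<and> X \<subseteq> ground M - e ` {..<m} \<and>
      (\<forall>P. P \<subseteq> {..<m} \<longrightarrow>
         (P \<in> \<I> \<longleftrightarrow> \<not> (\<exists>C\<in>circuits M. C \<subseteq> e ` P \<union> X \<and> C \<inter> e ` P \<noteq> {}))))"
  proof (rule minor_certificate_iff[OF _ _ D])
    show "Q \<in> \<I>" if "P \<in> \<I>" "Q \<subseteq> P" for P Q
      using that indep_subset[OF N, of "g ` P" "g ` Q"] unfolding \<I> by blast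
    show "{} \<in> \<I>" using empty_indep[OF N] unfolding \<I> by simp
    show "C \<subseteq> ground M" if "C \<in> circuits M" for C using that unfolding circuits_def by blast
  qed
  also have "\<dots> \<longleftrightarrow> (\<exists>X Y e. X \<subseteq> ground M \<and> Y \<subseteq> ground M \<and> X \<inter> Y = {} \<and>
    bij_betw e {..<m} (ground M - X - Y) \<and>
    (\<forall>P. P \<subseteq> {..<m} \<longrightarrow> (g ` P \<in> indep N \<longleftrightarrow> e ` P \<in> indep (delete (contract M X) Y))))"
    (is "?l = ?r")
  proof
    assume ?l
    then obtain e X where inj: "inj_on e {..<m}" and e: "e ` {..<m} \<subseteq> ground M"
      and X: "X \<subseteq> ground M - e ` {..<m}"
      and I: "\<And>P. P \<subseteq> {..<m} \<Longrightarrow>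
         (P \<in> \<I> \<longleftrightarrow> \<not> (\<exists>C\<in>circuits M. C \<subseteq> e ` P \<union> X \<and> C \<inter> e ` P \<noteq> {}))"
      by (elim exE conjE) (rule that, simp_all)
    \<comment> \<open>Everything that is neither contracted nor labelled is deleted.\<close>
    let ?Y = "ground M - X - e ` {..<m}"
    have S: "ground M - X - ?Y = e ` {..<m}" using e X by blast
    have "g ` P \<in> indep N \<longleftrightarrow> e ` P \<in> indep (delete (contract M X) ?Y)"
      if P: "P \<subseteq> {..<m}" for P
    proof -
      have eP: "e ` P \<subseteq> ground M - X" "e ` P \<subseteq> ground M - X - ?Y" using e X P by blast+
      have "X \<subseteq> ground M" using X by blast
      then show ?thesis using I[OF P] indep_contract_circuits[OF M _ eP(1)] P eP(2)
        unfolding \<I> by (simp add: indep_delete ground_contract)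
    qed
    then show ?r
      using X S inj by (intro exI[of _ X] exI[of _ ?Y] exI[of _ e]) (auto simp: bij_betw_def)
  next
    assume ?r
    then obtain X Y e where X: "X \<subseteq> ground M" and Y: "Y \<subseteq> ground M" "X \<inter> Y = {}"
      and e: "bij_betw e {..<m} (ground M - X - Y)"
      and I: "\<And>P. P \<subseteq> {..<m} \<Longrightarrow>
        (g ` P \<in> indep N \<longleftrightarrow> e ` P \<in> indep (delete (contract M X) Y))"
      by (elim exE conjE) (rule that, simp_all)
    have inj: "inj_on e {..<m}" and im: "e ` {..<m} = ground M - X - Y"
      using e unfolding bij_betw_def by auto
    have "P \<in> \<I> \<longleftrightarrow> \<not> (\<exists>C\<in>circuits M. C \<subseteq> e ` P \<union> X \<and> C \<inter> e ` P \<noteq> {})"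
      if P: "P \<subseteq> {..<m}" for P
    proof -
      have "e ` P \<subseteq> e ` {..<m}" using P by blast
      then have eP: "e ` P \<subseteq> ground M - X" "e ` P \<subseteq> ground M - X - Y" unfolding im by blast+
      then show ?thesis using I[OF P] indep_contract_circuits[OF M X eP(1)] P
        unfolding \<I> by (simp add: indep_delete ground_contract)
    qed
    then show ?l using X inj im by (intro exI[of _ e] exI[of _ X]) auto
  qed
  also have "\<dots> \<longleftrightarrow> has_minor M N" by (rule has_minor_iff[OF g, symmetric])
  finally show ?thesis by (rule sym)
qed

text \<open>\<open>dual_family U\<close> is an involution on down-closed families, hence injective
  there: two such families on \<open>U\<close> agree iff their duals do.\<close>

lemma indep_iff_coindep_pullback:
  assumes "finite U" and g: "bij_betw g U (ground N)" and e: "bij_betw e U (ground L)"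
    and N: "\<And>J. J \<in> indep N \<Longrightarrow> J \<subseteq> ground N" "\<And>J K. J \<in> indep N \<Longrightarrow> K \<subseteq> J \<Longrightarrow> K \<in> indep N"
    and L: "\<And>J. J \<in> indep L \<Longrightarrow> J \<subseteq> ground L" "\<And>J K. J \<in> indep L \<Longrightarrow> K \<subseteq> J \<Longrightarrow> K \<in> indep L"
  shows "(\<forall>P. P \<subseteq> U \<longrightarrow> (g ` P \<in> indep N \<longleftrightarrow> e ` P \<in> indep L)) \<longleftrightarrow>
    (\<forall>P. P \<subseteq> U \<longrightarrow> (g ` P \<in> coindep N \<longleftrightarrow> e ` P \<in> coindep L))"
proof -
  let ?IN = "{P. P \<subseteq> U \<and> g ` P \<in> indep N}" and ?IL = "{P. P \<subseteq> U \<and> e ` P \<in> indep L}"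
  have *: "{P. P \<subseteq> U \<and> a P} = {P. P \<subseteq> U \<and> b P} \<longleftrightarrow> (\<forall>P. P \<subseteq> U \<longrightarrow> (a P \<longleftrightarrow> b P))"
    for a b :: "_ \<Rightarrow> bool"
    by (simp only: set_eq_iff[of "Collect _"] mem_Collect_eq) auto
  have dN: "dual_family U (dual_family U ?IN) = ?IN"
  proof (rule dual_dual_family[OF assms(1)])
    show "Q \<in> ?IN" if "P \<in> ?IN" "Q \<subseteq> P" for P Q
      using that N(2)[of "g ` P" "g ` Q"] by (auto simp: image_mono)
  qed auto
  have dL: "dual_family U (dual_family U ?IL) = ?IL"
  proof (rule dual_dual_family[OF assms(1)])
    show "Q \<in> ?IL" if "P \<in> ?IL" "Q \<subseteq> P" for P Q
      using that L(2)[of "e ` P" "e ` Q"] by (auto simp: image_mono)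
  qed auto
  have "(\<forall>P. P \<subseteq> U \<longrightarrow> (g ` P \<in> indep N \<longleftrightarrow> e ` P \<in> indep L)) \<longleftrightarrow> ?IN = ?IL"
    by (rule *[symmetric])
  also have "\<dots> \<longleftrightarrow> dual_family U ?IN = dual_family U ?IL"
    by (rule iffI, erule arg_cong[where f = "dual_family U"])
      (subst dN[symmetric], subst dL[symmetric], erule arg_cong[where f = "dual_family U"])
  also have "\<dots> \<longleftrightarrow> {P. P \<subseteq> U \<and> g ` P \<in> coindep N} = {P. P \<subseteq> U \<and> e ` P \<in> coindep L}"
    using coindep_pullback[OF g N(1)] coindep_pullback[OF e L(1)] by simp
  also have "\<dots> \<longleftrightarrow> (\<forall>P. P \<subseteq> U \<longrightarrow> (g ` P \<in> coindep N \<longleftrightarrow> e ` P \<in> coindep L))"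
    by (rule *)
  finally show ?thesis .
qed

text \<open>Deletion is contraction in the dual. The set supplied by the certificate is therefore
  the deleted set \<open>Y\<close>, and the remaining unlabelled elements are contracted. A final
  step returns from coindependent to independent sets.\<close>

lemma has_minor_iff_hyperplanes:
  assumes M: "matroid M" and N: "matroid N" and g: "bij_betw g {..<m} (ground N)"
    and D: "D ` {..<k} = {P. P \<subseteq> {..<m} \<and> P \<notin> \<I> \<and> (\<forall>Q. Q \<subset> P \<longrightarrow> Q \<in> \<I>)}"
    and \<I>: "\<I> = {P. P \<subseteq> {..<m} \<and> g ` P \<in> coindep N}"
  shows "has_minor M N \<longleftrightarrow>
    minor_certificate m \<I> k D (ground M) ((\<lambda>H. ground M - H) ` hyperplanes M)"
proof -
  let ?\<C> = "(\<lambda>H. ground M - H) ` hyperplanes M"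
  have "minor_certificate m \<I> k D (ground M) ?\<C> \<longleftrightarrow>
    (\<exists>e Y. inj_on e {..<m} \<and> e ` {..<m} \<subseteq> ground M \<and> Y \<subseteq> ground M - e ` {..<m} \<and>
      (\<forall>P. P \<subseteq> {..<m} \<longrightarrow>
         (P \<in> \<I> \<longleftrightarrow> \<not> (\<exists>C\<in>?\<C>. C \<subseteq> e ` P \<union> Y \<and> C \<inter> e ` P \<noteq> {}))))"
  proof (rule minor_certificate_iff[OF _ _ D])
    show "Q \<in> \<I>" if PI: "P \<in> \<I>" and QP: "Q \<subseteq> P" for P Q
    proof -
      obtain B where B: "P \<subseteq> {..<m}" "g ` P \<subseteq> ground N" "B \<in> bases N" "B \<inter> g ` P = {}"
        using PI unfolding \<I> coindep_def by auto
      have "g ` Q \<subseteq> g ` P" using QP by (rule image_mono)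
      then have "g ` Q \<subseteq> ground N" "B \<inter> g ` Q = {}" using B(2,4) by blast+
      moreover have "Q \<subseteq> {..<m}" using B(1) QP by blast
      ultimately show ?thesis unfolding \<I> coindep_def using B(3) by simp metis
    qed
    obtain B where "basis_of N (ground N) B" using basis_of_exists[OF N] .
    then show "{} \<in> \<I>" unfolding \<I> coindep_def bases_def by auto
    show "C \<subseteq> ground M" if "C \<in> ?\<C>" for C using that by blast
  qed
  also have "\<dots> \<longleftrightarrow> (\<exists>X Y e. X \<subseteq> ground M \<and> Y \<subseteq> ground M \<and> X \<inter> Y = {} \<and>
    bij_betw e {..<m} (ground M - X - Y) \<and>
    (\<forall>P. P \<subseteq> {..<m} \<longrightarrow> (g ` P \<in> coindep N \<longleftrightarrow> e ` P \<in> coindep (delete (contract M X) Y))))"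
    (is "?l = ?r")
  proof
    assume ?l
    then obtain e Y where inj: "inj_on e {..<m}" and e: "e ` {..<m} \<subseteq> ground M"
      and Y: "Y \<subseteq> ground M - e ` {..<m}"
      and I: "\<And>P. P \<subseteq> {..<m} \<Longrightarrow>
         (P \<in> \<I> \<longleftrightarrow> \<not> (\<exists>C\<in>?\<C>. C \<subseteq> e ` P \<union> Y \<and> C \<inter> e ` P \<noteq> {}))"
      by (elim exE conjE) (rule that, simp_all)
    let ?X = "ground M - Y - e ` {..<m}"
    have S: "ground M - ?X - Y = e ` {..<m}" using e Y by blast
    have XY: "?X \<subseteq> ground M" "Y \<subseteq> ground M" "?X \<inter> Y = {}" using Y by blast+
    have "g ` P \<in> coindep N \<longleftrightarrow> e ` P \<in> coindep (delete (contract M ?X) Y)"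
      if P: "P \<subseteq> {..<m}" for P
    proof -
      have "e ` P \<subseteq> ground M - ?X - Y" unfolding S using P by blast
      then show ?thesis using I[OF P] coindep_minor_hyperplanes[OF M XY, of "e ` P"] P
        unfolding \<I> by simp
    qed
    then show ?r
      using XY S inj by (intro exI[of _ ?X] exI[of _ Y] exI[of _ e]) (simp add: bij_betw_def)
  next
    assume ?r
    then obtain X Y e where XY: "X \<subseteq> ground M" "Y \<subseteq> ground M" "X \<inter> Y = {}"
      and e: "bij_betw e {..<m} (ground M - X - Y)"
      and I: "\<And>P. P \<subseteq> {..<m} \<Longrightarrow>
        (g ` P \<in> coindep N \<longleftrightarrow> e ` P \<in> coindep (delete (contract M X) Y))"
      by (elim exE conjE) (rule that, simp_all)
    have inj: "inj_on e {..<m}" and im: "e ` {..<m} = ground M - X - Y"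
      using e unfolding bij_betw_def by auto
    have "P \<in> \<I> \<longleftrightarrow> \<not> (\<exists>C\<in>?\<C>. C \<subseteq> e ` P \<union> Y \<and> C \<inter> e ` P \<noteq> {})"
      if P: "P \<subseteq> {..<m}" for P
    proof -
      have "e ` P \<subseteq> ground M - X - Y" using P im by blast
      then show ?thesis using I[OF P] coindep_minor_hyperplanes[OF M XY, of "e ` P"] P
        unfolding \<I> by simp
    qed
    then show ?l using XY inj im by (intro exI[of _ e] exI[of _ Y]) auto
  qed
  also have "\<dots> \<longleftrightarrow> (\<exists>X Y e. X \<subseteq> ground M \<and> Y \<subseteq> ground M \<and> X \<inter> Y = {} \<and>
    bij_betw e {..<m} (ground M - X - Y) \<and>
    (\<forall>P. P \<subseteq> {..<m} \<longrightarrow> (g ` P \<in> indep N \<longleftrightarrow> e ` P \<in> indep (delete (contract M X) Y))))"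
  proof -
    have *: "(\<forall>P. P \<subseteq> {..<m} \<longrightarrow> (g ` P \<in> indep N \<longleftrightarrow> e ` P \<in> indep (delete (contract M X) Y))) \<longleftrightarrow>
      (\<forall>P. P \<subseteq> {..<m} \<longrightarrow> (g ` P \<in> coindep N \<longleftrightarrow> e ` P \<in> coindep (delete (contract M X) Y)))"
      if e: "bij_betw e {..<m} (ground M - X - Y)" for X Y e
    proof (rule indep_iff_coindep_pullback[OF _ g])
      obtain B where B: "basis_of M X B" using basis_of_exists[OF M] .
      show "bij_betw e {..<m} (ground (delete (contract M X) Y))"
        using e by (simp add: ground_delete ground_contract)
      show "J \<subseteq> ground N" if "J \<in> indep N" for J using indep_subset_ground[OF N that] .
      show "K \<in> indep N" if "J \<in> indep N" "K \<subseteq> J" for J K using indep_subset[OF N that] .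
      show "J \<subseteq> ground (delete (contract M X) Y)" if "J \<in> indep (delete (contract M X) Y)" for J
        using that by (simp add: indep_delete ground_delete)
      show "K \<in> indep (delete (contract M X) Y)"
        if "J \<in> indep (delete (contract M X) Y)" "K \<subseteq> J" for J K
      proof -
        have J: "J \<subseteq> ground M - X - Y" "J \<union> B \<in> indep M"
          using that(1) indep_contract_iff[OF M B, of J] by (auto simp: indep_delete ground_contract)
        have "K \<union> B \<in> indep M" by (rule indep_subset[OF M J(2)]) (use that(2) in blast)
        then show ?thesis
          using J(1) that(2) indep_contract_iff[OF M B, of K]
          by (auto simp: indep_delete ground_contract)
      qed
    qed simp
    show ?thesis by (intro ex_cong1 conj_cong refl) (rule *[symmetric])
  qed
  also have "\<dots> \<longleftrightarrow> has_minor M N" by (rule has_minor_iff[OF g, symmetric])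
  finally show ?thesis by (rule sym)
qed

section \<open>Reductions followed by multihead automata\<close>

lemma poly_nat_mono: "x \<le> y \<Longrightarrow> poly p x \<le> poly p y" for p :: "nat poly"
  by (induction p) (auto intro!: add_mono mult_mono)

section \<open>Words on tapes and invariants of runs\<close>

definition word_tape :: "word \<Rightarrow> int \<Rightarrow> cell" where
  "word_tape v i = (if 0 \<le> i \<and> i < int (length v) then Letter (v ! nat i) else Blank)"

lemma word_tape_Nil: "word_tape [] = (\<lambda>_. Blank)"
  unfolding word_tape_def by auto

lemma word_tape_take_Suc:
  "i < length v \<Longrightarrow> word_tape (take (Suc i) v) = (word_tape (take i v))(int i := Letter (v ! i))"
  unfolding word_tape_def by (auto simp: fun_eq_iff)

definition keep :: "cell list \<Rightarrow> (cell \<times> move) list" where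
  "keep cs = map (\<lambda>c. (c, Stay)) cs"

lemma length_keep [simp]: "length (keep cs) = length cs"
  and set_keep [simp]: "set (keep cs) = (\<lambda>c. (c, Stay)) ` set cs"
  by (auto simp: keep_def)

lemma map2_act_keep [simp]: "map2 act (keep (map read_tape ts)) ts = ts"
  by (induction ts) (auto simp: keep_def act_def read_tape_def)

lemma map2_append:
  "length xs = length ys \<Longrightarrow> map2 f (xs @ xs') (ys @ ys') = map2 f xs ys @ map2 f xs' ys'"
  by simp

lemma turing_machine_delta:
  assumes "turing_machine T" "q \<in> states T - {acc T, rej T}"
    and "length cs = tapes T" "set cs \<subseteq> alphabet T" "delta T q cs = (q', as)"
  shows "q' \<in> states T" "length as = tapes T" "fst ` set as \<subseteq> alphabet T"
proof -
  have "\<forall>q \<in> states T - {acc T, rej T}. \<forall>cs. length cs = tapes T \<and> set cs \<subseteq> alphabet T \<longrightarrow>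
      (case delta T q cs of (q', as) \<Rightarrow>
         q' \<in> states T \<and> length as = tapes T \<and> fst ` set as \<subseteq> alphabet T)"
    using assms(1) unfolding turing_machine_def by (elim conjE)
  from this[THEN bspec, OF assms(2), THEN spec, of cs]
  show "q' \<in> states T" "length as = tapes T" "fst ` set as \<subseteq> alphabet T"
    using assms(3-5) by simp_all
qed

lemma take_drop_map_append:
  "length ts = n \<Longrightarrow> take n (map f (ts @ us)) = map f ts"
  "length ts = n \<Longrightarrow> drop n (map f (ts @ us)) = map f us"
  by auto

text \<open>\<open>turing_machine\<close> restricts \<open>delta\<close> only on states of the
  machine and cells of its alphabet. This invariant keeps runs within that domain, so that each
  transition supplies exactly one action per tape and \<open>map2\<close> cuts nothing off.\<close>

definition wf_config :: "machine \<Rightarrow> config \<Rightarrow> bool" where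
  "wf_config T c \<longleftrightarrow> fst c \<in> states T \<and> length (snd c) = tapes T \<and>
     (\<forall>t\<in>set (snd c). range (fst t) \<subseteq> alphabet T)"

lemma wf_config_read:
  "wf_config T c \<Longrightarrow> set (map read_tape (snd c)) \<subseteq> alphabet T"
  unfolding wf_config_def read_tape_def by auto

lemma wf_config_step:
  assumes T: "turing_machine T" and c: "wf_config T c"
  shows "wf_config T (step T c)"
proof (cases "halted T c")
  case True
  then show ?thesis using c by (simp add: step_def)
next
  case False
  obtain q' as where d: "delta T (fst c) (map read_tape (snd c)) = (q', as)" by fastforce
  have len: "length (snd c) = tapes T" using c unfolding wf_config_def by simp
  have "fst c \<in> states T - {acc T, rej T}" using False c unfolding wf_config_def halted_def by simp
  then have q': "q' \<in> states T" "length as = tapes T" "fst ` set as \<subseteq> alphabet T"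
    using turing_machine_delta[OF T _ _ wf_config_read[OF c] d] len by simp_all
  have "range (fst t) \<subseteq> alphabet T" if t: "t \<in> set (map2 act as (snd c))" for t
  proof -
    obtain a s where as: "(a, s) \<in> set (zip as (snd c))" "t = act a s" using t by auto
    have "a \<in> set as" "s \<in> set (snd c)" using as(1) by (auto dest: set_zip_leftD set_zip_rightD)
    then have "fst a \<in> alphabet T" "range (fst s) \<subseteq> alphabet T"
      using q'(3) c unfolding wf_config_def by auto
    then show ?thesis unfolding as(2) act_def by auto
  qed
  then show ?thesis
    using False d q' len unfolding wf_config_def step_def by simp
qed

lemma wf_config_run: "turing_machine T \<Longrightarrow> wf_config T (run T w t)"
proof (induction t)
  case 0
  then show ?case
    unfolding run_def wf_config_def init_config_def turing_machine_def
    by (auto simp: input_tape_def blank_tape_def)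
next
  case (Suc t)
  then show ?case using wf_config_step by (simp add: run_def)
qed

lemma run_add: "run T w (s + t) = (step T ^^ t) (run T w s)"
  unfolding run_def by (metis add.commute comp_apply funpow_add)

lemma run_Suc: "run T w (Suc t) = step T (run T w t)"
  by (simp add: run_def)

text \<open>A head moves by at most one cell per step. This bounds the word to be copied afterwards;
  only blanks on the right matter, because an output is read rightwards.\<close>

lemma first_tape_bounds:
  assumes T: "turing_machine T"
  shows "\<bar>snd (hd (snd (run T w t)))\<bar> \<le> int t \<and>
    (\<forall>i \<ge> int (length w) + int t. fst (hd (snd (run T w t))) i = Blank)"
proof (induction t)
  case 0
  then show ?case by (simp add: run_def init_config_def input_tape_def)
next
  case (Suc t)
  let ?c = "run T w t"
  show ?case
  proof (cases "halted T ?c")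
    case True
    then show ?thesis using Suc by (simp add: run_Suc step_def)
  next
    case False
    have c: "wf_config T ?c" using wf_config_run[OF T] .
    obtain q' as where d: "delta T (fst ?c) (map read_tape (snd ?c)) = (q', as)" by fastforce
    have len: "length (snd ?c) = tapes T" using c unfolding wf_config_def by simp
    have "fst ?c \<in> states T - {acc T, rej T}"
      using False c unfolding wf_config_def halted_def by simp
    then have "length as = tapes T"
      using turing_machine_delta(2)[OF T _ _ wf_config_read[OF c] d] len by simp
    moreover have "tapes T \<ge> 1" using T unfolding turing_machine_def by simp
    ultimately obtain a as' t1 ts where as: "as = a # as'" "snd ?c = t1 # ts"
      using len by (metis One_nat_def Suc_le_length_iff)
    have "snd (run T w (Suc t)) = map2 act as (snd ?c)"
      unfolding run_Suc step_def using False d by simp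
    then have hd: "hd (snd (run T w (Suc t))) = act a t1" unfolding as by simp
    have "\<bar>move_head (snd a) (snd t1)\<bar> \<le> \<bar>snd t1\<bar> + 1" by (cases "snd a") auto
    then show ?thesis unfolding hd using Suc as(2) by (auto simp: act_def)
  qed
qed

text \<open>Several two-way heads on a read-only word \<open>v\<close>: a configuration is a state together with the head
  positions, and the states in \<open>F\<close> halt.\<close>

definition mh_step ::
    "('q \<Rightarrow> cell list \<Rightarrow> 'q \<times> move list) \<Rightarrow> 'q set \<Rightarrow> word \<Rightarrow> 'q \<times> int list \<Rightarrow> 'q \<times> int list" where
  "mh_step ctrl F v c =
     (if fst c \<in> F then c
      else (case ctrl (fst c) (map (word_tape v) (snd c)) of
              (q', ms) \<Rightarrow> (q', map2 move_head ms (snd c))))"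

section \<open>Composition of a reduction with a multihead automaton\<close>

locale multihead =
  fixes heads :: nat and Q :: "'q set" and q0 qa qr :: 'q
    and ctrl :: "'q \<Rightarrow> cell list \<Rightarrow> 'q \<times> move list"
  assumes finite_Q: "finite Q" and Q: "q0 \<in> Q" "qa \<in> Q" "qr \<in> Q" and qa_qr: "qa \<noteq> qr"
    and ctrl: "q \<in> Q \<Longrightarrow> length cs = heads \<Longrightarrow>
      fst (ctrl q cs) \<in> Q \<and> length (snd (ctrl q cs)) = heads"

locale reduction_then_multihead = multihead heads Q q0 qa qr ctrl
  for heads :: nat and Q :: "'q set" and q0 qa qr ctrl +
  fixes R :: machine
  assumes R: "turing_machine R"
begin

definition comp_states :: "(nat + 'q option) set" where
  "comp_states = Inl ` states R \<union> Inr ` insert None (Some ` Q)"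

text \<open>States of a \<open>machine\<close> are natural numbers; any injection of the finite sum
  type part will do.\<close>

definition enc :: "nat + 'q option \<Rightarrow> nat" where
  "enc = (SOME f. inj_on f comp_states)"

definition dec :: "nat \<Rightarrow> nat + 'q option" where
  "dec = inv_into comp_states enc"

text \<open>The states \<open>Inl q\<close> run the reduction on the first tapes, \<open>Inr None\<close> copies its output to the
  other tapes, and \<open>Inr (Some q)\<close> runs the automaton there. Copying stops at the first cell that is
  not a letter, so that it terminates even if the reduction leaves no word behind.\<close>

fun comp_delta ::
    "nat + 'q option \<Rightarrow> cell list \<Rightarrow> (nat + 'q option) \<times> (cell \<times> move) list" where
  "comp_delta (Inl q) cs =
     (if q \<in> {acc R, rej R} then (Inr None, keep cs)
      else (case delta R q (take (tapes R) cs) of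
              (q', as) \<Rightarrow> (Inl q', as @ keep (drop (tapes R) cs))))"
| "comp_delta (Inr None) cs =
     (case hd cs of
        Letter a \<Rightarrow> (Inr None, (hd cs, MoveRight) # keep (tl (take (tapes R) cs)) @
          map (\<lambda>_. (Letter a, MoveRight)) (drop (tapes R) cs))
      | _ \<Rightarrow> (Inr (Some q0), keep (take (tapes R) cs) @
          map (\<lambda>c. (c, MoveLeft)) (drop (tapes R) cs)))"
| "comp_delta (Inr (Some q)) cs =
     (case ctrl q (drop (tapes R) cs) of
        (q', ms) \<Rightarrow> (Inr (Some q'), keep (take (tapes R) cs) @ zip (drop (tapes R) cs) ms))"

definition comp :: machine where
  "comp = \<lparr>tapes = tapes R + heads, alphabet = alphabet R, states = enc ` comp_states,
     start = enc (Inl (start R)), acc = enc (Inr (Some qa)), rej = enc (Inr (Some qr)),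
     delta = (\<lambda>n cs. case comp_delta (dec n) cs of (s, as) \<Rightarrow> (enc s, as))\<rparr>"

lemma R_facts: "tapes R \<ge> 1" "finite (states R)" "start R \<in> states R"
  "Blank \<in> alphabet R" "Letter a \<in> alphabet R" "finite (alphabet R)"
  "insert Blank (range Letter) \<subseteq> alphabet R"
  using R unfolding turing_machine_def by auto

lemma inj_enc: "inj_on enc comp_states"
proof -
  have "finite comp_states" unfolding comp_states_def using R_facts(2) finite_Q by simp
  then have "\<exists>f :: _ \<Rightarrow> nat. inj_on f comp_states" by (rule finite_imp_inj_to_nat_seg[THEN exE]) blast
  then show ?thesis unfolding enc_def by (rule someI_ex)
qed

lemma dec_enc: "s \<in> comp_states \<Longrightarrow> dec (enc s) = s"
  unfolding dec_def by (rule inv_into_f_f[OF inj_enc])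

lemma in_comp_states [simp]:
  "Inl q \<in> comp_states \<longleftrightarrow> q \<in> states R" "Inr None \<in> comp_states"
  "Inr (Some p) \<in> comp_states \<longleftrightarrow> p \<in> Q"
  unfolding comp_states_def by auto

lemma halted_comp:
  "s \<in> comp_states \<Longrightarrow> halted comp (enc s, ts) \<longleftrightarrow> s \<in> {Inr (Some qa), Inr (Some qr)}"
  unfolding halted_def comp_def using inj_on_eq_iff[OF inj_enc, of s] Q by auto

lemma comp_delta_wf:
  assumes s: "s \<in> comp_states" and cs: "length cs = tapes R + heads" "set cs \<subseteq> alphabet R"
    and d: "comp_delta s cs = (s', as)"
  shows "s' \<in> comp_states \<and> length as = tapes R + heads \<and> fst ` set as \<subseteq> alphabet R"
proof -
  have sub: "set (take n cs) \<subseteq> alphabet R" "set (drop n cs) \<subseteq> alphabet R" for n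
    using cs(2) set_take_subset set_drop_subset by fast+
  have mem: "\<And>c. c \<in> set (take (tapes R) cs) \<Longrightarrow> c \<in> alphabet R"
      "\<And>c. c \<in> set (drop (tapes R) cs) \<Longrightarrow> c \<in> alphabet R"
    using sub by blast+
  show ?thesis
  proof (cases s)
    case (Inl q)
    then have q: "q \<in> states R" using s by simp
    show ?thesis
    proof (cases "q \<in> {acc R, rej R}")
      case True
      then show ?thesis using d Inl cs by auto
    next
      case False
      obtain q' as' where d': "delta R q (take (tapes R) cs) = (q', as')" by fastforce
      have "length (take (tapes R) cs) = tapes R" "q \<in> states R - {acc R, rej R}"
        using cs(1) q False by simp_all
      then have "q' \<in> states R" "length as' = tapes R" "fst ` set as' \<subseteq> alphabet R"
        using turing_machine_delta[OF R _ _ sub(1) d'] by simp_all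
      moreover have "a \<in> alphabet R" if "(a, b) \<in> set as'" for a b
        using that \<open>fst ` set as' \<subseteq> alphabet R\<close> by force
      ultimately show ?thesis using d d' Inl False cs(1) mem by auto
    qed
  next
    case (Inr o')
    show ?thesis
    proof (cases o')
      case None
      show ?thesis
      proof (cases "hd cs")
        case (Letter a)
        have "c \<in> alphabet R" if "c \<in> set (tl (take (tapes R) cs))" for c
          using that mem(1)[of c] by (metis list.sel(2) list.set_sel(2))
        then show ?thesis using d Inr None Letter cs(1) R_facts(1) R_facts(5)[of a] by auto
      qed (use d Inr None cs(1) mem Q in auto)
    next
      case (Some q)
      obtain q' ms where c: "ctrl q (drop (tapes R) cs) = (q', ms)" by fastforce
      have "q' \<in> Q" "length ms = heads"
        using ctrl[of q "drop (tapes R) cs"] c s Inr Some cs(1) by simp_all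
      moreover have "a \<in> alphabet R" if "(a, b) \<in> set (zip (drop (tapes R) cs) ms)" for a b
        using set_zip_leftD[OF that] mem by blast
      ultimately show ?thesis using d c Inr Some cs(1) mem by auto
    qed
  qed
qed

lemma turing_machine_comp: "turing_machine comp"
proof -
  have "finite (enc ` comp_states)"
    unfolding comp_states_def using R_facts(2) finite_Q by simp
  moreover have "enc (Inr (Some qa)) \<noteq> enc (Inr (Some qr))"
    using inj_on_eq_iff[OF inj_enc] Q qa_qr by simp
  moreover have "{enc (Inl (start R)), enc (Inr (Some qa)), enc (Inr (Some qr))} \<subseteq> enc ` comp_states"
    using Q R_facts(3) by auto
  moreover have "case delta comp n cs of (q', as) \<Rightarrow>
      q' \<in> enc ` comp_states \<and> length as = tapes R + heads \<and> fst ` set as \<subseteq> alphabet R"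
    if n: "n \<in> enc ` comp_states" and cs: "length cs = tapes R + heads" "set cs \<subseteq> alphabet R" for n cs
  proof -
    obtain s where s: "s \<in> comp_states" "n = enc s" using n by auto
    obtain s' as where d: "comp_delta s cs = (s', as)" by fastforce
    then show ?thesis using comp_delta_wf[OF s(1) cs d] s by (simp add: comp_def dec_enc)
  qed
  ultimately show ?thesis
    unfolding turing_machine_def using R_facts by (simp add: comp_def)
qed

lemma step_comp:
  assumes "s \<in> comp_states" "s \<notin> {Inr (Some qa), Inr (Some qr)}"
    and "comp_delta s (map read_tape ts) = (s', as)"
  shows "step comp (enc s, ts) = (enc s', map2 act as ts)"
  unfolding step_def using assms halted_comp by (simp add: comp_def dec_enc)

section \<open>The phases of the composed machine: reducing, copying, scanning\<close>

lemma run_reduction_phase: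
  assumes "\<And>s. s < t \<Longrightarrow> \<not> halted R (run R w s)"
  shows "run comp w t =
    (enc (Inl (fst (run R w t))), snd (run R w t) @ replicate heads blank_tape)"
  using assms
proof (induction t)
  case 0
  have "replicate (tapes R + heads - 1) blank_tape =
      replicate (tapes R - 1) blank_tape @ replicate heads blank_tape"
    using R_facts(1) by (simp add: replicate_add[symmetric])
  then show ?case by (simp add: run_def init_config_def comp_def)
next
  case (Suc t)
  let ?c = "run R w t"
  have IH: "run comp w t = (enc (Inl (fst ?c)), snd ?c @ replicate heads blank_tape)"
    using Suc by simp
  have nh: "\<not> halted R ?c" using Suc.prems by simp
  have wf: "wf_config R ?c" using wf_config_run[OF R] .
  have len: "length (snd ?c) = tapes R" and q: "fst ?c \<in> states R"
    using wf unfolding wf_config_def by auto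
  obtain q' as where d: "delta R (fst ?c) (map read_tape (snd ?c)) = (q', as)" by fastforce
  have "fst ?c \<in> states R - {acc R, rej R}" using nh q unfolding halted_def by simp
  then have las: "length as = tapes R"
    using turing_machine_delta(2)[OF R _ _ wf_config_read[OF wf] d] len by simp
  let ?ts = "snd ?c @ replicate heads blank_tape"
  have "comp_delta (Inl (fst ?c)) (map read_tape ?ts) =
      (Inl q', as @ keep (map read_tape (replicate heads blank_tape)))"
    using nh d len unfolding halted_def by simp
  from step_comp[OF _ _ this] q
  have "step comp (enc (Inl (fst ?c)), ?ts) =
      (enc (Inl q'), map2 act (as @ keep (map read_tape (replicate heads blank_tape))) ?ts)"
    by simp
  also have "map2 act (as @ keep (map read_tape (replicate heads blank_tape))) ?ts =
      map2 act as (snd ?c) @ replicate heads blank_tape"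
    using las len by (simp only: map2_append map2_act_keep)
  finally show ?case using nh d by (simp add: run_Suc IH step_def)
qed

lemma copy_step:
  assumes "i < length v" "c (h + int i) = Letter (v ! i)" "length ts = tapes R - 1"
  shows "step comp (enc (Inr None),
      ((c, h + int i) # ts) @ replicate heads (word_tape (take i v), int i)) =
    (enc (Inr None),
      ((c, h + int (Suc i)) # ts) @ replicate heads (word_tape (take (Suc i) v), int (Suc i)))"
proof -
  let ?us = "replicate heads (word_tape (take i v), int i)"
  have len: "length ((c, h + int i) # ts) = tapes R" using assms(3) R_facts(1) by simp
  have "comp_delta (Inr None) (map read_tape (((c, h + int i) # ts) @ ?us)) =
    (Inr None, ((Letter (v ! i), MoveRight) # keep (map read_tape ts)) @
      map (\<lambda>_. (Letter (v ! i), MoveRight)) ?us)"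
  proof -
    have 1: "hd (map read_tape (((c, h + int i) # ts) @ ?us)) = Letter (v ! i)"
      using assms(2) by (simp add: read_tape_def)
    have 2: "take (tapes R) (map read_tape (((c, h + int i) # ts) @ ?us)) =
        Letter (v ! i) # map read_tape ts"
      unfolding take_drop_map_append(1)[OF len] using assms(2) by (simp add: read_tape_def)
    have 3: "drop (tapes R) (map read_tape (((c, h + int i) # ts) @ ?us)) = map read_tape ?us"
      by (rule take_drop_map_append(2)[OF len])
    show ?thesis unfolding comp_delta.simps 1 2 3 by simp
  qed
  from step_comp[OF _ _ this]
  have "step comp (enc (Inr None), ((c, h + int i) # ts) @ ?us) =
    (enc (Inr None), map2 act (((Letter (v ! i), MoveRight) # keep (map read_tape ts)) @
      map (\<lambda>_. (Letter (v ! i), MoveRight)) ?us) (((c, h + int i) # ts) @ ?us))"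
    by simp
  also have "map2 act (((Letter (v ! i), MoveRight) # keep (map read_tape ts)) @
      map (\<lambda>_. (Letter (v ! i), MoveRight)) ?us) (((c, h + int i) # ts) @ ?us) =
    map2 act ((Letter (v ! i), MoveRight) # keep (map read_tape ts)) ((c, h + int i) # ts) @
    map2 act (map (\<lambda>_. (Letter (v ! i), MoveRight)) ?us) ?us"
    by (rule map2_append) simp
  also have "map2 act ((Letter (v ! i), MoveRight) # keep (map read_tape ts)) ((c, h + int i) # ts) =
      (c, h + int (Suc i)) # ts"
  proof -
    have "act (Letter (v ! i), MoveRight) (c, h + int i) = (c, h + int (Suc i))"
      using assms(2) by (simp add: act_def fun_upd_idem)
    then show ?thesis by simp
  qed
  also have "map2 act (map (\<lambda>_. (Letter (v ! i), MoveRight)) ?us) ?us =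
      replicate heads (word_tape (take (Suc i) v), int (Suc i))"
    by (rule nth_equalityI) (simp_all add: act_def word_tape_take_Suc[OF assms(1)])
  finally show ?thesis .
qed

text \<open>The move to the left puts the heads on the last copied letter, or on cell -1 if nothing
  was copied. An automaton that searches for the left end by looking for a blank would otherwise
  stop on the blank behind the word.\<close>

lemma copy_end:
  assumes "c h \<notin> range Letter" "length ts = tapes R - 1"
  shows "step comp (enc (Inr None), ((c, h) # ts) @ replicate heads (word_tape v, x)) =
    (enc (Inr (Some q0)), ((c, h) # ts) @ map (Pair (word_tape v)) (replicate heads (x - 1)))"
proof -
  let ?us = "replicate heads (word_tape v, x)" and ?ts = "(c, h) # ts"
  have len: "length ?ts = tapes R" using assms(2) R_facts(1) by simp
  have "comp_delta (Inr None) (map read_tape (?ts @ ?us)) =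
    (Inr (Some q0), keep (map read_tape ?ts) @ map (\<lambda>c. (c, MoveLeft)) (map read_tape ?us))"
  proof -
    have 1: "hd (map read_tape (?ts @ ?us)) = c h" by (simp add: read_tape_def)
    have 2: "take (tapes R) (map read_tape (?ts @ ?us)) = map read_tape ?ts"
      by (rule take_drop_map_append(1)[OF len])
    have 3: "drop (tapes R) (map read_tape (?ts @ ?us)) = map read_tape ?us"
      by (rule take_drop_map_append(2)[OF len])
    show ?thesis unfolding comp_delta.simps 1 2 3 using assms(1) by (cases "c h") auto
  qed
  from step_comp[OF _ _ this]
  have "step comp (enc (Inr None), ?ts @ ?us) = (enc (Inr (Some q0)),
      map2 act (keep (map read_tape ?ts) @ map (\<lambda>c. (c, MoveLeft)) (map read_tape ?us)) (?ts @ ?us))"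
    by simp
  also have "map2 act (keep (map read_tape ?ts) @ map (\<lambda>c. (c, MoveLeft)) (map read_tape ?us))
      (?ts @ ?us) = ?ts @ map2 act (map (\<lambda>c. (c, MoveLeft)) (map read_tape ?us)) ?us"
    by (subst map2_append) (simp_all only: length_keep length_map map2_act_keep)
  also have "map2 act (map (\<lambda>c. (c, MoveLeft)) (map read_tape ?us)) ?us =
      map (Pair (word_tape v)) (replicate heads (x - 1))"
    by (rule nth_equalityI) (simp_all add: act_def read_tape_def)
  finally show ?thesis .
qed

lemma copy_phase:
  assumes "\<And>i. i < length v \<Longrightarrow> c (h + int i) = Letter (v ! i)"
    and "c (h + int (length v)) \<notin> range Letter" and "length ts = tapes R - 1"
  shows "(step comp ^^ Suc (length v))
      (enc (Inr None), ((c, h) # ts) @ replicate heads blank_tape) =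
    (enc (Inr (Some q0)), ((c, h + int (length v)) # ts) @
       map (Pair (word_tape v)) (replicate heads (int (length v) - 1)))"
proof -
  have "(step comp ^^ i) (enc (Inr None), ((c, h) # ts) @ replicate heads blank_tape) =
    (enc (Inr None), ((c, h + int i) # ts) @ replicate heads (word_tape (take i v), int i))"
    if "i \<le> length v" for i
    using that
  proof (induction i)
    case 0
    then show ?case by (simp add: word_tape_Nil blank_tape_def)
  next
    case (Suc i)
    then show ?case using copy_step[of i v c h ts] assms by simp
  qed
  from this[of "length v"] show ?thesis using copy_end[of c _ ts v] assms by simp
qed

lemma multihead_phase:
  assumes "length ts = tapes R" "length xs = heads" "q \<in> Q"
  shows "(step comp ^^ t) (enc (Inr (Some q)), ts @ map (Pair (word_tape v)) xs) =
      (case (mh_step ctrl {qa, qr} v ^^ t) (q, xs) of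
         (q', xs') \<Rightarrow> (enc (Inr (Some q')), ts @ map (Pair (word_tape v)) xs')) \<and>
    length (snd ((mh_step ctrl {qa, qr} v ^^ t) (q, xs))) = heads \<and>
    fst ((mh_step ctrl {qa, qr} v ^^ t) (q, xs)) \<in> Q"
proof (induction t)
  case 0
  then show ?case using assms by simp
next
  case (Suc t)
  obtain p ys where p: "(mh_step ctrl {qa, qr} v ^^ t) (q, xs) = (p, ys)" by fastforce
  have IH: "(step comp ^^ t) (enc (Inr (Some q)), ts @ map (Pair (word_tape v)) xs) =
      (enc (Inr (Some p)), ts @ map (Pair (word_tape v)) ys)" and ys: "length ys = heads" "p \<in> Q"
    using Suc p by auto
  show ?case
  proof (cases "p \<in> {qa, qr}")
    case True
    then have "halted comp (enc (Inr (Some p)), ts @ map (Pair (word_tape v)) ys)"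
      using halted_comp[of "Inr (Some p)"] ys by auto
    then have "step comp (enc (Inr (Some p)), ts @ map (Pair (word_tape v)) ys) =
        (enc (Inr (Some p)), ts @ map (Pair (word_tape v)) ys)"
      by (simp add: step_def)
    moreover have "mh_step ctrl {qa, qr} v (p, ys) = (p, ys)"
      using True by (simp add: mh_step_def)
    ultimately show ?thesis using IH p ys by simp
  next
    case False
    obtain p' ms where d: "ctrl p (map (word_tape v) ys) = (p', ms)" by fastforce
    have p': "p' \<in> Q" "length ms = heads"
      using ctrl[OF ys(2), of "map (word_tape v) ys"] d ys(1) by auto
    let ?us = "map (Pair (word_tape v)) ys"
    have us: "map read_tape ?us = map (word_tape v) ys" by (simp add: read_tape_def)
    have "comp_delta (Inr (Some p)) (map read_tape (ts @ ?us)) =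
      (Inr (Some p'), keep (map read_tape ts) @ zip (map (word_tape v) ys) ms)"
      unfolding comp_delta.simps take_drop_map_append[OF assms(1)] us d by simp
    from step_comp[OF _ _ this] ys False
    have "step comp (enc (Inr (Some p)), ts @ ?us) =
      (enc (Inr (Some p')),
        map2 act (keep (map read_tape ts) @ zip (map (word_tape v) ys) ms) (ts @ ?us))"
      by simp
    also have "map2 act (keep (map read_tape ts) @ zip (map (word_tape v) ys) ms) (ts @ ?us) =
      ts @ map2 act (zip (map (word_tape v) ys) ms) ?us"
      by (subst map2_append) (simp_all only: length_keep length_map map2_act_keep)
    also have "map2 act (zip (map (word_tape v) ys) ms) ?us =
        map (Pair (word_tape v)) (map2 move_head ms ys)"
      by (rule nth_equalityI) (use p' ys in \<open>simp_all add: act_def\<close>)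
    finally have st: "step comp (enc (Inr (Some p)), ts @ ?us) =
      (enc (Inr (Some p')), ts @ map (Pair (word_tape v)) (map2 move_head ms ys))" .
    have "mh_step ctrl {qa, qr} v (p, ys) = (p', map2 move_head ms ys)"
      using False d by (simp add: mh_step_def)
    then show ?thesis using IH p st p' ys by simp
  qed
qed

text \<open>\<open>v\<close> is the maximal run of letters from the head rightwards when
  \<open>R\<close> halts. It exists whether or not \<open>R\<close> produces an output, and the last
  conjunct identifies it with the output if there is one. The summands of the bound are the run of
  \<open>R\<close>, the switch, the copying of \<open>v\<close> with its final step, and the
  automaton.\<close>

lemma comp_run:
  assumes "halted R (run R w t)" and poly: "t \<le> b"
    and mh: "\<And>v. \<exists>t \<le> poly p (length v).
      fst ((mh_step ctrl {qa, qr} v ^^ t) (q0, replicate heads (int (length v) - 1))) =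
        (if P v then qa else qr)"
  shows "\<exists>v s. s \<le> b + 1 + (length w + 2 * b + 1) + poly p (length w + 2 * b) \<and>
      fst (run comp w s) = (if P v then acc comp else rej comp) \<and>
      (\<forall>u. outputs R w u \<longrightarrow> u = v)"
proof -
  \<comment> \<open>The composed machine leaves the first phase at the first halting time.
    \<open>outputs\<close> permits any halting time, but later ones show the same configuration,
    since \<open>step\<close> fixes halted configurations.\<close>
  define t0 where "t0 = (LEAST t. halted R (run R w t))"
  have t0: "halted R (run R w t0)" unfolding t0_def using assms(1) by (rule LeastI)
  have before: "\<not> halted R (run R w s)" if "s < t0" for s
    using that not_less_Least unfolding t0_def by blast
  have t0b: "t0 \<le> b" using Least_le[of "\<lambda>t. halted R (run R w t)", OF assms(1)] poly
    unfolding t0_def by simp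
  have wf: "wf_config R (run R w t0)" using wf_config_run[OF R] .
  then obtain ch ts where cfg: "snd (run R w t0) = ch # ts" and lts: "length ts = tapes R - 1"
    using R_facts(1) unfolding wf_config_def by (cases "snd (run R w t0)") auto
  obtain c h where ch: "ch = (c, h)" by fastforce
  have bounds: "\<bar>h\<bar> \<le> int t0" "\<And>i. i \<ge> int (length w) + int t0 \<Longrightarrow> c i = Blank"
    using first_tape_bounds[OF R, of w t0] cfg ch by auto
  define L where "L = (LEAST l. c (h + int l) \<notin> range Letter)"
  \<comment> \<open>The head may be \<open>t0\<close> cells left of the origin, and blanks are
    certain only from \<open>t0\<close> cells behind the end of the input; hence the factor
    2.\<close>
  have ex: "c (h + int (length w + 2 * t0)) \<notin> range Letter"
    using bounds(2)[of "h + int (length w + 2 * t0)"] bounds(1) by auto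
  have L: "c (h + int L) \<notin> range Letter"
    unfolding L_def by (rule LeastI[of "\<lambda>l. c (h + int l) \<notin> range Letter", OF ex])
  have Lb: "L \<le> length w + 2 * t0"
    unfolding L_def by (rule Least_le[of "\<lambda>l. c (h + int l) \<notin> range Letter", OF ex])
  have below: "c (h + int i) \<in> range Letter" if "i < L" for i
    using not_less_Least[of i "\<lambda>l. c (h + int l) \<notin> range Letter"] that unfolding L_def by blast
  define v where "v = map (\<lambda>i. inv Letter (c (h + int i))) [0..<L]"
  have lv: "length v = L" unfolding v_def by simp
  have v: "c (h + int i) = Letter (v ! i)" if "i < length v" for i
    using below[of i] that unfolding v_def by (simp add: f_inv_into_f)
  have uniq: "u = v" if out: "outputs R w u" for u
  proof -
    obtain t' where t': "halted R (run R w t')" "word_at_head (hd (snd (run R w t'))) u"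
      using out unfolding outputs_def by blast
    have "t0 \<le> t'" unfolding t0_def using t'(1) by (rule Least_le)
    moreover have "run R w (t0 + s) = run R w t0" for s
      by (induction s) (use t0 in \<open>simp_all add: run_Suc step_def\<close>)
    ultimately have "run R w t' = run R w t0" using le_Suc_ex by metis
    then have u: "\<And>i. i < length u \<Longrightarrow> c (h + int i) = Letter (u ! i)"
      "c (h + int (length u)) = Blank"
      using t'(2) cfg ch unfolding word_at_head_def by auto
    have "length u = length v"
    proof (rule linorder_cases[of "length u" "length v"])
      assume "length u < length v"
      then show ?thesis using v[of "length u"] u(2) by simp
    next
      assume "length v < length u"
      then show ?thesis using u(1)[of "length v"] L lv by auto
    qed
    then show ?thesis using u(1) v by (intro nth_equalityI) auto
  qed
  have run0: "run comp w t0 = (enc (Inl (fst (run R w t0))), ((c, h) # ts) @ replicate heads blank_tape)"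
    using run_reduction_phase[OF before] cfg ch by simp
  have run1: "run comp w (t0 + 1) = (enc (Inr None), ((c, h) # ts) @ replicate heads blank_tape)"
  proof -
    let ?ts = "((c, h) # ts) @ replicate heads blank_tape"
    have "comp_delta (Inl (fst (run R w t0))) (map read_tape ?ts) =
        (Inr None, keep (map read_tape ?ts))"
      using t0 unfolding halted_def by simp
    from step_comp[OF _ _ this] wf
    have "step comp (enc (Inl (fst (run R w t0))), ?ts) =
        (enc (Inr None), map2 act (keep (map read_tape ?ts)) ?ts)"
      unfolding wf_config_def by simp
    then show ?thesis using run0 by (simp only: map2_act_keep add_Suc_right add_0_right One_nat_def run_Suc)
  qed
  let ?h = "h + int (length v)"
  have run2: "run comp w (t0 + 1 + Suc (length v)) = (enc (Inr (Some q0)), ((c, ?h) # ts) @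
       map (Pair (word_tape v)) (replicate heads (int (length v) - 1)))"
    unfolding run_add[of comp w "t0 + 1"] run1 using L lv v lts by (intro copy_phase) auto
  obtain t2 where t2: "t2 \<le> poly p (length v)"
    "fst ((mh_step ctrl {qa, qr} v ^^ t2) (q0, replicate heads (int (length v) - 1))) =
        (if P v then qa else qr)"
    using mh by blast
  let ?s = "t0 + 1 + Suc (length v) + t2"
  have "length ((c, ?h) # ts) = tapes R" using lts R_facts(1) by simp
  from multihead_phase[OF this, of "replicate heads (int (length v) - 1)" q0 t2 v] Q(1)
  have "fst (run comp w ?s) = enc (Inr (Some (if P v then qa else qr)))"
    unfolding run_add[of comp w "t0 + 1 + Suc (length v)"] run2 t2(2)[symmetric]
    by (simp add: split_beta)
  then have "fst (run comp w ?s) = (if P v then acc comp else rej comp)"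
    by (simp add: comp_def)
  moreover have "?s \<le> b + 1 + (length w + 2 * b + 1) + poly p (length w + 2 * b)"
  proof -
    have "length v \<le> length w + 2 * b" using Lb lv t0b by simp
    then have "poly p (length v) \<le> poly p (length w + 2 * b)" by (rule poly_nat_mono)
    then show ?thesis using t2(1) t0b \<open>length v \<le> length w + 2 * b\<close> by simp
  qed
  ultimately show ?thesis using uniq by blast
qed

end

text \<open>The bound on the automaton is required for every word \<open>v\<close>, because the
  composed machine has to halt on inputs for which \<open>R\<close> leaves an arbitrary
  word.\<close>

lemma (in multihead) decide_after_reduction:
  fixes p :: "nat poly"
  assumes tm: "turing_machine R" and poly_time: "polynomial_time R"
    and mh: "\<And>v. \<exists>t \<le> poly p (length v).
      fst ((mh_step ctrl {qa, qr} v ^^ t) (q0, replicate heads (int (length v) - 1))) =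
        (if P v then qa else qr)"
  shows "\<exists>T. turing_machine T \<and> polynomial_time T \<and>
    (\<forall>w v. outputs R w v \<longrightarrow> (if P v then accepts T w else rejects T w))"
proof -
  interpret reduction_then_multihead heads Q q0 qa qr ctrl R
    by unfold_locales (rule tm)
  obtain r where r: "\<And>w. \<exists>t \<le> poly r (length w). halted R (run R w t)"
    using poly_time unfolding polynomial_time_def by blast
  let ?X = "[:0, 1:] :: nat poly"
  \<comment> \<open>The word handed to the automaton has length at most
    \<open>length w + 2 * poly r (length w)\<close>, which explains the composed polynomial.\<close>
  let ?p = "r + 1 + (?X + 2 * r + 1) + pcompose p (?X + 2 * r)"
  have run: "\<exists>v s. s \<le> poly ?p (length w) \<and>
      fst (run comp w s) = (if P v then acc comp else rej comp) \<and>
      (\<forall>u. outputs R w u \<longrightarrow> u = v)" for w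
  proof -
    obtain t where "t \<le> poly r (length w)" "halted R (run R w t)" using r by blast
    from comp_run[OF this(2,1) mh] show ?thesis by (simp add: poly_pcompose)
  qed
  have "polynomial_time comp"
    unfolding polynomial_time_def
  proof (intro exI[of _ ?p] allI)
    fix w
    obtain v s where "s \<le> poly ?p (length w)"
      "fst (run comp w s) = (if P v then acc comp else rej comp)" using run by blast
    then show "\<exists>t\<le>poly ?p (length w). halted comp (run comp w t)"
      by (intro exI[of _ s]) (auto simp: halted_def)
  qed
  moreover have "if P u then accepts comp w else rejects comp w" if "outputs R w u" for w u
  proof -
    obtain v s where "fst (run comp w s) = (if P v then acc comp else rej comp)"
      "\<forall>u. outputs R w u \<longrightarrow> u = v" using run by blast
    then show ?thesis using that unfolding accepts_def rejects_def by auto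
  qed
  ultimately show ?thesis using turing_machine_comp by blast
qed

section \<open>Odometers\<close>

definition ruler :: "word \<Rightarrow> nat" where
  "ruler v = length (takeWhile (\<lambda>a. a = One) v)"

lemma ruler_le: "ruler v \<le> length v"
  unfolding ruler_def by (rule length_takeWhile_le)

lemma word_tape_below_ruler: "q < ruler v \<Longrightarrow> word_tape v (int q) = Letter One"
  using ruler_le[of v] nth_mem[of q "takeWhile (\<lambda>a. a = One) v"]
  by (auto simp: ruler_def word_tape_def takeWhile_nth dest!: set_takeWhileD)

lemma word_tape_ruler: "word_tape v (int (ruler v)) \<noteq> Letter One"
  unfolding ruler_def word_tape_def using nth_length_takeWhile[of "\<lambda>a. a = One" v] by auto

text \<open>
  Head 0 is a ruler, which limits a scan to the initial block of ones; heads \<open>1, \<dots>, K\<close> are the digits of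
  the odometer and return to their home positions after each scan. \<open>Inc j b\<close> advances digit \<open>j\<close>, and
  \<open>Reset j\<close> returns it to 0 before a carry. The innermost digit \<open>K\<close> is quantified universally and the
  others existentially; the flag records whether no counterexample has been met since digit \<open>K\<close> was 0.
  Nothing is assumed about the format of the word, hence the running time is bounded on all words.
\<close>

datatype 's odometer_state =
  Rewind | Scan 's bool | Back bool | Inc nat bool | Reset nat | Halt bool

locale odometer =
  fixes K :: nat and \<delta> :: "'s \<Rightarrow> cell list \<Rightarrow> 's" and s0 :: 's and S :: "'s set" and \<Phi> :: "'s \<Rightarrow> bool"
  assumes K: "K > 0" and S: "finite S" "s0 \<in> S"
    and \<delta>: "s \<in> S \<Longrightarrow> length cs = K \<Longrightarrow> \<delta> s cs \<in> S"
begin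

definition move_one :: "nat \<Rightarrow> move \<Rightarrow> move list" where
  "move_one j m = (replicate (Suc K) Stay)[j := m]"

lemma length_move_one: "length (move_one j m) = Suc K"
  unfolding move_one_def by (simp del: replicate_Suc)

text \<open>Blanks mark both ends: the one at cell -1 ends leftward motion, the one at cell
  \<open>length v\<close> is the last value of a digit. Reaching \<open>Inc 0\<close> means that the
  outermost digit has overflowed, so all existential choices have failed. The flag matters only at
  digit \<open>K\<close>, and a change of any other digit restarts it.\<close>

fun ctrl :: "'s odometer_state \<Rightarrow> cell list \<Rightarrow> 's odometer_state \<times> move list" where
  "ctrl Rewind cs =
     (if hd cs \<noteq> Blank then (Rewind, replicate (Suc K) MoveLeft)
      else (Scan s0 True, replicate (Suc K) MoveRight))"
| "ctrl (Scan s b) cs =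
     (if hd cs = Letter One then (Scan (\<delta> s (tl cs)) b, replicate (Suc K) MoveRight)
      else (Back (b \<and> \<Phi> (\<delta> s (tl cs))), replicate (Suc K) MoveLeft))"
| "ctrl (Back b) cs =
     (if hd cs \<noteq> Blank then (Back b, replicate (Suc K) MoveLeft)
      else (Inc K b, replicate (Suc K) MoveRight))"
| "ctrl (Inc j b) cs =
     (if j = 0 then (Halt False, replicate (Suc K) Stay)
      else if cs ! j \<noteq> Blank then (Scan s0 (j < K \<or> b), move_one j MoveRight)
      else if j = K \<and> b then (Halt True, replicate (Suc K) Stay)
      else (Reset j, move_one j MoveLeft))"
| "ctrl (Reset j) cs =
     (if cs ! j \<noteq> Blank then (Reset j, move_one j MoveLeft)
      else (Inc (j - 1) True, move_one j MoveRight))"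
| "ctrl (Halt b) cs = (Halt b, replicate (Suc K) Stay)"

definition Q :: "'s odometer_state set" where
  "Q = {Rewind, Halt True, Halt False, Back True, Back False} \<union>
     (\<lambda>(s, b). Scan s b) ` (S \<times> UNIV) \<union> (\<lambda>(j, b). Inc j b) ` ({..K} \<times> UNIV) \<union> Reset ` {..K}"

sublocale multihead "Suc K" Q Rewind "Halt True" "Halt False" ctrl
proof
  show "finite Q" unfolding Q_def using S by simp
  show "Rewind \<in> Q" "Halt True \<in> Q" "Halt False \<in> Q" unfolding Q_def by auto
  have Q: "Rewind \<in> Q" "Halt b \<in> Q" "Back b \<in> Q" "Scan s b \<in> Q \<longleftrightarrow> s \<in> S"
    "Inc j b \<in> Q \<longleftrightarrow> j \<le> K" "Reset j \<in> Q \<longleftrightarrow> j \<le> K" for b s j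
    unfolding Q_def by (cases b; auto)+
  show "fst (ctrl q cs) \<in> Q \<and> length (snd (ctrl q cs)) = Suc K"
    if "q \<in> Q" "length cs = Suc K" for q cs
    using that S(2) \<delta> by (cases q) (auto simp: Q length_move_one)
qed simp

abbreviation mstep where
  "mstep \<equiv> mh_step ctrl {Halt True, Halt False}"

definition reaches :: "word \<Rightarrow> nat \<Rightarrow> 's odometer_state \<times> int list \<Rightarrow> 's odometer_state \<times> int list \<Rightarrow> bool"
  where "reaches v B c c' \<longleftrightarrow> (\<exists>t\<le>B. (mstep v ^^ t) c = c')"

lemma reaches_refl: "reaches v B c c"
  unfolding reaches_def by (intro exI[of _ 0]) simp

lemma reaches_trans:
  assumes "reaches v A c d" "reaches v B d e" "A + B \<le> C"
  shows "reaches v C c e"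
proof -
  obtain s t where "s \<le> A" "(mstep v ^^ s) c = d" "t \<le> B" "(mstep v ^^ t) d = e"
    using assms unfolding reaches_def by blast
  then show ?thesis
    unfolding reaches_def using assms(3) by (intro exI[of _ "t + s"]) (simp add: funpow_add)
qed

lemma reaches_step:
  assumes "q \<notin> {Halt True, Halt False}" "ctrl q (map (word_tape v) xs) = (q', ms)"
    and "map2 move_head ms xs = xs'"
  shows "reaches v 1 (q, xs) (q', xs')"
  unfolding reaches_def using assms by (intro exI[of _ 1]) (simp add: mh_step_def)

lemma move_all:
  assumes "length xs = Suc K"
  shows "map2 move_head (replicate (Suc K) m) xs = map (move_head m) xs"
  by (rule nth_equalityI) (use assms in \<open>simp_all del: replicate_Suc\<close>)

lemma move_stay: "length xs = Suc K \<Longrightarrow> map2 move_head (replicate (Suc K) Stay) xs = xs"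
  by (rule nth_equalityI) (simp_all del: replicate_Suc)

lemma move_one:
  assumes "length xs = Suc K" "j \<le> K"
  shows "map2 move_head (move_one j m) xs = xs[j := move_head m (xs ! j)]"
  by (rule nth_equalityI)
    (use assms in \<open>simp_all del: replicate_Suc add: move_one_def nth_list_update\<close>)

section \<open>A single scan and its outcome\<close>

definition column :: "word \<Rightarrow> int list \<Rightarrow> nat \<Rightarrow> cell list" where
  "column v xs q = map (\<lambda>x. word_tape v (x + int q)) xs"

definition scanned :: "word \<Rightarrow> int list \<Rightarrow> nat \<Rightarrow> 's" where
  "scanned v xs q = foldl \<delta> s0 (map (column v xs) [0..<q])"

text \<open>The column at offset \<open>ruler v\<close>, which ends the scan, is included: a block
  consists of a separator and as many symbols as the ruler is long, hence
  \<open>Suc (ruler v)\<close> columns.\<close>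

definition matrix :: "word \<Rightarrow> int list \<Rightarrow> bool" where
  "matrix v xs = \<Phi> (scanned v xs (Suc (ruler v)))"

lemma scan_forward:
  assumes "length xs = K" "q \<le> ruler v"
  shows "reaches v q (Scan s0 b, 0 # xs)
    (Scan (scanned v xs q) b, map (\<lambda>x. x + int q) (0 # xs))"
  using assms(2)
proof (induction q)
  case 0
  then show ?case by (simp add: scanned_def reaches_refl)
next
  case (Suc q)
  let ?xs = "map (\<lambda>x. x + int q) (0 # xs)"
  have "reaches v 1 (Scan (scanned v xs q) b, ?xs)
      (Scan (scanned v xs (Suc q)) b, map (\<lambda>x. x + int (Suc q)) (0 # xs))"
  proof (rule reaches_step)
    show "ctrl (Scan (scanned v xs q) b) (map (word_tape v) ?xs) =
        (Scan (scanned v xs (Suc q)) b, replicate (Suc K) MoveRight)"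
      using Suc.prems word_tape_below_ruler[of q v]
      by (simp add: scanned_def column_def comp_def)
    show "map2 move_head (replicate (Suc K) MoveRight) ?xs = map (\<lambda>x. x + int (Suc q)) (0 # xs)"
      by (subst move_all) (use assms(1) in auto)
  qed simp
  from reaches_trans[OF Suc.IH[OF Suc_leD[OF Suc.prems]] this] show ?case by simp
qed

text \<open>The step that ends the forward scan has already moved all heads one cell back, hence the
  offset \<open>q - 1\<close>. Head 0 finally reads the blank at cell -1, and one joint move to the
  right restores the home positions.\<close>

lemma scan_back:
  assumes "length xs = K" "q \<le> ruler v"
  shows "reaches v (Suc q) (Back b, map (\<lambda>x. x + int q - 1) (0 # xs)) (Inc K b, 0 # xs)"
  using assms(2)
proof (induction q)
  case 0
  show ?case
  proof (rule reaches_step[where ms = "replicate (Suc K) MoveRight", THEN reaches_trans[OF _ reaches_refl[of v 0]]])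
    show "ctrl (Back b) (map (word_tape v) (map (\<lambda>x. x + int 0 - 1) (0 # xs))) =
        (Inc K b, replicate (Suc K) MoveRight)"
      by (simp add: word_tape_def)
    show "map2 move_head (replicate (Suc K) MoveRight) (map (\<lambda>x. x + int 0 - 1) (0 # xs)) = 0 # xs"
      by (subst move_all) (use assms(1) in \<open>auto simp: comp_def\<close>)
  qed simp_all
next
  case (Suc q)
  let ?xs = "map (\<lambda>x. x + int (Suc q) - 1) (0 # xs)"
  have "reaches v 1 (Back b, ?xs) (Back b, map (\<lambda>x. x + int q - 1) (0 # xs))"
  proof (rule reaches_step)
    show "ctrl (Back b) (map (word_tape v) ?xs) = (Back b, replicate (Suc K) MoveLeft)"
      using Suc.prems word_tape_below_ruler[of q v] by simp
    show "map2 move_head (replicate (Suc K) MoveLeft) ?xs = map (\<lambda>x. x + int q - 1) (0 # xs)"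
      by (subst move_all) (use assms(1) in auto)
  qed simp
  from reaches_trans[OF this Suc.IH[OF Suc_leD[OF Suc.prems]]] show ?case by simp
qed

lemma scan_total:
  assumes xs: "length xs = K"
  shows "reaches v (2 * length v + 3) (Scan s0 b, 0 # xs) (Inc K (b \<and> matrix v xs), 0 # xs)"
proof -
  let ?n = "ruler v" and ?b = "b \<and> matrix v xs"
  let ?xs = "map (\<lambda>x. x + int ?n) (0 # xs)"
  have "reaches v 1 (Scan (scanned v xs ?n) b, ?xs) (Back ?b, map (\<lambda>x. x + int ?n - 1) (0 # xs))"
  proof (rule reaches_step)
    show "ctrl (Scan (scanned v xs ?n) b) (map (word_tape v) ?xs) =
        (Back ?b, replicate (Suc K) MoveLeft)"
      using word_tape_ruler[of v] by (simp add: matrix_def scanned_def column_def comp_def)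
    show "map2 move_head (replicate (Suc K) MoveLeft) ?xs = map (\<lambda>x. x + int ?n - 1) (0 # xs)"
      by (subst move_all) (use xs in auto)
  qed simp
  from reaches_trans[OF scan_forward[OF xs order_refl, of v b] this order_refl]
  have "reaches v (?n + 1) (Scan s0 b, 0 # xs) (Back ?b, map (\<lambda>x. x + int ?n - 1) (0 # xs))" .
  from reaches_trans[OF this scan_back[OF xs order_refl]]
  show ?thesis using ruler_le[of v] by simp
qed

text \<open>The lists \<open>pre\<close> and \<open>post\<close> hold the digits before and after
  the moving one, whose number is \<open>Suc (length pre)\<close> because head 0 is the
  ruler.\<close>

lemma reset_head:
  assumes "length pre + Suc (length post) = K" "y \<le> length v"
  shows "reaches v (Suc y) (Reset (Suc (length pre)), 0 # pre @ (int y - 1) # post)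
    (Inc (length pre) True, 0 # pre @ 0 # post)"
  using assms(2)
proof (induction y)
  case 0
  show ?case
  proof (rule reaches_step[where ms = "move_one (Suc (length pre)) MoveRight",
        THEN reaches_trans[OF _ reaches_refl[of v 0]]])
    show "map2 move_head (move_one (Suc (length pre)) MoveRight) (0 # pre @ (int 0 - 1) # post) =
        0 # pre @ 0 # post"
      by (subst move_one) (use assms(1) in auto)
  qed (simp_all add: word_tape_def nth_append)
next
  case (Suc y)
  have "reaches v 1 (Reset (Suc (length pre)), 0 # pre @ (int (Suc y) - 1) # post)
    (Reset (Suc (length pre)), 0 # pre @ (int y - 1) # post)"
  proof (rule reaches_step[where ms = "move_one (Suc (length pre)) MoveLeft"])
    show "map2 move_head (move_one (Suc (length pre)) MoveLeft)
        (0 # pre @ (int (Suc y) - 1) # post) = 0 # pre @ (int y - 1) # post"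
      by (subst move_one) (use assms(1) in auto)
  qed (use Suc.prems in \<open>simp_all add: word_tape_def nth_append\<close>)
  from reaches_trans[OF this Suc.IH[OF Suc_leD[OF Suc.prems]]] show ?case by simp
qed

lemma increment:
  assumes "length pre + Suc (length post) = K" "y < length v"
  shows "reaches v 1 (Inc (Suc (length pre)) b, 0 # pre @ int y # post)
    (Scan s0 (post \<noteq> [] \<or> b), 0 # pre @ int (Suc y) # post)"
proof (rule reaches_step[where ms = "move_one (Suc (length pre)) MoveRight"])
  show "map2 move_head (move_one (Suc (length pre)) MoveRight) (0 # pre @ int y # post) =
      0 # pre @ int (Suc y) # post"
    by (subst move_one) (use assms(1) in auto)
  have "Suc (length pre) < K \<longleftrightarrow> post \<noteq> []" using assms(1) by (cases post) auto
  then show "ctrl (Inc (Suc (length pre)) b) (map (word_tape v) (0 # pre @ int y # post)) =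
      (Scan s0 (post \<noteq> [] \<or> b), move_one (Suc (length pre)) MoveRight)"
    using assms(2) by (simp add: word_tape_def nth_append)
qed simp

lemma carry:
  assumes "length pre + Suc (length post) = K" "post \<noteq> [] \<or> \<not> b"
  shows "reaches v (length v + 2) (Inc (Suc (length pre)) b, 0 # pre @ int (length v) # post)
    (Inc (length pre) True, 0 # pre @ 0 # post)"
proof -
  have "reaches v 1 (Inc (Suc (length pre)) b, 0 # pre @ int (length v) # post)
    (Reset (Suc (length pre)), 0 # pre @ (int (length v) - 1) # post)"
  proof (rule reaches_step[where ms = "move_one (Suc (length pre)) MoveLeft"])
    show "map2 move_head (move_one (Suc (length pre)) MoveLeft) (0 # pre @ int (length v) # post) =
        0 # pre @ (int (length v) - 1) # post"
      by (subst move_one) (use assms(1) in auto)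
  qed (use assms in \<open>auto simp: word_tape_def nth_append\<close>)
  from reaches_trans[OF this reset_head[OF assms(1) order_refl]] show ?thesis by simp
qed

lemma accept_inner:
  assumes "Suc (length pre) = K"
  shows "reaches v 1 (Inc K True, 0 # pre @ [int (length v)]) (Halt True, 0 # pre @ [int (length v)])"
proof (rule reaches_step[where ms = "replicate (Suc K) Stay"])
  show "map2 move_head (replicate (Suc K) Stay) (0 # pre @ [int (length v)]) = 0 # pre @ [int (length v)]"
    by (rule move_stay) (use assms in simp)
  let ?cs = "map (word_tape v) (0 # pre @ [int (length v)])"
  have "?cs ! K = Blank" unfolding assms[symmetric] by (simp add: word_tape_def nth_append)
  then show "ctrl (Inc K True) ?cs = (Halt True, replicate (Suc K) Stay)"
    using K by (simp only: ctrl.simps) simp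
qed simp

section \<open>Nested loops and their running time\<close>

fun holds :: "word \<Rightarrow> nat \<Rightarrow> int list \<Rightarrow> bool" where
  "holds v 0 pre = (\<forall>y\<le>length v. matrix v (pre @ [int y]))"
| "holds v (Suc r) pre = (\<exists>y\<le>length v. holds v r (pre @ [int y]))"

text \<open>Each of the \<open>Suc l\<close> values of the innermost digit costs a scan of at most
  \<open>2 * l + 3\<close> steps and an increment, a carry of at most \<open>l + 2\<close> steps, or
  acceptance. Each value of an outer digit costs one run of the loops inside it and an increment or
  a carry.\<close>

fun bound :: "nat \<Rightarrow> nat \<Rightarrow> nat" where
  "bound 0 l = Suc l * (3 * l + 6)"
| "bound (Suc r) l = Suc l * (bound r l + l + 3)"

text \<open>Generalized to a start at any \<open>y\<close> with any flag, for induction on the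
  number of values left. A false flag records an earlier counterexample, after which the loop can
  only end in a carry.\<close>

lemma inner_loop:
  assumes pre: "Suc (length pre) = K" and "y \<le> length v"
  shows "if b \<and> (\<forall>z\<in>{y..length v}. matrix v (pre @ [int z]))
    then \<exists>xs. reaches v (Suc (length v - y) * (3 * length v + 6))
      (Scan s0 b, 0 # pre @ [int y]) (Halt True, xs)
    else reaches v (Suc (length v - y) * (3 * length v + 6))
      (Scan s0 b, 0 # pre @ [int y]) (Inc (length pre) True, 0 # pre @ [0])"
  using assms(2)
proof (induction "length v - y" arbitrary: y b)
  case 0
  then have y: "y = length v" by simp
  have sc: "reaches v (2 * length v + 3) (Scan s0 b, 0 # pre @ [int y])
      (Inc K (b \<and> matrix v (pre @ [int y])), 0 # pre @ [int y])"
    by (rule scan_total) (use pre in simp)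
  show ?case
  proof (cases "b \<and> matrix v (pre @ [int y])")
    case True
    have "reaches v 1 (Inc K (b \<and> matrix v (pre @ [int y])), 0 # pre @ [int y])
        (Halt True, 0 # pre @ [int y])"
      using accept_inner[OF pre] True y by simp
    from reaches_trans[OF sc this, of "Suc (length v - y) * (3 * length v + 6)"]
    show ?thesis using True y by auto
  next
    case False
    have "reaches v (length v + 2) (Inc K (b \<and> matrix v (pre @ [int y])), 0 # pre @ [int y])
        (Inc (length pre) True, 0 # pre @ [0])"
      using carry[of pre "[]" "b \<and> matrix v (pre @ [int y])" v] False y pre by simp
    from reaches_trans[OF sc this, of "Suc (length v - y) * (3 * length v + 6)"]
    show ?thesis using False y by auto
  qed
next
  case (Suc d)
  let ?b = "b \<and> matrix v (pre @ [int y])"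
  have y: "y < length v" "d = length v - Suc y" using Suc by simp_all
  have sc: "reaches v (2 * length v + 3) (Scan s0 b, 0 # pre @ [int y])
      (Inc K ?b, 0 # pre @ [int y])"
    by (rule scan_total) (use pre in simp)
  have inc: "reaches v 1 (Inc K ?b, 0 # pre @ [int y]) (Scan s0 ?b, 0 # pre @ [int (Suc y)])"
    using increment[of pre "[]" y v ?b] y pre by simp
  have st: "reaches v (2 * length v + 4) (Scan s0 b, 0 # pre @ [int y])
      (Scan s0 ?b, 0 # pre @ [int (Suc y)])"
    by (rule reaches_trans[OF sc inc]) simp
  have split: "{y..length v} = insert y {Suc y..length v}" using y by auto
  have le: "2 * length v + 4 + Suc (length v - Suc y) * (3 * length v + 6) \<le>
      Suc (length v - y) * (3 * length v + 6)"
    using y Suc_diff_Suc[OF y(1)] by simp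
  have IH: "if ?b \<and> (\<forall>z\<in>{Suc y..length v}. matrix v (pre @ [int z]))
    then \<exists>xs. reaches v (Suc (length v - Suc y) * (3 * length v + 6))
      (Scan s0 ?b, 0 # pre @ [int (Suc y)]) (Halt True, xs)
    else reaches v (Suc (length v - Suc y) * (3 * length v + 6))
      (Scan s0 ?b, 0 # pre @ [int (Suc y)]) (Inc (length pre) True, 0 # pre @ [0])"
    by (rule Suc(1)[OF y(2)]) (use y(1) in simp)
  show ?case
  proof (cases "?b \<and> (\<forall>z\<in>{Suc y..length v}. matrix v (pre @ [int z]))")
    case True
    then obtain xs where "reaches v (Suc (length v - Suc y) * (3 * length v + 6))
      (Scan s0 ?b, 0 # pre @ [int (Suc y)]) (Halt True, xs)" using IH by auto
    from reaches_trans[OF st this le] show ?thesis using True split by auto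
  next
    case False
    then have "reaches v (Suc (length v - Suc y) * (3 * length v + 6))
      (Scan s0 ?b, 0 # pre @ [int (Suc y)]) (Inc (length pre) True, 0 # pre @ [0])"
      using IH by (simp only: if_False)
    from reaches_trans[OF st this le] show ?thesis using False split by auto
  qed
qed

text \<open>A failing level leaves its own digits at 0 and passes the carry on to digit
  \<open>length pre\<close>. That is the situation in which the surrounding level increments its
  digit, so the levels nest.\<close>

lemma level:
  assumes "length pre + Suc r = K"
  shows "if holds v r pre
    then \<exists>xs. reaches v (bound r (length v)) (Scan s0 True, 0 # pre @ replicate (Suc r) 0) (Halt True, xs)
    else reaches v (bound r (length v)) (Scan s0 True, 0 # pre @ replicate (Suc r) 0)
      (Inc (length pre) True, 0 # pre @ replicate (Suc r) 0)"
  using assms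
proof (induction r arbitrary: pre)
  case 0
  then have pre: "Suc (length pre) = K" by simp
  have "holds v 0 pre \<longleftrightarrow> True \<and> (\<forall>z\<in>{0..length v}. matrix v (pre @ [int z]))" by auto
  then show ?case using inner_loop[OF pre le0[of "length v"], of True]
    by (simp only: bound.simps diff_zero replicate.simps of_nat_0)
next
  case (Suc r)
  note level_r = Suc.IH and len_r = Suc.prems
  let ?post = "replicate (Suc r) (0::int)" and ?B = "bound r (length v)"
  have len: "length pre + Suc (length ?post) = K" using Suc.prems by simp
  \<comment> \<open>The loop over one existential digit, from an arbitrary value \<open>y\<close>
    on, by induction on the distance to \<open>length v\<close>; each round is one use of the
    hypothesis for \<open>r\<close>.\<close>
  have "if \<exists>z\<in>{y..length v}. holds v r (pre @ [int z])
    then \<exists>xs. reaches v (Suc (length v - y) * (?B + length v + 3))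
      (Scan s0 True, 0 # pre @ int y # ?post) (Halt True, xs)
    else reaches v (Suc (length v - y) * (?B + length v + 3))
      (Scan s0 True, 0 # pre @ int y # ?post) (Inc (length pre) True, 0 # pre @ 0 # ?post)"
    if "y \<le> length v" for y
    using that
  proof (induction "length v - y" arbitrary: y)
    case 0
    then have y: "y = length v" by simp
    show ?case
    proof (cases "holds v r (pre @ [int y])")
      case True
      then obtain xs where "reaches v ?B (Scan s0 True, 0 # pre @ int y # ?post) (Halt True, xs)"
        using level_r[of "pre @ [int y]"] len_r by auto
      from reaches_trans[OF this reaches_refl[of v 0], of "?B + length v + 3"]
      show ?thesis using True y by auto
    next
      case False
      then have "reaches v ?B (Scan s0 True, 0 # pre @ int y # ?post)
          (Inc (Suc (length pre)) True, 0 # pre @ int y # ?post)"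
        using level_r[of "pre @ [int y]"] len_r by simp
      from reaches_trans[OF this carry[OF len, of True v, folded y], of "?B + length v + 3"]
      show ?thesis using False y by simp
    qed
  next
    case (Suc d)
    have y: "y < length v" "d = length v - Suc y" using Suc.hyps(2) by simp_all
    have split: "{y..length v} = insert y {Suc y..length v}" using y by auto
    have le: "?B + 1 + Suc (length v - Suc y) * (?B + length v + 3) \<le>
        Suc (length v - y) * (?B + length v + 3)"
      using y Suc_diff_Suc[OF y(1)] by simp
    show ?case
    proof (cases "holds v r (pre @ [int y])")
      case True
      then obtain xs where "reaches v ?B (Scan s0 True, 0 # pre @ int y # ?post) (Halt True, xs)"
        using level_r[of "pre @ [int y]"] len_r by auto
      from reaches_trans[OF this reaches_refl[of v 0], of "Suc (length v - y) * (?B + length v + 3)"]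
      show ?thesis using True split by auto
    next
      case False
      then have "reaches v ?B (Scan s0 True, 0 # pre @ int y # ?post)
          (Inc (Suc (length pre)) True, 0 # pre @ int y # ?post)"
        using level_r[of "pre @ [int y]"] len_r by simp
      from reaches_trans[OF this increment[OF len y(1)] order_refl]
      have st: "reaches v (?B + 1) (Scan s0 True, 0 # pre @ int y # ?post)
          (Scan s0 True, 0 # pre @ int (Suc y) # ?post)" by simp
      show ?thesis
      proof (cases "\<exists>z\<in>{Suc y..length v}. holds v r (pre @ [int z])")
        case True
        then obtain xs where "reaches v (Suc (length v - Suc y) * (?B + length v + 3))
          (Scan s0 True, 0 # pre @ int (Suc y) # ?post) (Halt True, xs)"
          using Suc.hyps(1)[OF y(2)] y(1) by auto
        from reaches_trans[OF st this le] show ?thesis using True split by auto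
      next
        case F: False
        then have "reaches v (Suc (length v - Suc y) * (?B + length v + 3))
          (Scan s0 True, 0 # pre @ int (Suc y) # ?post) (Inc (length pre) True, 0 # pre @ 0 # ?post)"
          using Suc.hyps(1)[OF y(2)] y(1) by (simp only: if_False)
        from reaches_trans[OF st this le] show ?thesis using F False split by auto
      qed
    qed
  qed
  from this[OF le0]
  have loop: "if \<exists>z\<in>{0..length v}. holds v r (pre @ [int z])
    then \<exists>xs. reaches v (Suc (length v - 0) * (?B + length v + 3))
      (Scan s0 True, 0 # pre @ int 0 # ?post) (Halt True, xs)
    else reaches v (Suc (length v - 0) * (?B + length v + 3))
      (Scan s0 True, 0 # pre @ int 0 # ?post) (Inc (length pre) True, 0 # pre @ 0 # ?post)" .
  have "holds v (Suc r) pre \<longleftrightarrow> (\<exists>z\<in>{0..length v}. holds v r (pre @ [int z]))" by auto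
  then show ?case using loop
    by (simp only: bound.simps diff_zero replicate.simps of_nat_0)
qed

text \<open>The degree grows with the number of digits, which will depend on \<open>N\<close>
  alone.\<close>

lemma bound_poly: "\<exists>p :: nat poly. \<forall>l. bound r l = poly p l"
proof (induction r)
  case 0
  show ?case by (intro exI[of _ "[:1, 1:] * [:6, 3:]"]) (simp add: algebra_simps)
next
  case (Suc r)
  then obtain p :: "nat poly" where "\<forall>l. bound r l = poly p l" by blast
  then show ?case by (intro exI[of _ "[:1, 1:] * (p + [:3, 1:])"]) (simp add: algebra_simps)
qed

lemma rewind:
  assumes "y \<le> length v"
  shows "reaches v (Suc y) (Rewind, replicate (Suc K) (int y - 1)) (Scan s0 True, replicate (Suc K) 0)"
  using assms
proof (induction y)
  case 0
  show ?case
  proof (rule reaches_step[where ms = "replicate (Suc K) MoveRight",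
        THEN reaches_trans[OF _ reaches_refl[of v 0]]])
    show "map2 move_head (replicate (Suc K) MoveRight) (replicate (Suc K) (int 0 - 1)) =
        replicate (Suc K) 0"
      by (subst move_all) auto
  qed (simp_all add: word_tape_def)
next
  case (Suc y)
  have "reaches v 1 (Rewind, replicate (Suc K) (int (Suc y) - 1)) (Rewind, replicate (Suc K) (int y - 1))"
  proof (rule reaches_step[where ms = "replicate (Suc K) MoveLeft"])
    show "map2 move_head (replicate (Suc K) MoveLeft) (replicate (Suc K) (int (Suc y) - 1)) =
        replicate (Suc K) (int y - 1)"
      by (subst move_all) auto
  qed (use Suc.prems in \<open>simp_all add: word_tape_def\<close>)
  from reaches_trans[OF this Suc.IH[OF Suc_leD[OF Suc.prems]]] show ?case by simp
qed

lemma run_odometer: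
  "\<exists>p :: nat poly. \<forall>v. \<exists>t \<le> poly p (length v).
     fst ((mstep v ^^ t) (Rewind, replicate (Suc K) (int (length v) - 1))) =
       (if holds v (K - 1) [] then Halt True else Halt False)"
proof -
  obtain p :: "nat poly" where p: "\<And>l. bound (K - 1) l = poly p l" using bound_poly by blast
  have "\<exists>t \<le> poly (p + [:2, 1:]) (length v).
     fst ((mstep v ^^ t) (Rewind, replicate (Suc K) (int (length v) - 1))) =
       (if holds v (K - 1) [] then Halt True else Halt False)" for v
  proof -
    let ?c = "(Rewind, replicate (Suc K) (int (length v) - 1))"
    have K1: "replicate (Suc K) 0 = 0 # [] @ replicate (Suc (K - 1)) 0" using K by simp
    note rw = rewind[OF order_refl, of v, unfolded K1]
    have lev: "length ([] :: int list) + Suc (K - 1) = K" using K by simp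
    have "\<exists>xs. reaches v (length v + 2 + bound (K - 1) (length v)) ?c
        ((if holds v (K - 1) [] then Halt True else Halt False), xs)"
    proof (cases "holds v (K - 1) []")
      case True
      then obtain xs where "reaches v (bound (K - 1) (length v))
          (Scan s0 True, 0 # [] @ replicate (Suc (K - 1)) 0) (Halt True, xs)"
        using level[OF lev, of v] by auto
      from reaches_trans[OF rw this, of "length v + 2 + bound (K - 1) (length v)"]
      show ?thesis using True by auto
    next
      case False
      let ?xs = "0 # [] @ replicate (Suc (K - 1)) (0::int)"
      have "reaches v (bound (K - 1) (length v)) (Scan s0 True, ?xs) (Inc 0 True, ?xs)"
        using False level[OF lev, of v] by (simp only: if_False list.size)
      from reaches_trans[OF rw this order_refl]
      have "reaches v (Suc (length v) + bound (K - 1) (length v)) ?c (Inc 0 True, ?xs)" .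
      moreover have "reaches v 1 (Inc 0 True, ?xs) (Halt False, ?xs)"
      proof (rule reaches_step[where ms = "replicate (Suc K) Stay"])
        show "map2 move_head (replicate (Suc K) Stay) ?xs = ?xs"
          by (rule move_stay) (use K in simp)
      qed simp_all
      ultimately have "reaches v (length v + 2 + bound (K - 1) (length v)) ?c (Halt False, ?xs)"
        by (rule reaches_trans) simp
      then show ?thesis using False by auto
    qed
    then obtain xs t where t: "t \<le> length v + 2 + bound (K - 1) (length v)"
      "(mstep v ^^ t) ?c = ((if holds v (K - 1) [] then Halt True else Halt False), xs)"
      unfolding reaches_def by blast
    have "length v + 2 + bound (K - 1) (length v) = poly (p + [:2, 1:]) (length v)"
      unfolding p by simp
    then show ?thesis using t by (intro exI[of _ t]) simp
  qed
  then show ?thesis by blast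
qed

lemma holds_iff:
  "holds v r pre \<longleftrightarrow> (\<exists>ys. length ys = r \<and> set ys \<subseteq> {..length v} \<and>
     (\<forall>y\<le>length v. matrix v (pre @ map int (ys @ [y]))))"
proof (induction r arbitrary: pre)
  case 0
  then show ?case by simp
next
  case (Suc r)
  show ?case
  proof
    assume "holds v (Suc r) pre"
    then obtain y ys where "y \<le> length v" "length ys = r" "set ys \<subseteq> {..length v}"
      "\<forall>z\<le>length v. matrix v ((pre @ [int y]) @ map int (ys @ [z]))"
      using Suc.IH by auto
    then show "\<exists>ys. length ys = Suc r \<and> set ys \<subseteq> {..length v} \<and>
     (\<forall>y\<le>length v. matrix v (pre @ map int (ys @ [y])))"
      by (intro exI[of _ "y # ys"]) simp
  next
    assume "\<exists>ys. length ys = Suc r \<and> set ys \<subseteq> {..length v} \<and>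
     (\<forall>y\<le>length v. matrix v (pre @ map int (ys @ [y])))"
    then obtain y ys where "length ys = r" "y \<le> length v" "set ys \<subseteq> {..length v}"
      "\<forall>z\<le>length v. matrix v (pre @ map int ((y # ys) @ [z]))"
      by (auto simp: length_Suc_conv)
    then show "holds v (Suc r) pre" using Suc.IH[of "pre @ [int y]"] by auto
  qed
qed

end

section \<open>Searching for certificates\<close>

definition symbol :: "word \<Rightarrow> nat \<Rightarrow> nat \<Rightarrow> cell" where
  "symbol v x r = word_tape v (int x + int r)"

text \<open>The home position \<open>x\<close> of a head stands for the element \<open>first v x - 1\<close>, provided that
  \<open>0 < first v x \<le> ruler v\<close>.\<close>

definition first :: "word \<Rightarrow> nat \<Rightarrow> nat" where
  "first v x = (LEAST r. symbol v x r \<noteq> Letter One)"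

lemma first_iff:
  "(\<forall>r'<r. symbol v x r' = Letter One) \<and> symbol v x r \<noteq> Letter One \<longleftrightarrow> r = first v x"
proof -
  have "symbol v x (length v) \<noteq> Letter One" unfolding symbol_def word_tape_def by simp
  then have "symbol v x (first v x) \<noteq> Letter One" unfolding first_def by (rule LeastI)
  moreover have "symbol v x r' = Letter One" if "r' < first v x" for r'
    using not_less_Least[OF that[unfolded first_def]] by simp
  ultimately show ?thesis by (metis linorder_neqE_nat)
qed

lemma first_pos_iff: "0 < first v x \<longleftrightarrow> symbol v x 0 = Letter One"
  using first_iff[of 0 v x] by auto

text \<open>Forgetting the auxiliary symbols keeps the set of scan states finite.\<close>

definition clean :: "cell \<Rightarrow> cell" where
  "clean c = (if c \<in> range Letter then c else Blank)"

lemma clean_word_tape [simp]: "clean (word_tape v i) = word_tape v i"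
  unfolding clean_def word_tape_def by auto

lemma finite_clean: "finite (range clean)"
proof -
  have "range Letter \<subseteq> {Letter Zero, Letter One, Letter Sep}" using letter.exhaust by blast
  then show ?thesis by (intro finite_subset[of "range clean" "{Blank, Letter Zero, Letter One, Letter Sep}"])
    (auto simp: clean_def)
qed

text \<open>\<open>mem\<close> is the letter that counts as membership. Taking \<open>Zero\<close>
  makes a listed hyperplane be read as its complement, without any rewriting of the word.\<close>

locale minor_search =
  fixes m k :: nat and D :: "nat \<Rightarrow> nat set" and \<I> :: "nat set set" and mem :: letter
  assumes mem: "mem \<noteq> Sep"
begin

text \<open>Heads \<open>0, \<dots>, m - 1\<close> stand for elements and heads \<open>m, \<dots>, m + k\<close> for listed sets, the home
  position of the latter being the separator in front of the block. The data of a scan consist of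
  the columns read, each paired with the list telling which heads had read only ones before; an
  element head is at its element precisely when it reads its first symbol other than one.\<close>

type_synonym data = "(bool list \<times> cell list) set"

definition \<delta> :: "bool list \<times> data \<Rightarrow> cell list \<Rightarrow> bool list \<times> data" where
  "\<delta> s cs = (map2 (\<lambda>p c. p \<and> c = Letter One) (fst s) cs, insert (fst s, map clean cs) (snd s))"

definition s0 :: "bool list \<times> data" where
  "s0 = (replicate (Suc (m + k)) True, {})"

definition S :: "(bool list \<times> data) set" where
  "S = {ps. length ps = Suc (m + k)} \<times>
     Pow ({ps. length ps = Suc (m + k)} \<times> {cs. set cs \<subseteq> range clean \<and> length cs = Suc (m + k)})"

definition mark :: "bool list \<times> cell list \<Rightarrow> nat \<Rightarrow> bool" where
  "mark d i \<longleftrightarrow> fst d ! i \<and> snd d ! i \<noteq> Letter One"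

text \<open>Expresses \<open>0 < first\<close> and \<open>first \<le> ruler\<close> for head
  \<open>i\<close>: a one is read before any other symbol, and the mark occurs before the scan
  ends.\<close>

definition element_ok :: "data \<Rightarrow> nat \<Rightarrow> bool" where
  "element_ok A i \<longleftrightarrow> (\<exists>d\<in>A. fst d ! i \<and> snd d ! i = Letter One) \<and> (\<exists>d\<in>A. mark d i)"

text \<open>Says that the head starts on a separator, without knowing which column came first. The
  flag alone would also admit a separator behind a run of ones; the second conjunct excludes such a
  run.\<close>

definition block_ok :: "data \<Rightarrow> nat \<Rightarrow> bool" where
  "block_ok A j \<longleftrightarrow> (\<exists>d\<in>A. fst d ! j \<and> snd d ! j = Letter Sep) \<and>
     \<not> (\<exists>d\<in>A. fst d ! j \<and> snd d ! j = Letter One)"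

definition data_trace :: "data \<Rightarrow> nat \<Rightarrow> nat set" where
  "data_trace A j = {i. i < m \<and> (\<exists>d\<in>A. mark d i \<and> snd d ! j = Letter mem)}"

text \<open>The requirements on the first \<open>m + k\<close> heads are the same for every position
  of the last head and are checked in each scan. The final conjunct is conditional, so that a
  position of the universal head that is not the start of a block never counts as a
  counterexample.\<close>

definition \<Phi> :: "bool list \<times> data \<Rightarrow> bool" where
  "\<Phi> s \<longleftrightarrow> (let A = snd s in
     (\<forall>i<m. element_ok A i) \<and>
     (\<forall>i<m. \<forall>i'<m. i \<noteq> i' \<longrightarrow> \<not> (\<exists>d\<in>A. mark d i \<and> mark d i')) \<and>
     (\<forall>j<k. block_ok A (m + j) \<and> data_trace A (m + j) = D j) \<and>
     (block_ok A (m + k) \<longrightarrow>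
        (\<exists>d\<in>A. snd d ! (m + k) = Letter mem \<and> (\<forall>i<m. \<not> mark d i) \<and>
           (\<forall>j<k. snd d ! (m + j) \<noteq> Letter mem)) \<or>
        data_trace A (m + k) = {} \<or> data_trace A (m + k) \<notin> \<I>))"

sublocale odometer "Suc (m + k)" \<delta> s0 S \<Phi>
proof
  have "finite {ps :: bool list. set ps \<subseteq> UNIV \<and> length ps = Suc (m + k)}"
    by (rule finite_lists_length_eq) simp
  moreover have "finite {cs. set cs \<subseteq> range clean \<and> length cs = Suc (m + k)}"
    by (rule finite_lists_length_eq[OF finite_clean])
  ultimately show "finite S" unfolding S_def by simp
  show "s0 \<in> S" unfolding s0_def S_def by simp
  show "\<delta> s cs \<in> S" if "s \<in> S" "length cs = Suc (m + k)" for s cs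
    using that unfolding \<delta>_def S_def by auto
qed simp

section \<open>What the collected columns say about the word\<close>

definition datum :: "word \<Rightarrow> nat list \<Rightarrow> nat \<Rightarrow> bool list \<times> cell list" where
  "datum v ys r = (map (\<lambda>x. \<forall>r'<r. symbol v x r' = Letter One) ys, map (\<lambda>x. symbol v x r) ys)"

lemma scanned_eq:
  assumes "length ys = Suc (m + k)"
  shows "scanned v (map int ys) q =
    (map (\<lambda>x. \<forall>r'<q. symbol v x r' = Letter One) ys, datum v ys ` {..<q})"
proof (induction q)
  case 0
  have "map (\<lambda>x. True) ys = replicate (Suc (m + k)) True"
    using assms by (simp add: map_replicate_const)
  then show ?case unfolding scanned_def by (simp add: s0_def)
next
  case (Suc q)
  have col: "column v (map int ys) q = map (\<lambda>x. symbol v x q) ys"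
    by (simp add: column_def symbol_def)
  have "scanned v (map int ys) (Suc q) = \<delta> (scanned v (map int ys) q) (column v (map int ys) q)"
    by (simp add: scanned_def)
  also have "\<dots> = (map (\<lambda>x. (\<forall>r'<q. symbol v x r' = Letter One) \<and> symbol v x q = Letter One) ys,
      insert (datum v ys q) (datum v ys ` {..<q}))"
    unfolding Suc.IH col \<delta>_def
    by (auto simp: datum_def symbol_def zip_map_map zip_same_conv_map)
  also have "\<dots> = (map (\<lambda>x. \<forall>r'<Suc q. symbol v x r' = Letter One) ys, datum v ys ` {..<Suc q})"
    by (auto simp: less_Suc_eq lessThan_Suc)
  finally show ?case .
qed

text \<open>At offset \<open>f i\<close>, a head that started on a separator reads the entry of the
  element meant by head \<open>i\<close>. Traces and escaping elements thus become conditions on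
  single columns, which survive the loss of their order.\<close>

lemma matrix_iff:
  fixes v :: word
  assumes len: "length ys = m + k"
  defines "f \<equiv> \<lambda>i. first v (ys ! i)" and "g \<equiv> \<lambda>j. symbol v (ys ! (m + j))"
  shows "matrix v (map int (ys @ [y])) \<longleftrightarrow>
    (\<forall>i<m. 0 < f i \<and> f i \<le> ruler v) \<and> inj_on f {..<m} \<and>
    (\<forall>j<k. g j 0 = Letter Sep \<and> {i. i < m \<and> g j (f i) = Letter mem} = D j) \<and>
    (symbol v y 0 = Letter Sep \<longrightarrow>
       (\<exists>r\<le>ruler v. symbol v y r = Letter mem \<and> r \<notin> f ` {..<m} \<and> (\<forall>j<k. g j r \<noteq> Letter mem)) \<or>
       {i. i < m \<and> symbol v y (f i) = Letter mem} = {} \<or>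
       {i. i < m \<and> symbol v y (f i) = Letter mem} \<notin> \<I>)"
proof -
  let ?zs = "ys @ [y]" and ?n = "ruler v"
  let ?A = "datum v ?zs ` {..<Suc ?n}"
  have A: "snd (scanned v (map int ?zs) (Suc ?n)) = ?A"
    using scanned_eq[of ?zs v "Suc ?n"] len by simp
  have past: "fst (datum v ?zs r) ! i \<longleftrightarrow> (\<forall>r'<r. symbol v (?zs ! i) r' = Letter One)"
    and cell: "snd (datum v ?zs r) ! i = symbol v (?zs ! i) r" if "i \<le> m + k" for r i
    using that len by (simp_all add: datum_def del: map_append)
  have zs: "i < m \<Longrightarrow> ?zs ! i = ys ! i" "j < k \<Longrightarrow> ?zs ! (m + j) = ys ! (m + j)"
    "?zs ! (m + k) = y" for i j
    using len by (simp_all add: nth_append)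
  have mk: "mark (datum v ?zs r) i \<longleftrightarrow> r = f i" if "i < m" for r i
    using past[of i r] cell[of i r] that zs(1) first_iff[of r v "ys ! i"]
    by (simp add: mark_def f_def)
  have el: "element_ok ?A i \<longleftrightarrow> 0 < f i \<and> f i \<le> ?n" if i: "i < m" for i
  proof -
    have "(\<exists>d\<in>?A. fst d ! i \<and> snd d ! i = Letter One) \<longleftrightarrow> symbol v (ys ! i) 0 = Letter One"
    proof
      assume "\<exists>d\<in>?A. fst d ! i \<and> snd d ! i = Letter One"
      then obtain r where "\<forall>r'<r. symbol v (ys ! i) r' = Letter One" "symbol v (ys ! i) r = Letter One"
        using past[of i] cell[of i] i zs(1)[OF i] by auto
      then show "symbol v (ys ! i) 0 = Letter One" by (cases r) auto
    next
      assume "symbol v (ys ! i) 0 = Letter One"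
      then have "fst (datum v ?zs 0) ! i \<and> snd (datum v ?zs 0) ! i = Letter One"
        using past[of i 0] cell[of i 0] i zs(1)[OF i] by simp
      then show "\<exists>d\<in>?A. fst d ! i \<and> snd d ! i = Letter One" by blast
    qed
    moreover have "(\<exists>d\<in>?A. mark d i) \<longleftrightarrow> f i \<le> ?n" using mk[OF i] by (auto simp: less_Suc_eq_le)
    ultimately show ?thesis unfolding element_ok_def f_def first_pos_iff by blast
  qed
  have bl: "block_ok ?A j \<longleftrightarrow> symbol v (?zs ! j) 0 = Letter Sep" if j: "j \<le> m + k" for j
  proof
    assume ok: "block_ok ?A j"
    then obtain r where r: "r \<le> ?n" "\<forall>r'<r. symbol v (?zs ! j) r' = Letter One"
      "symbol v (?zs ! j) r = Letter Sep"
      unfolding block_ok_def using past[OF j] cell[OF j] by (auto simp: less_Suc_eq_le)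
    have "datum v ?zs 0 \<in> ?A" by blast
    then have "\<not> (fst (datum v ?zs 0) ! j \<and> snd (datum v ?zs 0) ! j = Letter One)"
      using ok unfolding block_ok_def by blast
    then have "symbol v (?zs ! j) 0 \<noteq> Letter One"
      using past[OF j, of 0] cell[OF j, of 0] by simp
    then show "symbol v (?zs ! j) 0 = Letter Sep" using r by (cases r) auto
  next
    assume s: "symbol v (?zs ! j) 0 = Letter Sep"
    have "fst (datum v ?zs 0) ! j \<and> snd (datum v ?zs 0) ! j = Letter Sep"
      using s past[OF j, of 0] cell[OF j, of 0] by simp
    moreover have "\<not> (fst (datum v ?zs r) ! j \<and> snd (datum v ?zs r) ! j = Letter One)" for r
      using s past[OF j, of r] cell[OF j, of r] by (cases r) auto
    ultimately show "block_ok ?A j" unfolding block_ok_def by blast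
  qed
  have tr: "data_trace ?A j = {i. i < m \<and> symbol v (?zs ! j) (f i) = Letter mem}"
    if j: "j \<le> m + k" and f: "\<forall>i<m. f i \<le> ?n" for j
    unfolding data_trace_def using mk cell[OF j] f by (auto simp: less_Suc_eq_le)
  have dist: "(\<forall>i<m. \<forall>i'<m. i \<noteq> i' \<longrightarrow> \<not> (\<exists>d\<in>?A. mark d i \<and> mark d i')) \<longleftrightarrow> inj_on f {..<m}"
    if f: "\<forall>i<m. f i \<le> ?n"
    using mk f unfolding inj_on_def by (auto simp: less_Suc_eq_le)
  have ex: "(\<exists>d\<in>?A. snd d ! (m + k) = Letter mem \<and> (\<forall>i<m. \<not> mark d i) \<and>
           (\<forall>j<k. snd d ! (m + j) \<noteq> Letter mem)) \<longleftrightarrow>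
    (\<exists>r\<le>?n. symbol v y r = Letter mem \<and> r \<notin> f ` {..<m} \<and> (\<forall>j<k. g j r \<noteq> Letter mem))"
  proof -
    have "(snd (datum v ?zs r) ! (m + k) = Letter mem \<and> (\<forall>i<m. \<not> mark (datum v ?zs r) i) \<and>
           (\<forall>j<k. snd (datum v ?zs r) ! (m + j) \<noteq> Letter mem)) \<longleftrightarrow>
      (symbol v y r = Letter mem \<and> r \<notin> f ` {..<m} \<and> (\<forall>j<k. g j r \<noteq> Letter mem))" for r
    proof -
      have "(\<forall>j<k. snd (datum v ?zs r) ! (m + j) \<noteq> Letter mem) \<longleftrightarrow> (\<forall>j<k. g j r \<noteq> Letter mem)"
        using cell[of "m + _" r] zs(2) by (simp add: g_def)
      moreover have "(\<forall>i<m. \<not> mark (datum v ?zs r) i) \<longleftrightarrow> r \<notin> f ` {..<m}" using mk by auto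
      ultimately show ?thesis using cell[of "m + k" r] zs(3) by simp
    qed
    then show ?thesis
      by (simp only: bex_simps(7) lessThan_Suc_atMost) (simp only: Bex_def atMost_iff)
  qed
  show ?thesis
  \<comment> \<open>The readings of traces and distinctness assume that all marks fall within the
    scan; otherwise the first conjunct fails on both sides.\<close>
  proof (cases "\<forall>i<m. 0 < f i \<and> f i \<le> ?n")
    case False
    then show ?thesis unfolding matrix_def \<Phi>_def Let_def A using el by blast
  next
    case True
    then have f: "\<forall>i<m. f i \<le> ?n" by blast
    have 1: "(\<forall>i<m. element_ok ?A i) \<longleftrightarrow> True" using el True by blast
    have 2: "(\<forall>j<k. block_ok ?A (m + j) \<and> data_trace ?A (m + j) = D j) \<longleftrightarrow>
      (\<forall>j<k. g j 0 = Letter Sep \<and> {i. i < m \<and> g j (f i) = Letter mem} = D j)"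
      using bl[of "m + _"] tr[OF _ f, of "m + _"] zs(2) by (simp add: g_def)
    have 3: "block_ok ?A (m + k) \<longleftrightarrow> symbol v y 0 = Letter Sep"
      "data_trace ?A (m + k) = {i. i < m \<and> symbol v y (f i) = Letter mem}"
      using bl[of "m + k"] tr[OF _ f, of "m + k"] zs(3) by simp_all
    show ?thesis unfolding matrix_def \<Phi>_def Let_def A 1 2 3 ex dist[OF f] using True by simp
  qed
qed

end

section \<open>Addresses in a listing\<close>

lemma length_concat_blocks: "(\<And>xs. xs \<in> set xss \<Longrightarrow> length xs = d) \<Longrightarrow> length (concat xss) = length xss * d"
  by (induction xss) auto

lemma nth_concat_blocks:
  assumes "\<And>xs. xs \<in> set xss \<Longrightarrow> length xs = d" "i < length xss" "j < d"
  shows "concat xss ! (i * d + j) = xss ! i ! j"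
  using assms
proof (induction xss arbitrary: i)
  case (Cons xs xss)
  show ?case
  proof (cases i)
    case 0
    then show ?thesis using Cons.prems by (simp add: nth_append)
  next
    case (Suc i')
    have "length xs = d" using Cons.prems(1) by simp
    moreover have "concat xss ! (i' * d + j) = xss ! i' ! j"
      using Cons Suc by simp
    ultimately show ?thesis using Suc by (simp add: nth_append add.assoc)
  qed
qed simp

locale listed_word =
  fixes n :: nat and Xs :: "nat set list" and v :: word
  assumes v: "v = replicate n One @ listing n Xs"
begin

text \<open>Position of the separator of block \<open>i\<close>: behind the \<open>n\<close> initial
  ones, every block has length \<open>Suc n\<close>.\<close>

definition home :: "nat \<Rightarrow> nat" where
  "home i = n + i * Suc n"

lemma listing_blocks: "X \<in> set (map (\<lambda>X. Sep # char_vector n X) Xs) \<Longrightarrow> length X = Suc n"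
  by (auto simp: char_vector_def)

lemma length_v: "length v = n + length Xs * Suc n"
  unfolding v listing_def
  using length_concat_blocks[of "map (\<lambda>X. Sep # char_vector n X) Xs", OF listing_blocks] by simp

lemma ruler_v: "ruler v = n"
proof -
  have "takeWhile (\<lambda>a. a = One) (listing n Xs) = []"
    unfolding listing_def by (cases Xs) auto
  then have "takeWhile (\<lambda>a. a = One) v = replicate n One"
    unfolding v by (simp add: takeWhile_append)
  then show ?thesis unfolding ruler_def by simp
qed

lemma home_le: "i < length Xs \<Longrightarrow> home i \<le> length v"
  unfolding home_def length_v by (intro add_left_mono mult_right_mono) auto

lemma symbol_block:
  assumes i: "i < length Xs" and j: "j < Suc n"
  shows "symbol v (home i) j = Letter ((Sep # char_vector n (Xs ! i)) ! j)"
proof -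
  have "i * Suc n + j < Suc i * Suc n" using j by simp
  also have "\<dots> \<le> length Xs * Suc n" using i by (intro mult_right_mono) auto
  finally have lt: "i * Suc n + j < length Xs * Suc n" .
  have "v ! (home i + j) = listing n Xs ! (i * Suc n + j)"
    unfolding v home_def by (simp add: nth_append add.assoc)
  also have "\<dots> = map (\<lambda>X. Sep # char_vector n X) Xs ! i ! j"
    unfolding listing_def by (rule nth_concat_blocks[OF listing_blocks]) (use i j in auto)
  finally have "v ! (home i + j) = (Sep # char_vector n (Xs ! i)) ! j" using i by simp
  moreover have "home i + j < length v" using lt unfolding home_def length_v by simp
  ultimately show ?thesis unfolding symbol_def word_tape_def by (simp add: nat_add_distrib)
qed

lemma symbol_home: "i < length Xs \<Longrightarrow> symbol v (home i) 0 = Letter Sep"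
  using symbol_block[of i 0] by simp

lemma symbol_home_Suc:
  "i < length Xs \<Longrightarrow> q < n \<Longrightarrow> symbol v (home i) (Suc q) = Letter (if q \<in> Xs ! i then One else Zero)"
  using symbol_block[of i "Suc q"] by (simp add: char_vector_def)

text \<open>A cell before position \<open>n\<close> holds a one, and a nonzero remainder modulo
  \<open>Suc n\<close> points into a characteristic vector. Hence a head that sees a separator has
  found a listed set.\<close>

lemma symbol_Sep:
  assumes "symbol v x 0 = Letter Sep"
  obtains i where "i < length Xs" "x = home i"
proof -
  have x: "x < length v" "v ! x = Sep"
    using assms unfolding symbol_def word_tape_def by (auto split: if_splits)
  have "n \<le> x" using x unfolding v by (metis letter.distinct(5) not_le nth_append length_replicate nth_replicate)
  let ?i = "(x - n) div Suc n" and ?j = "(x - n) mod Suc n"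
  have eq: "x = home ?i + ?j" unfolding home_def using \<open>n \<le> x\<close> div_mult_mod_eq[of "x - n" "Suc n"] by linarith
  have "x - n < length Xs * Suc n" using x(1) \<open>n \<le> x\<close> unfolding length_v by linarith
  then have i: "?i < length Xs" by (simp add: less_mult_imp_div_less)
  have "?j = 0"
  proof (rule ccontr)
    assume "?j \<noteq> 0"
    then obtain q where q: "?j = Suc q" "q < n"
      by (metis Suc_less_SucD less_Suc_eq_0_disj mod_less_divisor zero_less_Suc)
    have "symbol v x 0 = symbol v (home ?i) (Suc q)"
      by (subst eq) (simp only: symbol_def q(1), simp add: algebra_simps)
    then show False using symbol_home_Suc[OF i q(2)] assms by (simp split: if_splits)
  qed
  then show thesis using that[OF i] eq by simp
qed

text \<open>From cell \<open>n - 1 - e\<close>, exactly \<open>Suc e\<close> ones remain in the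
  initial block, followed by a separator or a blank. The mark falls on offset \<open>Suc e\<close>,
  where a block shows its entry for \<open>e\<close>, one place behind the separator.\<close>

lemma first_element:
  assumes "e < n"
  shows "first v (n - 1 - e) = Suc e" "n - 1 - e \<le> length v"
proof -
  have one: "symbol v (n - 1 - e) r = Letter One" if "r < Suc e" for r
  proof -
    have "n - 1 - e + r < ruler v" using that assms unfolding ruler_v by simp
    from word_tape_below_ruler[OF this] show ?thesis unfolding symbol_def by simp
  qed
  have "symbol v (n - 1 - e) (Suc e) \<noteq> Letter One"
  proof -
    have "int (n - 1 - e) + int (Suc e) = int (ruler v)" using assms unfolding ruler_v by simp
    then show ?thesis unfolding symbol_def using word_tape_ruler[of v] by simp
  qed
  with one have "(\<forall>r<Suc e. symbol v (n - 1 - e) r = Letter One) \<and>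
      symbol v (n - 1 - e) (Suc e) \<noteq> Letter One"
    by (intro conjI allI impI)
  then show "first v (n - 1 - e) = Suc e" unfolding first_iff by (rule sym)
  show "n - 1 - e \<le> length v" unfolding length_v by simp
qed

text \<open>For \<open>One\<close> this is the part of \<open>X\<close> below \<open>n\<close>, for
  \<open>Zero\<close> the complement of \<open>X\<close> below \<open>n\<close>.\<close>

definition marked :: "letter \<Rightarrow> nat set \<Rightarrow> nat set" where
  "marked a X = {q. q < n \<and> (q \<in> X \<longleftrightarrow> a = One)}"

lemma symbol_marked:
  assumes "a \<noteq> Sep" "i < length Xs" "r \<le> n"
  shows "symbol v (home i) r = Letter a \<longleftrightarrow> 0 < r \<and> r - 1 \<in> marked a (Xs ! i)"
proof (cases r)
  case 0
  then show ?thesis using symbol_home[OF assms(2)] assms(1) by auto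
next
  case (Suc q)
  then show ?thesis
    using symbol_home_Suc[OF assms(2), of q] assms(1,3) by (cases a) (auto simp: marked_def)
qed

end

context minor_search
begin

text \<open>Positions decode to a certificate because accepted element heads yield numbers below
  \<open>n\<close> and accepted block heads stand at separators. Conversely, every element and every
  listed set has a home position within the word.\<close>

lemma holds_listing:
  assumes v: "v = replicate n One @ listing n Xs"
  shows "holds v (m + k) [] \<longleftrightarrow>
    minor_certificate m \<I> k D {..<n} ((\<lambda>X. {q. q < n \<and> (q \<in> X \<longleftrightarrow> mem = One)}) ` set Xs)"
proof -
  interpret listed_word n Xs v by unfold_locales (rule v)
  let ?\<C> = "marked mem ` set Xs"
  have mk: "symbol v (home i) (Suc q) = Letter mem \<longleftrightarrow> q \<in> marked mem (Xs ! i)"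
    if "i < length Xs" "q < n" for i q
    using symbol_marked[OF mem that(1), of "Suc q"] that(2) by simp
  have sub: "marked mem X \<subseteq> {..<n}" for X unfolding marked_def by auto
  have "holds v (m + k) [] \<longleftrightarrow> minor_certificate m \<I> k D {..<n} ?\<C>"
  proof
    assume "holds v (m + k) []"
    then obtain ys where len: "length ys = m + k"
      and mat: "\<And>y. y \<le> length v \<Longrightarrow> matrix v (map int (ys @ [y]))"
      unfolding holds_iff by auto
    define f where "f i = first v (ys ! i)" for i
    define g where "g j = symbol v (ys ! (m + j))" for j
    have M: "(\<forall>i<m. 0 < f i \<and> f i \<le> n) \<and> inj_on f {..<m} \<and>
      (\<forall>j<k. g j 0 = Letter Sep \<and> {i. i < m \<and> g j (f i) = Letter mem} = D j) \<and>
      (symbol v y 0 = Letter Sep \<longrightarrow>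
         (\<exists>r\<le>n. symbol v y r = Letter mem \<and> r \<notin> f ` {..<m} \<and> (\<forall>j<k. g j r \<noteq> Letter mem)) \<or>
         {i. i < m \<and> symbol v y (f i) = Letter mem} = {} \<or>
         {i. i < m \<and> symbol v y (f i) = Letter mem} \<notin> \<I>)" if "y \<le> length v" for y
      using mat[OF that] matrix_iff[OF len, of v y] unfolding f_def g_def ruler_v by blast
    have f: "\<And>i. i < m \<Longrightarrow> 0 < f i \<and> f i \<le> n" and inj: "inj_on f {..<m}"
      and g: "\<And>j. j < k \<Longrightarrow> g j 0 = Letter Sep"
        "\<And>j. j < k \<Longrightarrow> {i. i < m \<and> g j (f i) = Letter mem} = D j"
      using M[OF le0] by simp_all
    have "\<exists>b. b < length Xs \<and> ys ! (m + j) = home b" if "j < k" for j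
      using symbol_Sep[of "ys ! (m + j)"] g(1)[OF that] unfolding g_def by metis
    then obtain b where b: "\<And>j. j < k \<Longrightarrow> b j < length Xs \<and> ys ! (m + j) = home (b j)" by metis
    \<comment> \<open>The head may also stand before a run of ones inside a listed vector. Since
      \<open>f i\<close> lies between 1 and \<open>n\<close>, it denotes an element all the
      same.\<close>
    define e where "e i = f i - 1" for i
    have fe: "f i = Suc (e i)" "e i < n" if "i < m" for i
      using f[OF that] unfolding e_def by linarith+
    have gm: "g j (Suc q) = Letter mem \<longleftrightarrow> q \<in> marked mem (Xs ! b j)" if "j < k" "q < n" for j q
      using mk[of "b j" q] b[OF that(1)] that(2) unfolding g_def by simp
    have tr: "trace m e (marked mem (Xs ! i)) = {i'. i' < m \<and> symbol v (home i) (f i') = Letter mem}"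
      if "i < length Xs" for i
      unfolding trace_def using mk[OF that] fe by auto
    have inj_e: "inj_on e {..<m}"
    proof (rule inj_onI)
      fix i i' assume "i \<in> {..<m}" "i' \<in> {..<m}" "e i = e i'"
      then show "i = i'" using inj_onD[OF inj, of i i'] fe(1) by simp
    qed
    have F: "marked mem (Xs ! b j) \<in> ?\<C> \<and> trace m e (marked mem (Xs ! b j)) = D j" if "j < k" for j
      using tr[of "b j"] b[OF that] g(2)[OF that] unfolding g_def by simp
    have "(\<exists>x\<in>C. x \<notin> e ` {..<m} \<and> (\<forall>j<k. x \<notin> marked mem (Xs ! b j))) \<or>
        trace m e C = {} \<or> trace m e C \<notin> \<I>" if C: "C \<in> ?\<C>" for C
    proof -
      obtain i where i: "i < length Xs" "C = marked mem (Xs ! i)"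
        using C by (auto simp: in_set_conv_nth)
      from M[OF home_le[OF i(1)]] symbol_home[OF i(1)]
      have "(\<exists>r\<le>n. symbol v (home i) r = Letter mem \<and> r \<notin> f ` {..<m} \<and> (\<forall>j<k. g j r \<noteq> Letter mem)) \<or>
         trace m e C = {} \<or> trace m e C \<notin> \<I>"
        unfolding i(2) tr[OF i(1)] by simp
      then show ?thesis
      proof (elim disjE exE conjE)
        fix r assume r: "r \<le> n" "symbol v (home i) r = Letter mem" "r \<notin> f ` {..<m}"
          "\<forall>j<k. g j r \<noteq> Letter mem"
        then obtain q where q: "r = Suc q" "q \<in> C"
          using symbol_marked[OF mem i(1) r(1)] i(2) by (cases r) auto
        have "q < n" using r(1) q(1) by simp
        moreover have "q \<notin> e ` {..<m}" using r(3) fe(1) q(1) by (auto simp: image_iff)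
        ultimately have "\<exists>x\<in>C. x \<notin> e ` {..<m} \<and> (\<forall>j<k. x \<notin> marked mem (Xs ! b j))"
          using q r(4) gm by blast
        then show ?thesis ..
      qed simp_all
    qed
    then show "minor_certificate m \<I> k D {..<n} ?\<C>"
      unfolding minor_certificate_def using inj_e fe(2) F
      by (intro exI[of _ e] exI[of _ "\<lambda>j. marked mem (Xs ! b j)"]) auto
  next
    assume "minor_certificate m \<I> k D {..<n} ?\<C>"
    then obtain e F where inj: "inj_on e {..<m}" and e: "e ` {..<m} \<subseteq> {..<n}"
      and F: "\<forall>j<k. F j \<in> ?\<C> \<and> trace m e (F j) = D j"
      and all: "\<forall>C\<in>?\<C>. (\<exists>x\<in>C. x \<notin> e ` {..<m} \<and> (\<forall>j<k. x \<notin> F j)) \<or>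
           trace m e C = {} \<or> trace m e C \<notin> \<I>"
      unfolding minor_certificate_def by (elim exE conjE) (rule that)
    have "\<exists>b. b < length Xs \<and> F j = marked mem (Xs ! b)" if "j < k" for j
      using F that by (metis imageE in_set_conv_nth)
    then obtain b where b: "\<And>j. j < k \<Longrightarrow> b j < length Xs \<and> F j = marked mem (Xs ! b j)" by metis
    \<comment> \<open>Element heads are placed among the initial ones, block heads on the separators
      of the sets \<open>F j\<close>.\<close>
    let ?ys = "map (\<lambda>i. n - 1 - e i) [0..<m] @ map (\<lambda>j. home (b j)) [0..<k]"
    have len: "length ?ys = m + k" by simp
    have en: "e i < n" if "i < m" for i using e that by auto
    have f: "first v (?ys ! i) = Suc (e i)" if "i < m" for i
      using that first_element(1)[OF en[OF that]] by (simp add: nth_append)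
    have g: "?ys ! (m + j) = home (b j)" if "j < k" for j
      using that by (simp add: nth_append)
    have tr: "{i'. i' < m \<and> symbol v (home i) (first v (?ys ! i')) = Letter mem} =
        trace m e (marked mem (Xs ! i))" if "i < length Xs" for i
      unfolding trace_def using mk[OF that] f en by auto
    have "matrix v (map int (?ys @ [y]))" for y
      unfolding matrix_iff[OF len, of v y] ruler_v
    proof (intro conjI allI impI)
      fix i assume i: "i < m"
      show "0 < first v (?ys ! i)" "first v (?ys ! i) \<le> n" using f[OF i] en[OF i] by simp_all
    next
      show "inj_on (\<lambda>i. first v (?ys ! i)) {..<m}"
        using inj f unfolding inj_on_def by simp
    next
      fix j assume j: "j < k"
      show "symbol v (?ys ! (m + j)) 0 = Letter Sep"
        unfolding g[OF j] by (rule symbol_home) (use b[OF j] in simp)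
      show "{i. i < m \<and> symbol v (?ys ! (m + j)) (first v (?ys ! i)) = Letter mem} = D j"
        unfolding g[OF j] tr[OF b[OF j, THEN conjunct1]] b[OF j, THEN conjunct2, symmetric]
        using F j by blast
    next
      assume "symbol v y 0 = Letter Sep"
      then obtain i where i: "i < length Xs" "y = home i" by (rule symbol_Sep)
      let ?C = "marked mem (Xs ! i)"
      have "?C \<in> ?\<C>" using i(1) by simp
      with all have "(\<exists>x\<in>?C. x \<notin> e ` {..<m} \<and> (\<forall>j<k. x \<notin> F j)) \<or>
           trace m e ?C = {} \<or> trace m e ?C \<notin> \<I>" by (rule bspec)
      moreover have "\<exists>r\<le>n. symbol v y r = Letter mem \<and> r \<notin> (\<lambda>i. first v (?ys ! i)) ` {..<m} \<and>
          (\<forall>j<k. symbol v (?ys ! (m + j)) r \<noteq> Letter mem)"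
        if ex: "\<exists>x\<in>?C. x \<notin> e ` {..<m} \<and> (\<forall>j<k. x \<notin> F j)"
      proof -
        obtain x where x: "x \<in> ?C" "x \<notin> e ` {..<m}" "\<forall>j<k. x \<notin> F j" using ex by blast
        have xn: "x < n" using x(1) sub by auto
        have "symbol v y (Suc x) = Letter mem" using mk[OF i(1) xn] x(1) i(2) by simp
        moreover have "Suc x \<notin> (\<lambda>i. first v (?ys ! i)) ` {..<m}"
          using x(2) f by (auto simp: image_iff)
        moreover have "symbol v (?ys ! (m + j)) (Suc x) \<noteq> Letter mem" if j: "j < k" for j
          unfolding g[OF j] mk[OF b[OF j, THEN conjunct1] xn] b[OF j, THEN conjunct2, symmetric]
          using x(3) j by blast
        ultimately show ?thesis using xn by (intro exI[of _ "Suc x"]) simp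
      qed
      ultimately show "(\<exists>r\<le>n. symbol v y r = Letter mem \<and> r \<notin> (\<lambda>i. first v (?ys ! i)) ` {..<m} \<and>
            (\<forall>j<k. symbol v (?ys ! (m + j)) r \<noteq> Letter mem)) \<or>
          {i. i < m \<and> symbol v y (first v (?ys ! i)) = Letter mem} = {} \<or>
          {i. i < m \<and> symbol v y (first v (?ys ! i)) = Letter mem} \<notin> \<I>"
        unfolding i(2) tr[OF i(1)] by blast
    qed
    moreover have "set ?ys \<subseteq> {..length v}"
      using first_element(2) en home_le b by auto
    ultimately show "holds v (m + k) []"
      unfolding holds_iff using len by (intro exI[of _ ?ys]) simp
  qed
  then show ?thesis unfolding marked_def .
qed

lemma decide_listing_after_reduction:
  assumes "turing_machine R" "polynomial_time R"
  shows "\<exists>T. turing_machine T \<and> polynomial_time T \<and>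
    (\<forall>w v. outputs R w v \<longrightarrow> (if holds v (m + k) [] then accepts T w else rejects T w))"
proof -
  obtain p :: "nat poly" where "\<forall>v. \<exists>t \<le> poly p (length v).
     fst ((mstep v ^^ t) (Rewind, replicate (Suc (Suc (m + k))) (int (length v) - 1))) =
       (if holds v (m + k) [] then Halt True else Halt False)"
    using run_odometer unfolding diff_Suc_1 by blast
  then show ?thesis by (intro decide_after_reduction[OF assms, of p]) blast
qed

end

section \<open>From certificates to the decision problem\<close>

lemma enumerate_finite:
  assumes "finite A"
  obtains k :: nat and f where "f ` {..<k} = A" "inj_on f {..<k}"
  using ex_bij_betw_nat_finite[OF assms] unfolding bij_betw_def atLeast0LessThan by blast

text \<open>Descriptions by circuits and by hyperplanes consist of the initial ones and a plain
  listing, with no rank numerals in between; this is the format that the search reads.\<close>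

lemma detecting_minor_in_P:
  fixes N :: "'b matroid"
  assumes red: "I \<le>\<^sub>P J" and J: "J \<in> {CIRCUITS, HYPERPLANES}" and mem: "mem \<noteq> Sep"
    and crit: "\<And>M :: nat matroid. matroid M \<Longrightarrow> has_minor M N \<longleftrightarrow>
      minor_certificate m \<I> k D (ground M)
        ((\<lambda>X. {q \<in> ground M. q \<in> X \<longleftrightarrow> mem = One}) ` listed_sets J M)"
  shows "in_P (detecting_minor I N)"
proof -
  interpret minor_search m k D \<I> mem by unfold_locales (rule mem)
  obtain R where R: "turing_machine R" "polynomial_time R"
    "\<And>M w. describes I w M \<Longrightarrow> \<exists>v. outputs R w v \<and> describes J v M"
    using red unfolding reducible_def by blast
  obtain T where T: "turing_machine T" "polynomial_time T"
    and dec: "\<And>w v. outputs R w v \<Longrightarrow>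
      (if holds v (m + k) [] then accepts T w else rejects T w)"
    using decide_listing_after_reduction[OF R(1,2)] by blast
  have key: "if has_minor M N then accepts T w else rejects T w" if desc: "describes I w M" for w M
  proof -
    obtain v where v: "outputs R w v" "describes J v M" using R(3)[OF desc] by blast
    let ?n = "card (ground M)"
    obtain Xs where M: "matroid M" "ground M = {..<?n}" and Xs: "set Xs = listed_sets J M"
      and d: "v = description J M Xs"
      using v(2) unfolding describes_def by blast
    have "char_vector ?n (ground M) = replicate ?n One"
      unfolding char_vector_def by (rule nth_equalityI) (use M(2) in auto)
    then have "v = replicate ?n One @ listing ?n Xs"
      using d J by (auto simp: Let_def)
    from holds_listing[OF this]
    have "holds v (m + k) [] \<longleftrightarrow> minor_certificate m \<I> k D (ground M)
        ((\<lambda>X. {q \<in> ground M. q \<in> X \<longleftrightarrow> mem = One}) ` listed_sets J M)"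
      unfolding Xs M(2)[symmetric] by (subst (2) M(2), simp)
    then have "holds v (m + k) [] \<longleftrightarrow> has_minor M N" using crit[OF M(1)] by (rule trans[OF _ sym])
    then show ?thesis using dec[OF v(1)] by simp
  qed
  have "accepts T w" if w: "w \<in> yes_instances (detecting_minor I N)" for w
  proof -
    obtain M where "describes I w M" "has_minor M N"
      using w unfolding detecting_minor_def by auto
    then show ?thesis using key[of w M] by simp
  qed
  moreover have "rejects T w" if w: "w \<in> no_instances (detecting_minor I N)" for w
  proof -
    obtain M where "describes I w M" "\<not> has_minor M N"
      using w unfolding detecting_minor_def by auto
    then show ?thesis using key[of w M] by simp
  qed
  ultimately show ?thesis unfolding in_P_def using T by blast
qed

theorem theorem4:
  fixes I :: input_type and N :: "'b matroid"
  assumes "matroid N"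
    and "I \<le>\<^sub>P CIRCUITS \<or> I \<le>\<^sub>P HYPERPLANES"
  shows "in_P (detecting_minor I N)"
proof -
  obtain m :: nat and g where g: "g ` {..<m} = ground N" "inj_on g {..<m}"
    by (rule enumerate_finite[OF finite_ground[OF assms(1)]])
  then have bij: "bij_betw g {..<m} (ground N)" unfolding bij_betw_def by blast
  have minimal: "\<exists>(k :: nat) D. D ` {..<k} = {P. P \<subseteq> {..<m} \<and> P \<notin> \<I> \<and> (\<forall>Q. Q \<subset> P \<longrightarrow> Q \<in> \<I>)}" for \<I>
  proof -
    have "finite {P. P \<subseteq> {..<m} \<and> P \<notin> \<I> \<and> (\<forall>Q. Q \<subset> P \<longrightarrow> Q \<in> \<I>)}" by simp
    from enumerate_finite[OF this] show ?thesis by metis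
  qed
  from assms(2) show ?thesis
  proof
    assume red: "I \<le>\<^sub>P CIRCUITS"
    let ?I = "{P. P \<subseteq> {..<m} \<and> g ` P \<in> indep N}"
    obtain k :: nat and D where
      D: "D ` {..<k} = {P. P \<subseteq> {..<m} \<and> P \<notin> ?I \<and> (\<forall>Q. Q \<subset> P \<longrightarrow> Q \<in> ?I)}"
      using minimal[of ?I] by metis
    show ?thesis
    proof (rule detecting_minor_in_P[OF red, of One])
      fix M :: "nat matroid" assume M: "matroid M"
      have "{q \<in> ground M. q \<in> C \<longleftrightarrow> One = One} = C" if "C \<in> circuits M" for C
        using that unfolding circuits_def by auto
      then have "(\<lambda>X. {q \<in> ground M. q \<in> X \<longleftrightarrow> One = One}) ` listed_sets CIRCUITS M = circuits M"
        by simp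
      then show "has_minor M N \<longleftrightarrow> minor_certificate m ?I k D (ground M)
          ((\<lambda>X. {q \<in> ground M. q \<in> X \<longleftrightarrow> One = One}) ` listed_sets CIRCUITS M)"
        using has_minor_iff_circuits[OF M assms(1) bij D refl] by simp
    qed simp_all
  next
    assume red: "I \<le>\<^sub>P HYPERPLANES"
    let ?I = "{P. P \<subseteq> {..<m} \<and> g ` P \<in> coindep N}"
    obtain k :: nat and D where
      D: "D ` {..<k} = {P. P \<subseteq> {..<m} \<and> P \<notin> ?I \<and> (\<forall>Q. Q \<subset> P \<longrightarrow> Q \<in> ?I)}"
      using minimal[of ?I] by metis
    show ?thesis
    \<comment> \<open>With \<open>Zero\<close> as membership letter, the listed hyperplanes are read
      as their complements, the circuits of the dual.\<close>
    proof (rule detecting_minor_in_P[OF red, of Zero])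
      fix M :: "nat matroid" assume M: "matroid M"
      have "(\<lambda>X. {q \<in> ground M. q \<in> X \<longleftrightarrow> Zero = One}) ` listed_sets HYPERPLANES M =
          (\<lambda>H. ground M - H) ` hyperplanes M"
        by (simp add: set_diff_eq)
      then show "has_minor M N \<longleftrightarrow> minor_certificate m ?I k D (ground M)
          ((\<lambda>X. {q \<in> ground M. q \<in> X \<longleftrightarrow> Zero = One}) ` listed_sets HYPERPLANES M)"
        using has_minor_iff_hyperplanes[OF M assms(1) bij D refl] by simp
    qed simp_all
  qed
qed

end
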